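(* Let $\mathbf L$ be any weight function and $\mathbf c=\gcd(\mathbf L(s_0),\mathbf L(s_1))$. At the specialization $u=\mathbf v^{\mathbf L(s_0)}$, $v=\mathbf v^{\mathbf L(s_1)}$ there is a canonical basis $\mathfrak B^\imath_{n,d}=\{\{A\}^{\mathbf L}\mid A\in\Xi^\imath\}$ of $\mathbb S^\imath_{n,d}$ such that $\overline{\{A\}^{\mathbf L}}=\{A\}^{\mathbf L}$ and $$\{A\}^{\mathbf L}\in[A]^{\mathbf L}+\sum_{B\in\Xi^\imath,\ B<_{\rm alg}A}\mathbf v^{-\mathbf c}\mathbb Z[\mathbf v^{-\mathbf c}]\,[B]^{\mathbf L}.$$ Moreover $\mathfrak B^\imath_{n,d}=\mathfrak B^\jmath_{n,d}\cap\mathbb S^\imath_{n,d}$ (at this specialization).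
   Context: Index conventions: $\mathbb N=\{0,1,2,\dots\}$; $[a,b]$ is an integer interval; $n,d\in\mathbb N$, $N=2n+1$. $N\times N$ matrices have rows and columns indexed by $[-n,n]$. Weyl group: $W$ is the group of permutations $g$ of $[-d,d]$ with $g(-i)=-g(i)$, a Coxeter group with generators $s_0=(-1,1)$, $s_i=(i,i+1)(-i,-i-1)$ for $1\le i<d$; $\ell$ is its length function. $\Lambda_{n,d}$ is the set of tuples $\lambda=(\lambda_n,\dots,\lambda_1,2\lambda_0+1,\lambda_1,\dots,\lambda_n)$ with $\lambda_i\in\mathbb N$, $\sum_{i=0}^n\lambda_i=d$; $\Lambda^\imath_{n,d}$ is the subset with $\lambda_0=0$. Put $R^\lambda_0=[-\lambda_0,\lambda_0]$, $R^\lambda_i=[\lambda_0+\sum_{1\le j<i}\lambda_j+1,\ \lambda_0+\sum_{1\le j\le i}\lambda_j]$ and $R^\lambda_{-i}=-R^\lambda_i$ for $0<i\le n$. $W_\lambda$ is the (parabolic) subgroup of $w\in W$ with $w(R^\lambda_i)=R^\lambda_i$ for all $i$; $\mathscr D_{\lambda\mu}$ is the set of minimal length representatives of $W_\lambda\backslash W/W_\mu$. Matrices: $\Xi_{n,d}$ is the set of $N\times N$ matrices over $\mathbb N$ with $a_{ij}=a_{-i,-j}$, $a_{00}$ odd and $\sum_{ij}a_{ij}=2d+1$. $\mathrm{row}(A)_k=\sum_ja_{kj}$, $\mathrm{col}(A)_k=\sum_ia_{ik}$. $\Xi^\imath=\{A\in\Xi_{n,d}:\mathrm{row}(A)_0=1=\mathrm{col}(A)_0\}$.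 The map $\kappa(\lambda,g,\mu)=(|R_i^\lambda\cap gR_j^\mu|)_{ij}$ is a bijection from triples ($\lambda,\mu\in\Lambda_{n,d}$, $g\in\mathscr D_{\lambda\mu}$) to $\Xi_{n,d}$. Partial order: $A\le_{\rm alg}B$ iff $\mathrm{row}(A)=\mathrm{row}(B)$, $\mathrm{col}(A)=\mathrm{col}(B)$ and $\sum_{x\le i,y\ge j}a_{xy}\le\sum_{x\le i,y\ge j}b_{xy}$ for all $i<j$; $A<_{\rm alg}B$ means in addition $A\ne B$. Schur algebras: $\mathbb A=\mathbb Z[u^{\pm1},v^{\pm1}]$. The Hecke algebra $\mathbb H$ is the $\mathbb A$-algebra with basis $T_w$ ($w\in W$), $T_wT_{w'}=T_{ww'}$ if $\ell(ww')=\ell(w)+\ell(w')$, $(T_{s_0}+1)(T_{s_0}-u^2)=0$, $(T_{s_i}+1)(T_{s_i}-v^2)=0$ for $i\ge1$. Let $x_\lambda=\sum_{w\in W_\lambda}T_w$; $\mathbb S^\jmath_{n,d}=\mathrm{End}_{\mathbb H}(\bigoplus_{\lambda\in\Lambda_{n,d}}x_\lambda\mathbb H)$ and $\mathbb S^\imath_{n,d}=\mathrm{End}_{\mathbb H}(\bigoplus_{\lambda\in\Lambda^\imath_{n,d}}x_\lambda\mathbb H)\subset\mathbb S^\jmath_{n,d}$ (right $\mathbb H$-linear endomorphisms). For $A=\kappa(\lambda,g,\mu)$, $e_A:x_\mu\mathbb H\to x_\lambda\mathbb H$, $x_\mu\mapsto\sum_{w\in W_\lambda gW_\mu}T_w$.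 Let $I_{\mathfrak a}=(\{0\}\times[1,n])\sqcup([1,n]\times[-n,n])$, $I_{\mathfrak c}=I_{\mathfrak a}\sqcup\{(0,0)\}$, $a_{00}^\natural=\frac12(a_{00}-1)$, $a_{ij}^\natural=a_{ij}$ on $I_{\mathfrak a}$, $$\hat\ell(A)=\tfrac12\sum_{(i,j)\in I_{\mathfrak c}}\Big(\sum_{x\le i,\,y>j}+\sum_{x\ge i,\,y<j}\Big)a^\natural_{ij}a_{xy},\quad \hat\ell_{\mathfrak c}(A)=\tfrac12\Big(\sum_{x\ge0,\,y<0}+\sum_{x\le0,\,y>0}\Big)a_{xy},\quad \hat\ell_{\mathfrak a}=\hat\ell-\hat\ell_{\mathfrak c},$$ $[A]=u^{-\hat\ell_{\mathfrak c}(A)}v^{-\hat\ell_{\mathfrak a}(A)}e_A$. The $[A]$, $A\in\Xi_{n,d}$ (resp. $A\in\Xi^\imath$), form an $\mathbb A$-basis of $\mathbb S^\jmath_{n,d}$ (resp. $\mathbb S^\imath_{n,d}$). Bar involution: on $\mathbb H$, the ring involution $u\mapsto u^{-1}$, $v\mapsto v^{-1}$, $T_w\mapsto T_{w^{-1}}^{-1}$; on $\mathbb S^\jmath_{n,d}$, for $f\in\mathrm{Hom}_{\mathbb H}(x_\mu\mathbb H,x_\lambda\mathbb H)$, $\bar f$ is $\mathbb H$-linear with $\bar f(x_\mu)=\overline{f(\overline{x_\mu})}$; it restricts to $\mathbb S^\imath_{n,d}$. Specialization: a weight function $\mathbf L:W\to\mathbb N$ (additive on reduced products) is given by $\mathbf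 L(s_0)$ and $\mathbf L(s_1)=\dots=\mathbf L(s_{d-1})$. Specializing means base change along $\mathbb A\to\mathbb Z[\mathbf v^{\mathbf c},\mathbf v^{-\mathbf c}]$, $u\mapsto\mathbf v^{\mathbf L(s_0)}$, $v\mapsto\mathbf v^{\mathbf L(s_1)}$ ($\mathbf v$ an indeterminate) with induced bar involution ($\mathbf v\mapsto\mathbf v^{-1}$); $[A]^{\mathbf L}$ is the image of $[A]$. $\mathfrak B^\jmath_{n,d}$ is the canonical basis of the specialization of $\mathbb S^\jmath_{n,d}$: its elements are indexed by $A\in\Xi_{n,d}$ and characterized by being bar invariant and lying in $[A]^{\mathbf L}+\sum_{B\in\Xi_{n,d},\,B<_{\rm alg}A}\mathbf v^{-\mathbf c}\mathbb Z[\mathbf v^{-\mathbf c}][B]^{\mathbf L}$. *)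

theory Defs
  imports
    Complex_Main
    "HOL-Library.Poly_Mapping"
    "HOL-Library.Product_Plus"
    "HOL-Library.Function_Algebras"
    "HOL-Combinatorics.Permutations"
begin

section \<open>The Weyl group\<close>

definition weyl :: "nat \<Rightarrow> (int \<Rightarrow> int) set" where
  "weyl d = {g. g permutes {- int d..int d} \<and> (\<forall>i. g (- i) = - g i)}"

definition sgen :: "nat \<Rightarrow> int \<Rightarrow> int" where
  "sgen i = (if i = 0 then Transposition.transpose (-1) 1
     else Transposition.transpose (int i) (int i + 1) \<circ> Transposition.transpose (- int i) (- int i - 1))"

definition weyl_len :: "nat \<Rightarrow> (int \<Rightarrow> int) \<Rightarrow> nat" where
  "weyl_len d w = (LEAST k. \<exists>is. length is = k \<and> set is \<subseteq> {..<d} \<and> w = foldr (\<lambda>i g. sgen i \<circ> g) is id)"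

text \<open>The function \<open>L\<close> is total, so for \<open>d \<le> 1\<close> the values \<open>L (sgen 0)\<close>, \<open>L (sgen 1)\<close>
  at generators that do not belong to the group are arbitrary natural numbers.\<close>

definition weight_function :: "nat \<Rightarrow> ((int \<Rightarrow> int) \<Rightarrow> nat) \<Rightarrow> bool" where
  "weight_function d L \<longleftrightarrow> (\<forall>w\<in>weyl d. \<forall>w'\<in>weyl d.
     weyl_len d (w \<circ> w') = weyl_len d w + weyl_len d w' \<longrightarrow> L (w \<circ> w') = L w + L w')"

text \<open>A tuple \<open>(\<lambda>\<^sub>n, \<dots>, \<lambda>\<^sub>1, 2\<lambda>\<^sub>0 + 1, \<lambda>\<^sub>1, \<dots>, \<lambda>\<^sub>n)\<close> is encoded by
  the function \<open>i \<mapsto> \<lambda>\<^sub>i\<close>, extended by zero beyond \<open>n\<close>.\<close>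

definition Lam :: "nat \<Rightarrow> nat \<Rightarrow> (nat \<Rightarrow> nat) set" where
  "Lam n d = {l. (\<forall>i>n. l i = 0) \<and> (\<Sum>i\<le>n. l i) = d}"

definition Lam_i :: "nat \<Rightarrow> nat \<Rightarrow> (nat \<Rightarrow> nat) set" where
  "Lam_i n d = {l \<in> Lam n d. l 0 = 0}"

text \<open>For \<open>l \<in> Lam n d\<close> the blocks \<open>block l i\<close> with \<open>\<bar>i\<bar> > n\<close> are empty.\<close>

definition block :: "(nat \<Rightarrow> nat) \<Rightarrow> int \<Rightarrow> int set" where
  "block l i =
    (let P = (\<lambda>k::nat. {int (l 0 + (\<Sum>j=1..<k. l j)) + 1 .. int (l 0 + (\<Sum>j=1..k. l j))})
     in if i = 0 then {- int (l 0)..int (l 0)}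
        else if i > 0 then P (nat i) else uminus ` P (nat (- i)))"

definition parabolic :: "nat \<Rightarrow> (nat \<Rightarrow> nat) \<Rightarrow> (int \<Rightarrow> int) set" where
  "parabolic d l = {w \<in> weyl d. \<forall>i. w ` block l i = block l i}"

definition double_coset ::
    "nat \<Rightarrow> (nat \<Rightarrow> nat) \<Rightarrow> (int \<Rightarrow> int) \<Rightarrow> (nat \<Rightarrow> nat) \<Rightarrow> (int \<Rightarrow> int) set" where
  "double_coset d l g m = {w \<circ> g \<circ> w' | w w'. w \<in> parabolic d l \<and> w' \<in> parabolic d m}"

definition min_reps :: "nat \<Rightarrow> (nat \<Rightarrow> nat) \<Rightarrow> (nat \<Rightarrow> nat) \<Rightarrow> (int \<Rightarrow> int) set" where
  "min_reps d l m = {g \<in> weyl d. \<forall>w\<in>double_coset d l g m. weyl_len d g \<le> weyl_len d w}"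


section \<open>Matrices\<close>

abbreviation idx :: "nat \<Rightarrow> int set" where
  "idx n \<equiv> {- int n..int n}"

type_synonym mat = "int \<Rightarrow> int \<Rightarrow> nat"

text \<open>A matrix with rows and columns indexed by \<open>[-n, n]\<close> is extended by zero to all
  integer indices.\<close>

definition Xi :: "nat \<Rightarrow> nat \<Rightarrow> mat set" where
  "Xi n d = {A. (\<forall>i j. i \<notin> idx n \<or> j \<notin> idx n \<longrightarrow> A i j = 0) \<and>
     (\<forall>i\<in>idx n. \<forall>j\<in>idx n. A i j = A (- i) (- j)) \<and>
     odd (A 0 0) \<and> (\<Sum>i\<in>idx n. \<Sum>j\<in>idx n. A i j) = 2 * d + 1}"

definition row :: "nat \<Rightarrow> mat \<Rightarrow> int \<Rightarrow> nat" where
  "row n A k = (\<Sum>j\<in>idx n. A k j)"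

definition col :: "nat \<Rightarrow> mat \<Rightarrow> int \<Rightarrow> nat" where
  "col n A k = (\<Sum>i\<in>idx n. A i k)"

definition Xi_i :: "nat \<Rightarrow> nat \<Rightarrow> mat set" where
  "Xi_i n d = {A \<in> Xi n d. row n A 0 = 1 \<and> col n A 0 = 1}"

definition le_alg :: "nat \<Rightarrow> mat \<Rightarrow> mat \<Rightarrow> bool" where
  "le_alg n A B \<longleftrightarrow> (\<forall>k\<in>idx n. row n A k = row n B k) \<and> (\<forall>k\<in>idx n. col n A k = col n B k) \<and>
     (\<forall>i\<in>idx n. \<forall>j\<in>idx n. i < j \<longrightarrow>
        (\<Sum>x\<in>{- int n..i}. \<Sum>y\<in>{j..int n}. A x y) \<le> (\<Sum>x\<in>{- int n..i}. \<Sum>y\<in>{j..int n}. B x y))"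

definition less_alg :: "nat \<Rightarrow> mat \<Rightarrow> mat \<Rightarrow> bool" where
  "less_alg n A B \<longleftrightarrow> le_alg n A B \<and> A \<noteq> B"

definition triples :: "nat \<Rightarrow> nat \<Rightarrow> ((nat \<Rightarrow> nat) \<times> (int \<Rightarrow> int) \<times> (nat \<Rightarrow> nat)) set" where
  "triples n d = {(l, g, m). l \<in> Lam n d \<and> m \<in> Lam n d \<and> g \<in> min_reps d l m}"

definition kappa :: "(nat \<Rightarrow> nat) \<times> (int \<Rightarrow> int) \<times> (nat \<Rightarrow> nat) \<Rightarrow> mat" where
  "kappa = (\<lambda>(l, g, m) i j. card (block l i \<inter> g ` block m j))"

definition I_c :: "nat \<Rightarrow> (int \<times> int) set" where
  "I_c n = {(0, 0)} \<union> ({0} \<times> {1..int n}) \<union> ({1..int n} \<times> idx n)"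

definition natural :: "mat \<Rightarrow> mat" where
  "natural A i j = (if i = 0 \<and> j = 0 then (A 0 0 - 1) div 2 else A i j)"

text \<open>The sums that are halved are even for \<open>A \<in> Xi n d\<close>, so \<open>div\<close> is exact division.\<close>

definition lhat :: "nat \<Rightarrow> mat \<Rightarrow> int" where
  "lhat n A = int ((\<Sum>(i, j)\<in>I_c n. natural A i j *
     ((\<Sum>x\<in>{- int n..i}. \<Sum>y\<in>{j<..int n}. A x y) +
      (\<Sum>x\<in>{i..int n}. \<Sum>y\<in>{- int n..<j}. A x y))) div 2)"

definition lhat_c :: "nat \<Rightarrow> mat \<Rightarrow> int" where
  "lhat_c n A = int (((\<Sum>x\<in>{0..int n}. \<Sum>y\<in>{- int n..<0}. A x y) +
     (\<Sum>x\<in>{- int n..0}. \<Sum>y\<in>{0<..int n}. A x y)) div 2)"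

definition lhat_a :: "nat \<Rightarrow> mat \<Rightarrow> int" where
  "lhat_a n A = lhat n A - lhat_c n A"


section \<open>Laurent polynomials\<close>

text \<open>Laurent polynomials are group rings of free abelian groups: \<open>lau2\<close> is the ring
  \<open>\<int>[u\<^sup>\<plusminus>\<^sup>1, v\<^sup>\<plusminus>\<^sup>1]\<close>, where \<open>mon i j\<close> is \<open>u\<^sup>i v\<^sup>j\<close>, and \<open>lau1\<close> is the ring
  of Laurent polynomials in the indeterminate of the specialization.\<close>

type_synonym lau2 = "(int \<times> int) \<Rightarrow>\<^sub>0 int"
type_synonym lau1 = "int \<Rightarrow>\<^sub>0 int"

definition mon :: "int \<Rightarrow> int \<Rightarrow> lau2" where
  "mon i j = Poly_Mapping.single (i, j) 1"

definition lau_bar :: "('e::ab_group_add \<Rightarrow>\<^sub>0 int) \<Rightarrow> ('e \<Rightarrow>\<^sub>0 int)" where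
  "lau_bar = Poly_Mapping.map_key uminus"

text \<open>The subring generated by the \<open>c\<close>-th powers of the indeterminate and its inverse.\<close>

definition lau_sub :: "nat \<Rightarrow> lau1 set" where
  "lau_sub c = {p. Poly_Mapping.keys p \<subseteq> {int c * k | k. True}}"

text \<open>With \<open>x\<close> the \<open>-c\<close>-th power of the indeterminate, this is \<open>x \<int>[x]\<close>
  (all of \<open>\<int>\<close> if \<open>c = 0\<close>).\<close>

definition lau_neg :: "nat \<Rightarrow> lau1 set" where
  "lau_neg c = {p. Poly_Mapping.keys p \<subseteq> {- int c * k | k. k \<ge> 1}}"

definition lau_spec :: "nat \<Rightarrow> nat \<Rightarrow> lau2 \<Rightarrow> lau1" where
  "lau_spec a b p = (\<Sum>(i, j)\<in>Poly_Mapping.keys p.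
     Poly_Mapping.single (int a * i + int b * j) (Poly_Mapping.lookup p (i, j)))"


section \<open>Base change of modules\<close>

text \<open>Let \<open>S\<close> be a module with scalar multiplication \<open>smul\<close>, let \<open>\<phi>\<close> be a ring homomorphism
  and \<open>C\<close> a subring containing its image. The base change of \<open>S\<close> along \<open>\<phi>\<close> is the tensor
  product \<open>C \<otimes> S\<close>, presented as the free \<open>C\<close>-module on the set \<open>S\<close>
  (\<open>single x c\<close> standing for \<open>c \<otimes> x\<close>) modulo the relations below.\<close>

definition bc_free :: "'m set \<Rightarrow> 'c::ring_1 set \<Rightarrow> ('m \<Rightarrow>\<^sub>0 'c) set" where
  "bc_free S C = {h. Poly_Mapping.keys h \<subseteq> S \<and> (\<forall>x. Poly_Mapping.lookup h x \<in> C)}"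

inductive_set bc_rel ::
    "'m::ab_group_add set \<Rightarrow> ('a \<Rightarrow> 'm \<Rightarrow> 'm) \<Rightarrow> ('a \<Rightarrow> 'c::ring_1) \<Rightarrow> 'c set \<Rightarrow> ('m \<Rightarrow>\<^sub>0 'c) set"
  for S smul \<phi> C where
  add: "x \<in> S \<Longrightarrow> y \<in> S \<Longrightarrow> c \<in> C \<Longrightarrow>
    Poly_Mapping.single (x + y) c - Poly_Mapping.single x c - Poly_Mapping.single y c
      \<in> bc_rel S smul \<phi> C"
| smul: "x \<in> S \<Longrightarrow> c \<in> C \<Longrightarrow>
    Poly_Mapping.single (smul a x) c - Poly_Mapping.single x (c * \<phi> a) \<in> bc_rel S smul \<phi> C"
| diff: "h \<in> bc_rel S smul \<phi> C \<Longrightarrow> h' \<in> bc_rel S smul \<phi> C \<Longrightarrow> h - h' \<in> bc_rel S smul \<phi> C"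

definition bc_class ::
    "'m::ab_group_add set \<Rightarrow> ('a \<Rightarrow> 'm \<Rightarrow> 'm) \<Rightarrow> ('a \<Rightarrow> 'c::ring_1) \<Rightarrow> 'c set \<Rightarrow>
     ('m \<Rightarrow>\<^sub>0 'c) \<Rightarrow> ('m \<Rightarrow>\<^sub>0 'c) set" where
  "bc_class S smul \<phi> C h = {h' \<in> bc_free S C. h' - h \<in> bc_rel S smul \<phi> C}"


section \<open>The Hecke algebra\<close>

definition ring_inv :: "'h::ring_1 \<Rightarrow> 'h" where
  "ring_inv x = (THE y. x * y = 1 \<and> y * x = 1)"

type_synonym 'h endo = "((nat \<Rightarrow> nat) \<Rightarrow> 'h) \<Rightarrow> ((nat \<Rightarrow> nat) \<Rightarrow> 'h)"

text \<open>Elements of the specialized algebras are classes (cosets) of formal combinations.\<close>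

type_synonym 'h spec_elt = "('h endo \<Rightarrow>\<^sub>0 lau1) set"

text \<open>An algebra with basis \<open>T w\<close> and the defining relations; these determine the multiplication,
  so the algebra is unique up to isomorphism.\<close>

locale hecke_algebra = module scale
  for scale :: "lau2 \<Rightarrow> 'h::ring_1 \<Rightarrow> 'h" +
  fixes d :: nat
    and T :: "(int \<Rightarrow> int) \<Rightarrow> 'h"
  assumes scale_mult_left: "scale a (x * y) = scale a x * y"
    and scale_mult_right: "scale a (x * y) = x * scale a y"
    and inj_T: "inj_on T (weyl d)"
    and independent_T: "independent (T ` weyl d)"
    and span_T: "span (T ` weyl d) = UNIV"
    and T_mult: "w \<in> weyl d \<Longrightarrow> w' \<in> weyl d \<Longrightarrow>
      weyl_len d (w \<circ> w') = weyl_len d w + weyl_len d w' \<Longrightarrow> T w * T w' = T (w \<circ> w')"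
    and quadratic_0: "0 < d \<Longrightarrow> (T (sgen 0) + 1) * (T (sgen 0) - scale (mon 2 0) 1) = 0"
    and quadratic: "1 \<le> i \<Longrightarrow> i < d \<Longrightarrow>
      (T (sgen i) + 1) * (T (sgen i) - scale (mon 0 2) 1) = 0"
begin

text \<open>Semilinear extension of \<open>T w \<mapsto> (T (inv w))\<^sup>-\<^sup>1\<close>.\<close>

definition hbar :: "'h \<Rightarrow> 'h" where
  "hbar h = (\<Sum>w\<in>weyl d.
     scale (lau_bar (representation (T ` weyl d) h (T w))) (ring_inv (T (inv w))))"

definition xx :: "(nat \<Rightarrow> nat) \<Rightarrow> 'h" where
  "xx l = (\<Sum>w\<in>parabolic d l. T w)"


section \<open>The Schur algebras\<close>

text \<open>The direct sum of the right ideals generated by \<open>xx l\<close>, \<open>l \<in> X\<close>, for a finite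
  set \<open>X\<close>.\<close>

definition dsum :: "(nat \<Rightarrow> nat) set \<Rightarrow> ((nat \<Rightarrow> nat) \<Rightarrow> 'h) set" where
  "dsum X = {m. \<forall>l. if l \<in> X then m l \<in> range (\<lambda>h. xx l * h) else m l = 0}"

definition inj_at :: "(nat \<Rightarrow> nat) \<Rightarrow> 'h \<Rightarrow> (nat \<Rightarrow> nat) \<Rightarrow> 'h" where
  "inj_at l h = (\<lambda>k. if k = l then h else 0)"

text \<open>Right linear endomorphisms of \<open>dsum X\<close>, extended by zero outside of \<open>dsum X\<close>.\<close>

definition End_H :: "(nat \<Rightarrow> nat) set \<Rightarrow> 'h endo set" where
  "End_H X = {f. (\<forall>m\<in>dsum X. f m \<in> dsum X) \<and>
     (\<forall>m\<in>dsum X. \<forall>m'\<in>dsum X. f (m + m') = f m + f m') \<and>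
     (\<forall>m\<in>dsum X. \<forall>h. f (\<lambda>l. m l * h) = (\<lambda>l. f m l * h)) \<and>
     (\<forall>m. m \<notin> dsum X \<longrightarrow> f m = 0)}"

definition Schur_j :: "nat \<Rightarrow> 'h endo set" where
  "Schur_j n = End_H (Lam n d)"

text \<open>The endomorphism algebra for the smaller index set is embedded into \<open>Schur_j n\<close> by letting
  endomorphisms act as zero on the remaining summands.\<close>

definition extend_end :: "nat \<Rightarrow> 'h endo \<Rightarrow> 'h endo" where
  "extend_end n f = (\<lambda>m. if m \<in> dsum (Lam n d)
     then f (\<lambda>l. if l \<in> Lam_i n d then m l else 0) else 0)"

definition Schur_i :: "nat \<Rightarrow> 'h endo set" where
  "Schur_i n = extend_end n ` End_H (Lam_i n d)"

definition end_scale :: "lau2 \<Rightarrow> 'h endo \<Rightarrow> 'h endo" where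
  "end_scale a f = (\<lambda>m l. scale a (f m l))"

text \<open>A right linear map on \<open>dsum (Lam n d)\<close> is determined by its values at the generators
  \<open>inj_at m (xx m)\<close>; this justifies the two definite descriptions below.\<close>

definition e_mat :: "nat \<Rightarrow> mat \<Rightarrow> 'h endo" where
  "e_mat n A = (case the_inv_into (triples n d) kappa A of (l, g, m) \<Rightarrow>
     (THE f. f \<in> Schur_j n \<and> (\<forall>k\<in>Lam n d. f (inj_at k (xx k)) =
        (if k = m then inj_at l (\<Sum>w\<in>double_coset d l g m. T w) else 0))))"

definition std :: "nat \<Rightarrow> mat \<Rightarrow> 'h endo" where
  "std n A = end_scale (mon (- lhat_c n A) (- lhat_a n A)) (e_mat n A)"

definition sbar :: "nat \<Rightarrow> 'h endo \<Rightarrow> 'h endo" where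
  "sbar n f = (THE g. g \<in> Schur_j n \<and> (\<forall>m\<in>Lam n d.
     g (inj_at m (xx m)) = (\<lambda>l. hbar (f (inj_at m (hbar (xx m))) l))))"


section \<open>Specialization\<close>

definition wt_gcd :: "((int \<Rightarrow> int) \<Rightarrow> nat) \<Rightarrow> nat" where
  "wt_gcd L = gcd (L (sgen 0)) (L (sgen 1))"

definition spec_class :: "nat \<Rightarrow> ((int \<Rightarrow> int) \<Rightarrow> nat) \<Rightarrow> ('h endo \<Rightarrow>\<^sub>0 lau1) \<Rightarrow>
    'h spec_elt" where
  "spec_class n L = bc_class (Schur_j n) end_scale
     (lau_spec (L (sgen 0)) (L (sgen 1))) (lau_sub (wt_gcd L))"

definition Schur_j_spec :: "nat \<Rightarrow> ((int \<Rightarrow> int) \<Rightarrow> nat) \<Rightarrow> 'h spec_elt set" where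
  "Schur_j_spec n L = spec_class n L ` bc_free (Schur_j n) (lau_sub (wt_gcd L))"

text \<open>The specialization of the smaller algebra, as a submodule of \<open>Schur_j_spec n L\<close>.\<close>

definition Schur_i_spec :: "nat \<Rightarrow> ((int \<Rightarrow> int) \<Rightarrow> nat) \<Rightarrow> 'h spec_elt set" where
  "Schur_i_spec n L = spec_class n L ` bc_free (Schur_i n) (lau_sub (wt_gcd L))"

definition std_spec :: "nat \<Rightarrow> ((int \<Rightarrow> int) \<Rightarrow> nat) \<Rightarrow> mat \<Rightarrow>
    'h spec_elt" where
  "std_spec n L A = spec_class n L (Poly_Mapping.single (std n A) 1)"

text \<open>The operations on classes are defined through representatives.\<close>

definition rep :: "'h spec_elt \<Rightarrow> 'h endo \<Rightarrow>\<^sub>0 lau1" where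
  "rep X = (SOME h. h \<in> X)"

definition bar_spec :: "nat \<Rightarrow> ((int \<Rightarrow> int) \<Rightarrow> nat) \<Rightarrow> 'h spec_elt \<Rightarrow> 'h spec_elt" where
  "bar_spec n L X = spec_class n L (\<Sum>f\<in>Poly_Mapping.keys (rep X).
     Poly_Mapping.single (sbar n f) (lau_bar (Poly_Mapping.lookup (rep X) f)))"

definition lin_comb :: "nat \<Rightarrow> ((int \<Rightarrow> int) \<Rightarrow> nat) \<Rightarrow> mat set \<Rightarrow> (mat \<Rightarrow> lau1) \<Rightarrow>
    (mat \<Rightarrow> 'h spec_elt) \<Rightarrow> 'h spec_elt" where
  "lin_comb n L I p X = spec_class n L (\<Sum>A\<in>I. Poly_Mapping.map (\<lambda>r. p A * r) (rep (X A)))"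

definition is_basis :: "nat \<Rightarrow> ((int \<Rightarrow> int) \<Rightarrow> nat) \<Rightarrow> mat set \<Rightarrow>
    'h spec_elt set \<Rightarrow> (mat \<Rightarrow> 'h spec_elt) \<Rightarrow> bool" where
  "is_basis n L I E b \<longleftrightarrow> (\<forall>A\<in>I. b A \<in> E) \<and>
     (\<forall>X\<in>E. \<exists>!p. (\<forall>A\<in>I. p A \<in> lau_sub (wt_gcd L)) \<and> (\<forall>A. A \<notin> I \<longrightarrow> p A = 0) \<and>
        X = lin_comb n L I p b)"

definition is_canonical_basis :: "nat \<Rightarrow> ((int \<Rightarrow> int) \<Rightarrow> nat) \<Rightarrow> mat set \<Rightarrow>
    'h spec_elt set \<Rightarrow> (mat \<Rightarrow> 'h spec_elt) \<Rightarrow> bool" where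
  "is_canonical_basis n L I E b \<longleftrightarrow> is_basis n L I E b \<and>
     (\<forall>A\<in>I. bar_spec n L (b A) = b A \<and>
        (\<exists>p. p A = 1 \<and> (\<forall>B\<in>I. less_alg n B A \<longrightarrow> p B \<in> lau_neg (wt_gcd L)) \<and>
           b A = lin_comb n L (insert A {B \<in> I. less_alg n B A}) p (std_spec n L)))"

definition canonical_j :: "nat \<Rightarrow> ((int \<Rightarrow> int) \<Rightarrow> nat) \<Rightarrow> (mat \<Rightarrow> 'h spec_elt) \<Rightarrow> bool" where
  "canonical_j n L b \<longleftrightarrow> is_canonical_basis n L (Xi n d) (Schur_j_spec n L) b"

definition canonical_i :: "nat \<Rightarrow> ((int \<Rightarrow> int) \<Rightarrow> nat) \<Rightarrow> (mat \<Rightarrow> 'h spec_elt) \<Rightarrow> bool" where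
  "canonical_i n L b \<longleftrightarrow> is_canonical_basis n L (Xi_i n d) (Schur_i_spec n L) b"

end

end

theory Submission
  imports Defs
begin

text \<open>
  A canonical basis exists for every free module of finite rank over Laurent polynomials that carries
  a semilinear involution which is unitriangular for a partial order (Lusztig's lemma): the
  coefficients of a bar invariant element are corrected from the top down, and each correction is
  possible because the defect is antisymmetric and hence of the form \<open>p - lau_bar p\<close> with
  negative exponents only (\<open>bar_invariant_exists\<close>, \<open>bar_invariant_unique\<close>). After
  specialization the exponents are multiples of the greatest common divisor of the two weights,
  and if it is zero the correction terms vanish. The restriction to the smaller algebra is then
  immediate: the order only compares matrices with equal row and column sums, so \<open>Xi_i n d\<close> is
  closed downwards, and the smaller algebra consists of the elements with coordinates supported on
  \<open>Xi_i n d\<close>.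

  What has to be shown is that the standard elements \<open>std n A\<close> are a basis on which the bar
  involution is unitriangular. A right linear map from \<open>x\<^sub>\<mu> H\<close> to \<open>x\<^sub>\<lambda> H\<close> is given by the
  image of \<open>x\<^sub>\<mu>\<close>, an element with coefficients constant on the double cosets of the two parabolic
  subgroups (\<open>left_invariant_range\<close>, \<open>right_invariant_range\<close>, \<open>Schur_j_exists\<close>), and double
  cosets correspond to matrices by \<open>kappa_bij\<close>. So the coordinates are coefficients at minimal
  representatives.

  Triangularity comes from the comparison of rank functions, the number of positions \<open>b \<ge> p\<close> with
  \<open>w b \<le> r\<close>. This order on the group has the lifting property (\<open>rank_le_sgen\<close>), so apart from
  \<open>T w\<close> itself the bar conjugate of \<open>T w\<close> only involves shorter elements of smaller rank (\<open>T_bar_triangular\<close>), and at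
  the ends of blocks the ranks are the sums of matrix entries that define the algebraic order
  (\<open>kappa_corner\<close>). The diagonal entry is the leading coefficient of the bar conjugate at an
  element \<open>h\<close> of maximal length in the double coset, divided by the one for the parabolic subgroup
  of \<open>\<mu>\<close>. It is a monomial determined by the length of \<open>h\<close> and the number of its sign changes, and
  \<open>lhat_max_rep\<close> identifies the exponents in the definition of \<open>std n A\<close> with half of its exponents, so that
  the normalized diagonal entry is \<open>1\<close>: an element of maximal length inverts exactly the pairs of
  positions in weakly inverted cells, and these are counted by products of matrix entries.
\<close>

section \<open>Laurent polynomials and their specialization\<close>

lemma inj_uminus_group: "inj (uminus :: 'e::ab_group_add \<Rightarrow> 'e)"
  by (simp add: inj_def)

lemma lookup_lau_bar: "Poly_Mapping.lookup (lau_bar p) k = Poly_Mapping.lookup p (- k)"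
  by (simp add: lau_bar_def Poly_Mapping.map_key.rep_eq inj_uminus_group)

lemma lau_bar_add: "lau_bar (p + q) = lau_bar p + lau_bar q"
  by (rule poly_mapping_eqI) (simp add: lookup_lau_bar lookup_add)

lemma lau_bar_diff: "lau_bar (p - q) = lau_bar p - lau_bar q"
  by (rule poly_mapping_eqI) (simp add: lookup_lau_bar lookup_minus)

lemma lau_bar_zero [simp]: "lau_bar 0 = 0"
  by (rule poly_mapping_eqI) (simp add: lookup_lau_bar)

lemma lau_bar_sum: "lau_bar (sum f I) = (\<Sum>i\<in>I. lau_bar (f i))"
  by (induction I rule: infinite_finite_induct) (auto simp: lau_bar_add)

lemma lau_bar_lau_bar [simp]: "lau_bar (lau_bar p) = p"
  by (rule poly_mapping_eqI) (simp add: lookup_lau_bar)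

lemma lau_bar_single [simp]:
  "lau_bar (Poly_Mapping.single k c) = Poly_Mapping.single (- k) c"
  by (rule poly_mapping_eqI) (auto simp: lookup_lau_bar lookup_single when_def)

lemma lau_bar_one [simp]: "lau_bar 1 = 1"
  using lau_bar_single[of 0 1] by simp

lemma poly_mapping_sum_single:
  fixes p :: "'e \<Rightarrow>\<^sub>0 'c::comm_monoid_add"
  shows "(\<Sum>k\<in>Poly_Mapping.keys p. Poly_Mapping.single k (Poly_Mapping.lookup p k)) = p"
proof (rule poly_mapping_eqI)
  fix k
  show "Poly_Mapping.lookup (\<Sum>k\<in>Poly_Mapping.keys p.
      Poly_Mapping.single k (Poly_Mapping.lookup p k)) k = Poly_Mapping.lookup p k"
    by (cases "k \<in> Poly_Mapping.keys p")
      (auto simp: lookup_sum lookup_single when_def in_keys_iff)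
qed

text \<open>Additive maps on polynomial mappings may be compared on monomials; this reduces the
  multiplicativity of \<open>lau_bar\<close> and \<open>lau_spec\<close> to monomials.\<close>

lemma poly_mapping_induct_single:
  fixes p :: "'e \<Rightarrow>\<^sub>0 'c::comm_monoid_add"
  assumes "P 0" "\<And>k c. P (Poly_Mapping.single k c)" "\<And>p q. P p \<Longrightarrow> P q \<Longrightarrow> P (p + q)"
  shows "P p"
proof -
  have "P (\<Sum>k\<in>K. Poly_Mapping.single k (Poly_Mapping.lookup p k))" if "finite K" for K
    using that by (induction K) (auto intro: assms)
  from this[of "Poly_Mapping.keys p"] show ?thesis
    by (simp add: poly_mapping_sum_single)
qed

lemma lau_bar_mult:
  fixes p q :: "'e::ab_group_add \<Rightarrow>\<^sub>0 int"
  shows "lau_bar (p * q) = lau_bar p * lau_bar q"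
proof (induction p rule: poly_mapping_induct_single)
  case (2 k c)
  show ?case
    by (induction q rule: poly_mapping_induct_single)
      (auto simp: distrib_left lau_bar_add mult_single)
qed (auto simp: distrib_right lau_bar_add)

lemma lookup_lau_spec_sum:
  assumes "finite K" "Poly_Mapping.keys p \<subseteq> K"
  shows "lau_spec a b p = (\<Sum>(i, j)\<in>K.
     Poly_Mapping.single (int a * i + int b * j) (Poly_Mapping.lookup p (i, j)))"
  unfolding lau_spec_def using assms
  by (intro sum.mono_neutral_left) (auto simp: in_keys_iff)

lemma lau_spec_zero [simp]: "lau_spec a b 0 = 0"
  by (simp add: lau_spec_def)

lemma lau_spec_single [simp]:
  "lau_spec a b (Poly_Mapping.single (i, j) c) = Poly_Mapping.single (int a * i + int b * j) c"
  by (simp add: lau_spec_def)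

lemma lau_spec_add: "lau_spec a b (p + q) = lau_spec a b p + lau_spec a b q"
proof -
  let ?K = "Poly_Mapping.keys p \<union> Poly_Mapping.keys q"
  have "Poly_Mapping.keys (p + q) \<subseteq> ?K"
    by (rule Poly_Mapping.keys_add)
  then show ?thesis
    by (simp add: lookup_lau_spec_sum[of ?K] sum.distrib[symmetric] lookup_add single_add
        case_prod_unfold)
qed

lemma lau_spec_sum: "lau_spec a b (sum f I) = (\<Sum>i\<in>I. lau_spec a b (f i))"
  by (induction I rule: infinite_finite_induct) (auto simp: lau_spec_add)

lemma lau_spec_one [simp]: "lau_spec a b 1 = 1"
proof -
  have "(1 :: lau2) = Poly_Mapping.single (0, 0) 1"
    by (metis single_one zero_prod_def)
  then have "lau_spec a b 1 = lau_spec a b (Poly_Mapping.single (0, 0) 1)"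
    by (rule arg_cong)
  also have "\<dots> = 1"
    by (subst lau_spec_single) simp
  finally show ?thesis .
qed

lemma lau_spec_mult: "lau_spec a b (p * q) = lau_spec a b p * lau_spec a b q"
proof (induction p rule: poly_mapping_induct_single)
  case (2 k c)
  obtain i j where k: "k = (i, j)" by (cases k)
  show ?case
  proof (induction q rule: poly_mapping_induct_single)
    case (2 k' c')
    obtain i' j' where "k' = (i', j')" by (cases k')
    with k show ?case by (simp add: mult_single algebra_simps)
  qed (auto simp: distrib_left lau_spec_add)
qed (auto simp: distrib_right lau_spec_add)

lemma lau_spec_lau_bar: "lau_spec a b (lau_bar p) = lau_bar (lau_spec a b p)"
proof (induction p rule: poly_mapping_induct_single)
  case (2 k c)
  obtain i j where k: "k = (i, j)" by (cases k)
  then show ?case by simp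
qed (auto simp: lau_spec_add lau_bar_add)

subsection \<open>The subring of the specialization\<close>

lemma lau_sub_iff: "p \<in> lau_sub c \<longleftrightarrow> (\<forall>k. Poly_Mapping.lookup p k \<noteq> 0 \<longrightarrow> int c dvd k)"
  by (auto simp: lau_sub_def dvd_def in_keys_iff subset_iff)

lemma lau_sub_zero [simp]: "0 \<in> lau_sub c"
  by (simp add: lau_sub_iff)

lemma lau_sub_one [simp]: "1 \<in> lau_sub c"
  by (auto simp: lau_sub_iff lookup_one when_def)

lemma lau_sub_add: "p \<in> lau_sub c \<Longrightarrow> q \<in> lau_sub c \<Longrightarrow> p + q \<in> lau_sub c"
  by (simp add: lau_sub_iff lookup_add) (metis add_0)

lemma lau_sub_diff: "p \<in> lau_sub c \<Longrightarrow> q \<in> lau_sub c \<Longrightarrow> p - q \<in> lau_sub c"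
  by (simp add: lau_sub_iff lookup_minus) (metis diff_0_right)

lemma lau_sub_sum: "(\<And>i. i \<in> I \<Longrightarrow> f i \<in> lau_sub c) \<Longrightarrow> sum f I \<in> lau_sub c"
  by (induction I rule: infinite_finite_induct) (auto intro: lau_sub_add)

lemma lau_sub_mult:
  assumes "p \<in> lau_sub c" "q \<in> lau_sub c"
  shows "p * q \<in> lau_sub c"
  unfolding lau_sub_def
proof safe
  fix k assume "k \<in> Poly_Mapping.keys (p * q)"
  then obtain i j where "k = i + j" "i \<in> Poly_Mapping.keys p" "j \<in> Poly_Mapping.keys q"
    using keys_mult[of p q] by auto
  moreover from this assms have "int c dvd i" "int c dvd j"
    by (auto simp: lau_sub_iff in_keys_iff)
  ultimately have "int c dvd k" by simp
  then show "\<exists>m. k = int c * m \<and> True" by (auto simp: dvd_def)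
qed

lemma lau_sub_bar: "p \<in> lau_sub c \<Longrightarrow> lau_bar p \<in> lau_sub c"
  by (simp add: lau_sub_iff lookup_lau_bar) (metis dvd_minus_iff)

lemma lau_spec_in_lau_sub: "lau_spec a b p \<in> lau_sub (gcd a b)"
proof (induction p rule: poly_mapping_induct_single)
  case (2 k c)
  obtain i j where k: "k = (i, j)" by (cases k)
  have "int (gcd a b) dvd int a * i + int b * j"
    by (intro dvd_add dvd_mult2) (simp_all add: int_dvd_int_iff)
  with k show ?case by (auto simp: lau_sub_iff lookup_single when_def)
qed (auto simp: lau_spec_add lau_sub_add)

lemma lau_neg_iff: "p \<in> lau_neg c \<longleftrightarrow> (\<forall>k. Poly_Mapping.lookup p k \<noteq> 0 \<longrightarrow>
   int c dvd k \<and> (c = 0 \<or> k < 0))"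
proof -
  have "(\<exists>m. k = - int c * m \<and> 1 \<le> m) \<longleftrightarrow> int c dvd k \<and> (c = 0 \<or> k < 0)" for k
  proof
    assume "int c dvd k \<and> (c = 0 \<or> k < 0)"
    then obtain m where m: "k = int c * m" "c = 0 \<or> k < 0" by auto
    show "\<exists>m. k = - int c * m \<and> 1 \<le> m"
    proof (cases "c = 0")
      case False
      with m have "m < 0" by (auto simp: mult_less_0_iff)
      with m show ?thesis by (intro exI[of _ "- m"]) auto
    qed (use m in \<open>auto intro: exI[of _ 1]\<close>)
  qed (auto simp: mult_less_0_iff zero_less_mult_iff)
  then show ?thesis
    by (simp add: lau_neg_def in_keys_iff subset_iff)
qed

lemma lau_neg_subset: "lau_neg c \<subseteq> lau_sub c"
  by (auto simp: lau_neg_iff lau_sub_iff)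

lemma lau_neg_zero [simp]: "0 \<in> lau_neg c"
  by (simp add: lau_neg_iff)

lemma lau_neg_diff: "p \<in> lau_neg c \<Longrightarrow> q \<in> lau_neg c \<Longrightarrow> p - q \<in> lau_neg c"
  by (simp add: lau_neg_iff lookup_minus) (metis diff_0_right)

text \<open>The part of \<open>q\<close> with negative exponents does it, as the constant coefficient of an
  antisymmetric \<open>q\<close> is zero. For \<open>c = 0\<close> there is no other coefficient, and \<open>q = 0\<close>.\<close>

lemma lau_antisymmetric_split:
  assumes "q \<in> lau_sub c" "lau_bar q = - q"
  shows "\<exists>p\<in>lau_neg c. p - lau_bar p = q"
proof -
  define p where "p = (\<Sum>k\<in>{k\<in>Poly_Mapping.keys q. k < 0}.
      Poly_Mapping.single k (Poly_Mapping.lookup q k))"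
  have lp: "Poly_Mapping.lookup p k = (if k < 0 then Poly_Mapping.lookup q k else 0)" for k
  proof (cases "k \<in> {k\<in>Poly_Mapping.keys q. k < 0}")
    case False
    then show ?thesis
      by (auto simp: p_def lookup_sum lookup_single when_def in_keys_iff intro!: sum.neutral)
  next
    case True
    then show ?thesis
      by (simp add: p_def lookup_sum lookup_single when_def)
  qed
  have anti: "Poly_Mapping.lookup q (- k) = - Poly_Mapping.lookup q k" for k
    using assms(2) by (metis lookup_lau_bar lookup_uminus)
  have "p \<in> lau_neg c"
    using assms(1) by (auto simp: lau_neg_iff lau_sub_iff lp split: if_splits)
  moreover have "p - lau_bar p = q"
  proof (rule poly_mapping_eqI)
    fix k show "Poly_Mapping.lookup (p - lau_bar p) k = Poly_Mapping.lookup q k"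
      using anti[of k] anti[of 0] by (auto simp: lookup_minus lookup_lau_bar lp)
  qed
  ultimately show ?thesis by blast
qed

lemma lau_neg_bar_invariant_zero:
  assumes "p \<in> lau_neg c" "lau_bar p = p" "c > 0"
  shows "p = 0"
proof (rule poly_mapping_eqI)
  fix k
  show "Poly_Mapping.lookup p k = Poly_Mapping.lookup 0 k"
    using assms lookup_lau_bar[of p k] by (auto simp: lau_neg_iff) (smt (verit))
qed

lemma finite_has_greatest_value:
  fixes f :: "'i \<Rightarrow> nat"
  assumes "finite S" "S \<noteq> {}"
  shows "\<exists>B\<in>S. \<forall>D\<in>S. f D \<le> f B"
proof -
  have "Max (f ` S) \<in> f ` S" using assms by (intro Max_in) auto
  then obtain B where "B \<in> S" "f B = Max (f ` S)" by auto
  with assms show ?thesis by (metis Max_ge finite_imageI imageI)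
qed

section \<open>Bar invariant elements of a free module with unitriangular bar involution\<close>

text \<open>A semilinear involution of the free module on \<open>I\<close>, given by its matrix: \<open>R A B\<close> is the
  coefficient at \<open>B\<close> of the image of the basis vector \<open>A\<close>. Inductions along the strict order
  \<open>lt\<close> use the measure \<open>ms\<close>.\<close>

locale triangular_bar =
  fixes I :: "'i set" and lt :: "'i \<Rightarrow> 'i \<Rightarrow> bool" and ms :: "'i \<Rightarrow> nat"
    and R :: "'i \<Rightarrow> 'i \<Rightarrow> lau1" and c :: nat
  assumes finite_I: "finite I"
    and lt_trans: "A \<in> I \<Longrightarrow> B \<in> I \<Longrightarrow> C \<in> I \<Longrightarrow> lt A B \<Longrightarrow> lt B C \<Longrightarrow> lt A C"
    and lt_ms: "A \<in> I \<Longrightarrow> B \<in> I \<Longrightarrow> lt A B \<Longrightarrow> ms A < ms B"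
    and R_sub: "A \<in> I \<Longrightarrow> B \<in> I \<Longrightarrow> R A B \<in> lau_sub c"
    and R_diag: "A \<in> I \<Longrightarrow> R A A = 1"
    and R_tri: "A \<in> I \<Longrightarrow> B \<in> I \<Longrightarrow> R A B \<noteq> 0 \<Longrightarrow> B = A \<or> lt B A"
    and R_invol: "A \<in> I \<Longrightarrow> C \<in> I \<Longrightarrow>
      (\<Sum>B\<in>I. lau_bar (R A B) * R B C) = (if A = C then 1 else 0)"
begin

definition vbar :: "('i \<Rightarrow> lau1) \<Rightarrow> 'i \<Rightarrow> lau1" where
  "vbar x C = (\<Sum>B\<in>I. lau_bar (x B) * R B C)"

lemma lt_irrefl: "A \<in> I \<Longrightarrow> \<not> lt A A"
  using lt_ms by blast

lemma vbar_vbar: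
  assumes "C \<in> I"
  shows "vbar (vbar x) C = x C"
proof -
  have "vbar (vbar x) C = (\<Sum>B\<in>I. \<Sum>A\<in>I. x A * (lau_bar (R A B) * R B C))"
    by (simp add: vbar_def lau_bar_sum lau_bar_mult sum_distrib_right mult.assoc)
  also have "\<dots> = (\<Sum>A\<in>I. \<Sum>B\<in>I. x A * (lau_bar (R A B) * R B C))"
    by (rule sum.swap)
  also have "\<dots> = (\<Sum>A\<in>I. x A * (if A = C then 1 else 0))"
    using assms by (simp add: sum_distrib_left[symmetric] R_invol)
  also have "\<dots> = x C"
    using assms finite_I by (simp add: if_distrib cong: if_cong)
  finally show ?thesis .
qed

lemma vbar_diff: "vbar (\<lambda>B. x B - y B) C = vbar x C - vbar y C"
  by (simp add: vbar_def lau_bar_diff left_diff_distrib sum_subtractf)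

text \<open>By triangularity only entries of \<open>x\<close> at indices not below \<open>C\<close> contribute to the value
  at \<open>C\<close>, and the diagonal entry is \<open>1\<close>.\<close>

lemma vbar_top:
  assumes "C \<in> I" "\<And>B. B \<in> I \<Longrightarrow> lt C B \<Longrightarrow> x B = 0"
  shows "vbar x C = lau_bar (x C)"
proof -
  have "vbar x C = (\<Sum>B\<in>I. if B = C then lau_bar (x C) else 0)"
    unfolding vbar_def using assms R_tri R_diag by (intro sum.cong) fastforce+
  then show ?thesis
    using assms finite_I by simp
qed

text \<open>The coefficients are corrected one index at a time, from the top down: the defect
  \<open>vbar x - x\<close> is antisymmetric, so at a maximal index of its support it has the form
  \<open>p - lau_bar p\<close>, and adding \<open>p\<close> to \<open>x\<close> there removes it without affecting larger indices.
  The induction is on the number of indices at or below a defect.\<close>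

lemma bar_invariant_exists:
  assumes "A \<in> I"
  shows "\<exists>x. x A = 1 \<and> (\<forall>B\<in>I. lt B A \<longrightarrow> x B \<in> lau_neg c) \<and>
     (\<forall>B. B \<notin> insert A {B\<in>I. lt B A} \<longrightarrow> x B = 0) \<and> (\<forall>B\<in>I. vbar x B = x B)"
proof -
  have lower: "{B\<in>I. lt B A} \<subseteq> I" by auto
  have "\<exists>x. x A = 1 \<and> (\<forall>B\<in>I. lt B A \<longrightarrow> x B \<in> lau_neg c) \<and>
     (\<forall>B. B \<notin> insert A {B\<in>I. lt B A} \<longrightarrow> x B = 0) \<and>
     card {B\<in>I. vbar x B \<noteq> x B \<or> (\<exists>D\<in>I. lt B D \<and> vbar x D \<noteq> x D)} \<le> card I - k" for k
  proof (induction k)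
    case 0
    show ?case
      using finite_I lt_irrefl[OF assms]
      by (intro exI[of _ "\<lambda>B. if B = A then 1 else 0"]) (auto intro!: card_mono)
  next
    case (Suc k)
    then obtain x where x: "x A = 1" "\<And>B. B \<in> I \<Longrightarrow> lt B A \<Longrightarrow> x B \<in> lau_neg c"
      "\<And>B. B \<notin> insert A {B\<in>I. lt B A} \<Longrightarrow> x B = 0"
      "card {B\<in>I. vbar x B \<noteq> x B \<or> (\<exists>D\<in>I. lt B D \<and> vbar x D \<noteq> x D)} \<le> card I - k"
      by blast
    let ?S = "\<lambda>x. {B\<in>I. vbar x B \<noteq> x B}"
    let ?U = "\<lambda>x. {B\<in>I. vbar x B \<noteq> x B \<or> (\<exists>D\<in>I. lt B D \<and> vbar x D \<noteq> x D)}"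
    show ?case
    proof (cases "?S x = {}")
      case True
      then have "?U x = {}" by auto
      then have "card (?U x) \<le> card I - Suc k" by (simp only: card.empty le0)
      with x(1-3) show ?thesis by (intro exI[of _ x]) blast
    next
      case False
      have "finite (?S x)" using finite_I by auto
      then obtain B where B: "B \<in> ?S x" "\<And>D. D \<in> ?S x \<Longrightarrow> ms D \<le> ms B"
        using False finite_has_greatest_value[of "?S x" ms] by blast
      have BI: "B \<in> I" using B by auto
      have above: "vbar x D = x D" if "D \<in> I" "lt B D" for D
        using B(2)[of D] that lt_ms[OF BI that] by auto
      define y where "y D = vbar x D - x D" for D
      have BA: "lt B A"
      proof (rule ccontr)
        assume nBA: "\<not> lt B A"
        \<comment> \<open>at such an index the defect vanishes: \<open>x\<close> is \<open>0\<close> or \<open>1\<close> there and \<open>0\<close> above\<close>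
        have "x D = 0" if "D \<in> I" "lt B D" for D
        proof (rule ccontr)
          assume "x D \<noteq> 0"
          then have "D = A \<or> lt D A" using x(3) by auto
          with nBA that lt_trans[OF BI that(1) assms] show False by auto
        qed
        then have "vbar x B = lau_bar (x B)" by (intro vbar_top BI) auto
        moreover have "x B = 0 \<or> x B = 1"
          using nBA x(1) x(3)[of B] by auto
        ultimately show False using B by auto
      qed
      have "vbar y B = lau_bar (y B)"
        by (rule vbar_top[OF BI]) (simp add: y_def above)
      moreover have "vbar y B = - y B"
      proof -
        have "y = (\<lambda>D. vbar x D - x D)" by (simp add: y_def fun_eq_iff)
        then show ?thesis using vbar_vbar[OF BI, of x] by (simp add: vbar_diff)
      qed
      ultimately have "lau_bar (y B) = - y B" by simp
      moreover have "y B \<in> lau_sub c"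
      proof -
        have "x D \<in> lau_sub c" for D
          using x lau_neg_subset[of c] by (cases "D \<in> insert A {B\<in>I. lt B A}") auto
        then show ?thesis
          unfolding y_def vbar_def
          by (intro lau_sub_diff lau_sub_sum lau_sub_mult lau_sub_bar R_sub BI)
      qed
      ultimately obtain p where p: "p \<in> lau_neg c" "p - lau_bar p = y B"
        using lau_antisymmetric_split by blast
      define z where "z = (\<lambda>D. x D + (if D = B then p else 0))"
      have AB: "A \<noteq> B" using BA lt_irrefl BI by auto
      have vz: "vbar z D = vbar x D + lau_bar p * R B D" for D
      proof -
        have "vbar z D = vbar x D + (\<Sum>C\<in>I. if C = B then lau_bar p * R B D else 0)"
          unfolding vbar_def z_def sum.distrib[symmetric]
          by (rule sum.cong) (auto simp: lau_bar_add distrib_right)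
        then show ?thesis using BI finite_I by simp
      qed
      have zB: "vbar z B = z B"
      proof -
        have "z B = x B + p" by (simp add: z_def)
        then show ?thesis
          using p(2) vz[of B] R_diag[OF BI] y_def[of B] by (simp add: algebra_simps)
      qed
      have zD: "vbar z D = z D \<longleftrightarrow> vbar x D = x D" if "D \<in> I" "D \<noteq> B" "\<not> lt D B" for D
      proof -
        have "z D = x D" "R B D = 0" using R_tri[OF BI that(1)] that by (auto simp: z_def)
        then show ?thesis by (simp only: vz) simp
      qed
      have sub: "?U z \<subseteq> ?U x - {B}"
      proof (intro subsetI DiffI)
        fix D assume D: "D \<in> ?U z"
        then show "D \<in> ?U x"
        proof -
          have "D \<in> I" using D by auto
          obtain E where E: "E \<in> I" "E = D \<or> lt D E" "vbar z E \<noteq> z E"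
            using D by auto
          show ?thesis
          proof (cases "lt E B")
            case True
            then have "lt D B" using E lt_trans \<open>D \<in> I\<close> BI by blast
            then show ?thesis using B BI \<open>D \<in> I\<close> by auto
          next
            case False
            then show ?thesis using E zB zD \<open>D \<in> I\<close> by (metis (mono_tags, lifting) mem_Collect_eq)
          qed
        qed
        have "B \<notin> ?U z"
        proof
          assume "B \<in> ?U z"
          then obtain E where E: "E \<in> I" "lt B E" "vbar z E \<noteq> z E" using zB by auto
          then have "\<not> lt E B" "E \<noteq> B" using lt_trans[of B E B] BI lt_irrefl by auto
          then show False using zD E above by auto
        qed
        then show "D \<notin> {B}" using D by auto
      qed
      have "B \<in> ?U x" using B by auto
      then have "card (?U z) < card (?U x)"
        using sub finite_I by (intro psubset_card_mono psubsetI) (simp, blast, blast)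
      then have "card (?U z) \<le> card I - Suc k" using x(4) by linarith
      moreover have "z A = 1" using AB x by (simp add: z_def)
      moreover have "z D \<in> lau_neg c" if "D \<in> I" "lt D A" for D
      proof (cases "D = B")
        case True
        have "x B + p = x B - (- p)" by simp
        moreover have "- p \<in> lau_neg c" using p by (auto simp: lau_neg_iff)
        ultimately have "x B + p \<in> lau_neg c"
          using lau_neg_diff[OF x(2)[OF BI BA]] by metis
        then show ?thesis using True by (simp add: z_def)
      qed (use x that in \<open>simp add: z_def\<close>)
      moreover have "z D = 0" if "D \<notin> insert A {B\<in>I. lt B A}" for D
        using that BA BI x by (auto simp: z_def)
      ultimately show ?thesis by (intro exI[of _ z]) blast
    qed
  qed
  from this[of "card I"] obtain x where x: "x A = 1" "\<forall>B\<in>I. lt B A \<longrightarrow> x B \<in> lau_neg c"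
    "\<forall>B. B \<notin> insert A {B\<in>I. lt B A} \<longrightarrow> x B = 0"
    "card {B\<in>I. vbar x B \<noteq> x B \<or> (\<exists>D\<in>I. lt B D \<and> vbar x D \<noteq> x D)} = 0"
    by auto
  then show ?thesis using finite_I by (intro exI[of _ x]) auto
qed

text \<open>At a maximal index where two solutions differ, their difference is bar invariant and has
  only negative exponents.\<close>

lemma bar_invariant_unique:
  assumes "c > 0" "A \<in> I"
    and x: "x A = 1" "\<And>B. B \<in> I \<Longrightarrow> lt B A \<Longrightarrow> x B \<in> lau_neg c"
      "\<And>B. B \<in> I \<Longrightarrow> B \<notin> insert A {B\<in>I. lt B A} \<Longrightarrow> x B = 0" "\<And>B. B \<in> I \<Longrightarrow> vbar x B = x B"
    and y: "y A = 1" "\<And>B. B \<in> I \<Longrightarrow> lt B A \<Longrightarrow> y B \<in> lau_neg c"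
      "\<And>B. B \<in> I \<Longrightarrow> B \<notin> insert A {B\<in>I. lt B A} \<Longrightarrow> y B = 0" "\<And>B. B \<in> I \<Longrightarrow> vbar y B = y B"
    and "B \<in> I"
  shows "x B = y B"
proof (rule ccontr)
  assume "x B \<noteq> y B"
  let ?S = "{B\<in>I. x B \<noteq> y B}"
  define z where "z B = x B - y B" for B
  have "finite ?S" "?S \<noteq> {}" using finite_I \<open>B \<in> I\<close> \<open>x B \<noteq> y B\<close> by auto
  then obtain D where D: "D \<in> ?S" "\<And>E. E \<in> ?S \<Longrightarrow> ms E \<le> ms D"
    using finite_has_greatest_value[of ?S ms] by blast
  have "vbar z D = lau_bar (z D)"
  proof (rule vbar_top)
    fix E assume "E \<in> I" "lt D E"
    then show "z E = 0" using D(2)[of E] lt_ms[of D E] D(1) by (auto simp: z_def)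
  qed (use D in auto)
  moreover have "vbar z D = z D"
  proof -
    have "z = (\<lambda>B. x B - y B)" by (simp add: z_def fun_eq_iff)
    then show ?thesis using D x(4) y(4) by (simp add: vbar_diff)
  qed
  moreover have "z D \<in> lau_neg c"
    using D x y by (cases "lt D A"; cases "D = A") (auto simp: z_def intro: lau_neg_diff)
  ultimately have "z D = 0" using lau_neg_bar_invariant_zero \<open>c > 0\<close> by auto
  then show False using D by (simp add: z_def)
qed

text \<open>The equation at \<open>B\<close> determines \<open>p B\<close> from the values of \<open>p\<close> at larger indices, so the
  system is solved from the top down.\<close>

lemma unitriangular_ex1:
  assumes P: "\<And>A. A \<in> I \<Longrightarrow> P A A = 1"
      "\<And>A B. A \<in> I \<Longrightarrow> B \<in> I \<Longrightarrow> P A B \<noteq> 0 \<Longrightarrow> B = A \<or> lt B A"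
      "\<And>A B. A \<in> I \<Longrightarrow> B \<in> I \<Longrightarrow> P A B \<in> lau_sub c"
    and J: "J \<subseteq> I"
    and v: "\<And>B. B \<in> J \<Longrightarrow> v B \<in> lau_sub c"
  shows "\<exists>!p. (\<forall>A\<in>J. p A \<in> lau_sub c) \<and> (\<forall>A. A \<notin> J \<longrightarrow> p A = 0) \<and>
     (\<forall>B\<in>J. v B = (\<Sum>A\<in>J. p A * P A B))"
proof -
  have finJ: "finite J" using J finite_I finite_subset by blast
  have step: "(\<Sum>A\<in>J. p A * P A B) = p B + (\<Sum>A\<in>{A\<in>J. lt B A}. p A * P A B)"
    if "B \<in> J" for p :: "'i \<Rightarrow> lau1" and B
  proof -
    have "P A B = 0" if "A \<in> J - insert B {A\<in>J. lt B A}" for A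
      using P(2)[of A B] J that \<open>B \<in> J\<close> by blast
    then have "(\<Sum>A\<in>J. p A * P A B) = (\<Sum>A\<in>insert B {A\<in>J. lt B A}. p A * P A B)"
      using that finJ by (intro sum.mono_neutral_right) auto
    also have "\<dots> = p B + (\<Sum>A\<in>{A\<in>J. lt B A}. p A * P A B)"
      using that J P(1) finJ lt_irrefl by (subst sum.insert) auto
    finally show ?thesis .
  qed
  have un: "p A = p' A"
    if "\<forall>B\<in>J. v B = (\<Sum>A\<in>J. p A * P A B)" "\<forall>B\<in>J. v B = (\<Sum>A\<in>J. p' A * P A B)" "A \<in> J"
    for p p' :: "'i \<Rightarrow> lau1" and A
  proof (rule ccontr)
    assume ne: "p A \<noteq> p' A"
    let ?S = "{B\<in>J. p B \<noteq> p' B}"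
    have "finite ?S" "?S \<noteq> {}" using finJ that ne by auto
    then obtain D where D: "D \<in> ?S" "\<And>E. E \<in> ?S \<Longrightarrow> ms E \<le> ms D"
      using finite_has_greatest_value[of ?S ms] by blast
    have "p E = p' E" if "E \<in> J" "lt D E" for E
      using D(2)[of E] lt_ms[of D E] that D(1) J by fastforce
    then have "(\<Sum>A\<in>{A\<in>J. lt D A}. p A * P A D) = (\<Sum>A\<in>{A\<in>J. lt D A}. p' A * P A D)"
      by (intro sum.cong) auto
    then have "p D = p' D"
      using that D(1) step[of D p] step[of D p'] by auto
    then show False using D by auto
  qed
  have ex: "\<exists>p. (\<forall>A\<in>J. p A \<in> lau_sub c) \<and> (\<forall>B\<in>J. k \<le> ms B \<longrightarrow> v B = (\<Sum>A\<in>J. p A * P A B))" for k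
  proof (induction "Suc (Max (insert 0 (ms ` I))) - k" arbitrary: k)
    case 0
    have "ms B < k" if "B \<in> I" for B
    proof -
      have "ms B \<le> Max (insert 0 (ms ` I))" using finite_I that by (intro Max_ge) auto
      with 0 show ?thesis by simp
    qed
    then show ?case using J by (intro exI[of _ "\<lambda>_. 0"]) fastforce
  next
    case (Suc m)
    then have "m = Suc (Max (insert 0 (ms ` I))) - Suc k" by linarith
    from Suc(1)[OF this] obtain p where p: "\<forall>A\<in>J. p A \<in> lau_sub c"
      "\<forall>B\<in>J. Suc k \<le> ms B \<longrightarrow> v B = (\<Sum>A\<in>J. p A * P A B)" by blast
    define p' where "p' B = (if ms B = k then v B - (\<Sum>A\<in>{A\<in>J. lt B A}. p A * P A B) else p B)" for B
    have *: "(\<Sum>A\<in>{A\<in>J. lt B A}. p' A * P A B) = (\<Sum>A\<in>{A\<in>J. lt B A}. p A * P A B)"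
      if "B \<in> J" "k \<le> ms B" for B
      using that lt_ms[of B] J by (intro sum.cong) (fastforce simp: p'_def)+
    have "p' A \<in> lau_sub c" if "A \<in> J" for A
      using that p v J P(3) unfolding p'_def
      by (auto intro!: lau_sub_diff lau_sub_sum lau_sub_mult
          P(3)[OF subsetD[OF J] subsetD[OF J]])
    moreover have "v B = (\<Sum>A\<in>J. p' A * P A B)" if "B \<in> J" "k \<le> ms B" for B
    proof (cases "ms B = k")
      case True
      then show ?thesis using that by (simp add: step * ) (simp add: p'_def)
    next
      case False
      then have "v B = (\<Sum>A\<in>J. p A * P A B)" using p that by auto
      then show ?thesis using that False by (simp add: step * ) (simp add: p'_def)
    qed
    ultimately show ?case by blast
  qed
  from ex[of 0] obtain p where p: "\<forall>A\<in>J. p A \<in> lau_sub c" "\<forall>B\<in>J. v B = (\<Sum>A\<in>J. p A * P A B)"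
    by auto
  show ?thesis
  proof (rule ex1I[of _ "\<lambda>A. if A \<in> J then p A else 0"])
    show "(\<forall>A\<in>J. (if A \<in> J then p A else 0) \<in> lau_sub c) \<and>
      (\<forall>A. A \<notin> J \<longrightarrow> (if A \<in> J then p A else 0) = 0) \<and>
      (\<forall>B\<in>J. v B = (\<Sum>A\<in>J. (if A \<in> J then p A else 0) * P A B))"
      using p by simp
  next
    fix p' assume p': "(\<forall>A\<in>J. p' A \<in> lau_sub c) \<and> (\<forall>A. A \<notin> J \<longrightarrow> p' A = 0) \<and>
      (\<forall>B\<in>J. v B = (\<Sum>A\<in>J. p' A * P A B))"
    show "p' = (\<lambda>A. if A \<in> J then p A else 0)"
      using un[of p' p] p p' by fastforce
  qed
qed

end

section \<open>Length and rank functions on the Weyl group\<close>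

subsection \<open>The group\<close>

lemma weyl_permutes: "w \<in> weyl d \<Longrightarrow> w permutes {- int d..int d}"
  by (simp add: weyl_def)

lemma weyl_odd: "w \<in> weyl d \<Longrightarrow> w (- i) = - w i"
  by (simp add: weyl_def)

lemma weyl_0 [simp]: "w \<in> weyl d \<Longrightarrow> w 0 = 0"
  using weyl_odd[of w d 0] by simp

lemma weyl_id [simp]: "id \<in> weyl d"
  by (simp add: weyl_def permutes_id)

lemma weyl_comp [simp]: "w \<in> weyl d \<Longrightarrow> w' \<in> weyl d \<Longrightarrow> w \<circ> w' \<in> weyl d"
  by (auto simp: weyl_def intro: permutes_compose)

lemma weyl_bij: "w \<in> weyl d \<Longrightarrow> bij w"
  by (rule permutes_bij[OF weyl_permutes])

lemma weyl_inv_apply [simp]: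
  "w \<in> weyl d \<Longrightarrow> inv w (w i) = i" "w \<in> weyl d \<Longrightarrow> w (inv w i) = i"
  by (rule permutes_inverses[OF weyl_permutes], assumption)+

lemma weyl_inv [simp]: "w \<in> weyl d \<Longrightarrow> inv w \<in> weyl d"
proof -
  assume w: "w \<in> weyl d"
  have "inv w (- i) = - inv w i" for i
    using w weyl_odd[OF w, of "inv w i"] by (metis weyl_inv_apply)
  then show ?thesis
    using w by (simp add: weyl_def permutes_inv)
qed

lemma weyl_inv_0 [simp]: "w \<in> weyl d \<Longrightarrow> inv w 0 = 0"
  by (rule weyl_0[OF weyl_inv])

lemma weyl_inv_inv [simp]: "w \<in> weyl d \<Longrightarrow> inv (inv w) = w"
  by (rule inv_inv_eq[OF weyl_bij])

lemma weyl_inv_comp: "w \<in> weyl d \<Longrightarrow> w' \<in> weyl d \<Longrightarrow> inv (w \<circ> w') = inv w' \<circ> inv w"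
  by (simp add: o_inv_distrib weyl_bij)

lemma finite_weyl [simp]: "finite (weyl d)"
  by (rule finite_subset[OF _ finite_permutations[of "{- int d..int d}"]]) (auto simp: weyl_def)

lemma weyl_eq_iff: "w \<in> weyl d \<Longrightarrow> w i = w j \<longleftrightarrow> i = j"
  by (metis weyl_inv_apply(1))

lemma weyl_range: "w \<in> weyl d \<Longrightarrow> - int d \<le> w i \<and> w i \<le> int d \<longleftrightarrow> - int d \<le> i \<and> i \<le> int d"
  using permutes_in_image[OF weyl_permutes, of w d i] by simp

text \<open>The four positions that a generator moves. For \<open>k = 0\<close> the positions \<open>k\<close> and \<open>- k\<close>
  coincide and are fixed.\<close>

lemma sgen_apply: "sgen k i =
  (if i = int k then (if k = 0 then 0 else int k + 1)
   else if i = int k + 1 then (if k = 0 then -1 else int k)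
   else if i = - int k then - int k - 1
   else if i = - int k - 1 then (if k = 0 then 1 else - int k) else i)"
  by (auto simp: sgen_def transpose_def)

lemma sgen_sgen [simp]: "sgen k (sgen k i) = i"
  by (auto simp: sgen_apply)

lemma sgen_comp_sgen [simp]: "sgen k \<circ> sgen k = id"
  by (simp add: fun_eq_iff)

lemma sgen_comp_cancel [simp]: "sgen k \<circ> (sgen k \<circ> w) = w" "w \<circ> sgen k \<circ> sgen k = w"
  by (simp_all add: fun_eq_iff)

lemma inv_sgen [simp]: "inv (sgen k) = sgen k"
  by (rule inv_unique_comp) simp_all

lemma sgen_weyl [simp]:
  assumes "k < d"
  shows "sgen k \<in> weyl d"
proof -
  have "sgen k permutes {- int d..int d}"
    using assms unfolding sgen_def
    by (auto intro!: permutes_compose permutes_swap_id)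
  then show ?thesis
    by (auto simp: weyl_def sgen_apply)
qed

lemma inv_sgen_comp: "w \<in> weyl d \<Longrightarrow> k < d \<Longrightarrow> inv (sgen k \<circ> w) = inv w \<circ> sgen k"
  using weyl_inv_comp[of "sgen k" d w] by simp

lemma inv_comp_sgen: "w \<in> weyl d \<Longrightarrow> k < d \<Longrightarrow> inv (w \<circ> sgen k) = sgen k \<circ> inv w"
  using weyl_inv_comp[of w d "sgen k"] by simp

text \<open>The condition \<open>asc k w\<close> describes the left ascents of \<open>w\<close>. As \<open>inv w 0 = 0\<close>, the
  condition for \<open>k = 0\<close> is \<open>0 < inv w 1\<close>.\<close>

abbreviation asc :: "nat \<Rightarrow> (int \<Rightarrow> int) \<Rightarrow> bool" where
  "asc k w \<equiv> inv w (int k) < inv w (int k + 1)"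

lemma asc_sgen:
  assumes "w \<in> weyl d" "k < d"
  shows "asc k (sgen k \<circ> w) \<longleftrightarrow> \<not> asc k w"
proof -
  have "inv w (-1) = - inv w 1"
    using weyl_odd[OF weyl_inv[OF assms(1)], of 1] by simp
  moreover have "inv w (int k) \<noteq> inv w (int k + 1)"
    using weyl_eq_iff[OF weyl_inv[OF assms(1)]] by simp
  ultimately show ?thesis
    using assms weyl_0[OF weyl_inv[OF assms(1)]] by (auto simp: inv_sgen_comp sgen_apply)
qed

subsection \<open>Adjacent transpositions\<close>

text \<open>The generators of the Weyl group are products of adjacent transpositions of the interval
  \<open>[-d, d]\<close>, and an ascent in the Weyl group is a chain of ascents in the symmetric group.
  So inversions and ranks have to be followed through adjacent transpositions only.\<close>

definition invs :: "nat \<Rightarrow> (int \<Rightarrow> int) \<Rightarrow> (int \<times> int) set" where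
  "invs d w = {(a, b). - int d \<le> a \<and> a < b \<and> b \<le> int d \<and> w b < w a}"

definition rk :: "nat \<Rightarrow> (int \<Rightarrow> int) \<Rightarrow> int \<Rightarrow> int \<Rightarrow> nat" where
  "rk d w p q = card {b \<in> {- int d..int d}. p \<le> b \<and> w b \<le> q}"

definition rank_le :: "nat \<Rightarrow> (int \<Rightarrow> int) \<Rightarrow> (int \<Rightarrow> int) \<Rightarrow> bool" where
  "rank_le d y w \<longleftrightarrow> (\<forall>p q. rk d y p q \<le> rk d w p q)"

lemma rank_le_refl [simp]: "rank_le d w w"
  by (simp add: rank_le_def)

lemma invs_id [simp]: "invs d id = {}" "invs d (\<lambda>a. a) = {}"
  by (auto simp: invs_def)

lemma finite_invs [simp]: "finite (invs d w)"
  by (rule finite_subset[of _ "{- int d..int d} \<times> {- int d..int d}"]) (auto simp: invs_def)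

definition adj :: "int \<Rightarrow> int \<Rightarrow> int" where
  "adj k = Transposition.transpose k (k + 1)"

lemma adj_apply: "adj k i = (if i = k then k + 1 else if i = k + 1 then k else i)"
  by (simp add: adj_def transpose_def)

lemma adj_permutes: "- int d \<le> k \<Longrightarrow> k < int d \<Longrightarrow> adj k permutes {- int d..int d}"
  unfolding adj_def by (rule permutes_swap_id) auto

lemma inv_adj_comp:
  assumes "w permutes {- int d..int d}"
  shows "inv (adj k \<circ> w) i = inv w (adj k i)"
proof -
  have "inv (adj k \<circ> w) = inv w \<circ> inv (adj k)"
    using permutes_bij[OF assms] by (intro o_inv_distrib) (auto simp: adj_def)
  then show ?thesis by (simp add: adj_def)
qed

lemma adj_less:
  assumes "p \<noteq> q" "\<not> (p = k \<and> q = k + 1)" "\<not> (p = k + 1 \<and> q = k)"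
  shows "adj k p < adj k q \<longleftrightarrow> p < q"
  using assms by (auto simp: adj_apply)

lemma card_invs_adj:
  assumes w: "w permutes {- int d..int d}" and k: "- int d \<le> k" "k < int d"
    and asc: "inv w k < inv w (k + 1)"
  shows "card (invs d (adj k \<circ> w)) = Suc (card (invs d w))"
proof -
  have iw: "w (inv w i) = i" "inv w (w i) = i" for i
    using permutes_inverses[OF w] by auto
  have inj: "w a = w b \<longleftrightarrow> a = b" for a b
    using iw by metis
  have "inv w k \<in> {- int d..int d}" "inv w (k + 1) \<in> {- int d..int d}"
    using k permutes_in_image[OF permutes_inv[OF w]] by auto
  moreover have "adj k (w b) < adj k (w a) \<longleftrightarrow> w b < w a \<or> a = inv w k \<and> b = inv w (k + 1)"
    if "a < b" for a b
  proof (cases "w a = k \<and> w b = k + 1 \<or> w a = k + 1 \<and> w b = k")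
    case True
    then have "w a = k" "w b = k + 1" "a = inv w k" "b = inv w (k + 1)"
      using that asc iw by (metis less_asym)+
    then show ?thesis by (simp add: adj_apply)
  next
    case False
    then have "adj k (w b) < adj k (w a) \<longleftrightarrow> w b < w a"
      using that inj[of b a] by (intro adj_less) auto
    then show ?thesis using False iw by metis
  qed
  ultimately have "invs d (adj k \<circ> w) = insert (inv w k, inv w (k + 1)) (invs d w)"
    using asc by (auto simp: invs_def)
  moreover have "(inv w k, inv w (k + 1)) \<notin> invs d w"
    by (simp add: invs_def iw)
  ultimately show ?thesis by simp
qed

lemma rk_adj:
  assumes "q \<noteq> k"
  shows "rk d (adj k \<circ> w) p q = rk d w p q"
proof -
  have "adj k i \<le> q \<longleftrightarrow> i \<le> q" for i
    using assms by (auto simp: adj_apply)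
  then show ?thesis by (simp add: rk_def)
qed

lemma rk_step:
  assumes w: "w permutes {- int d..int d}" and q: "- int d \<le> q" "q \<le> int d"
  shows "rk d w p q = rk d w p (q - 1) + (if p \<le> inv w q then 1 else 0)"
proof -
  have iw: "w b = q \<longleftrightarrow> b = inv w q" for b
    using permutes_inverses[OF w] by metis
  have "inv w q \<in> {- int d..int d}"
    using q permutes_in_image[OF permutes_inv[OF w]] by auto
  moreover have E: "w b \<le> q \<longleftrightarrow> w b \<le> q - 1 \<or> b = inv w q" for b
    by (simp only: iw[symmetric]) linarith
  ultimately have "{b \<in> {- int d..int d}. p \<le> b \<and> w b \<le> q} =
     {b \<in> {- int d..int d}. p \<le> b \<and> w b \<le> q - 1} \<union> (if p \<le> inv w q then {inv w q} else {})"
    unfolding E by auto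
  moreover have "finite {b \<in> {- int d..int d}. p \<le> b \<and> w b \<le> q - 1}"
    by (rule finite_subset[of _ "{- int d..int d}"]) auto
  moreover have "inv w q \<notin> {b \<in> {- int d..int d}. p \<le> b \<and> w b \<le> q - 1}"
    using iw[of "inv w q"] by auto
  ultimately show ?thesis
    by (simp add: rk_def)
qed

text \<open>The lifting property. Only the rank at \<open>k\<close> changes, and there an ascent of \<open>w\<close> makes the rank
  of \<open>adj k \<circ> w\<close> as large as the neighbouring ranks at \<open>k - 1\<close> and \<open>k + 1\<close> permit.\<close>

lemma rank_le_adj:
  assumes y: "y permutes {- int d..int d}" and w: "w permutes {- int d..int d}"
    and k: "- int d \<le> k" "k < int d"
    and asc: "inv w k < inv w (k + 1)" and le: "rank_le d y w"
  shows "rank_le d (adj k \<circ> y) (adj k \<circ> w)" "rank_le d y (adj k \<circ> w)"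
proof -
  have perm: "adj k \<circ> u permutes {- int d..int d}" if "u permutes {- int d..int d}" for u
    using permutes_compose[OF that adj_permutes[OF k]] .
  have st: "rk d u p (k + 1) = rk d u p (k - 1) + (if p \<le> inv u k then 1 else 0)
       + (if p \<le> inv u (k + 1) then 1 else 0)"
    "rk d u p k = rk d u p (k - 1) + (if p \<le> inv u k then 1 else 0)"
    "rk d (adj k \<circ> u) p k = rk d u p (k - 1) + (if p \<le> inv u (k + 1) then 1 else 0)"
    if u: "u permutes {- int d..int d}" for u p
    using rk_step[OF u, of "k + 1" p] rk_step[OF u, of k p] rk_step[OF perm[OF u], of k p] k
      rk_adj[of "k - 1" k d u p]
    by (auto simp: inv_adj_comp[OF u] adj_apply)
  have le': "rk d y p q \<le> rk d w p q" for p q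
    using le by (simp add: rank_le_def)
  have "rk d (adj k \<circ> y) p k \<le> rk d (adj k \<circ> w) p k" "rk d y p k \<le> rk d (adj k \<circ> w) p k" for p
    using le'[of p "k - 1"] le'[of p "k + 1"] asc
    by (auto simp: st[OF y] st[OF w] split: if_splits)
  then show "rank_le d (adj k \<circ> y) (adj k \<circ> w)" "rank_le d y (adj k \<circ> w)"
    unfolding rank_le_def using le' rk_adj by metis+
qed

lemma sgen_0_adj: "sgen 0 = adj (-1) \<circ> (adj 0 \<circ> adj (-1))"
  by (auto simp: fun_eq_iff sgen_apply adj_apply)

lemma sgen_pos_adj: "0 < k \<Longrightarrow> sgen k = adj (int k) \<circ> adj (- int k - 1)"
  by (auto simp: fun_eq_iff sgen_apply adj_apply)

text \<open>The chain of adjacent ascents behind one ascent along a generator: \<open>v\<close> is the product of the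
  transpositions so far, \<open>u = v \<circ> w\<close>, and \<open>i\<close> is their number.\<close>

lemma sgen_ascent_induct:
  assumes w: "w \<in> weyl d" and k: "k < d" and asc: "asc k w"
    and P: "P 0 id w"
    and step: "\<And>v u j i. v permutes {- int d..int d} \<Longrightarrow> u permutes {- int d..int d} \<Longrightarrow>
      - int d \<le> j \<Longrightarrow> j < int d \<Longrightarrow>
      inv u j < inv u (j + 1) \<Longrightarrow> P i v u \<Longrightarrow> P (Suc i) (adj j \<circ> v) (adj j \<circ> u)"
  shows "P (if k = 0 then 3 else 2 :: nat) (sgen k) (sgen k \<circ> w)"
proof -
  note iw = weyl_odd[OF weyl_inv[OF w]]
  note pw = weyl_permutes[OF w]
  have pc: "adj j \<circ> u permutes {- int d..int d}"
    if "u permutes {- int d..int d}" "- int d \<le> j" "j < int d" for u j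
    using permutes_compose[OF that(1) adj_permutes[OF that(2,3)]] .
  note pid = permutes_id[of "{- int d..int d}"]
  show ?thesis
  proof (cases "k = 0")
    case True
    have d: "- int d \<le> -1" "-1 < int d" "- int d \<le> 0" "0 < int d" using k by auto
    have a: "inv w (-1) < 0" "0 < inv w 1" "inv w 0 = 0"
      using asc iw[of 1] w True by auto
    note p1 = pc[OF pid d(1,2)] pc[OF pw d(1,2)]
    note p2 = pc[OF p1(1) d(3,4)] pc[OF p1(2) d(3,4)]
    have 1: "P (Suc 0) (adj (-1) \<circ> id) (adj (-1) \<circ> w)"
      by (rule step[OF pid pw d(1,2) _ P]) (use a in simp)
    have 2: "P (Suc (Suc 0)) (adj 0 \<circ> (adj (-1) \<circ> id)) (adj 0 \<circ> (adj (-1) \<circ> w))"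
      by (rule step[OF p1 d(3,4) _ 1]) (use a in \<open>simp add: inv_adj_comp[OF pw] adj_apply\<close>)
    have "P (Suc (Suc (Suc 0))) (adj (-1) \<circ> (adj 0 \<circ> (adj (-1) \<circ> id)))
       (adj (-1) \<circ> (adj 0 \<circ> (adj (-1) \<circ> w)))"
      by (rule step[OF p2 d(1,2) _ 2])
        (use a in \<open>simp add: inv_adj_comp[OF p1(2)] inv_adj_comp[OF pw] adj_apply\<close>)
    then show ?thesis
      using True by (simp add: sgen_0_adj o_assoc numeral_3_eq_3)
  next
    case False
    have d: "- int d \<le> - int k - 1" "- int k - 1 < int d" "- int d \<le> int k" "int k < int d"
      using k by auto
    have a: "inv w (- int k - 1) < inv w (- int k - 1 + 1)" "inv w (int k) < inv w (int k + 1)"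
      using asc iw[of "int k + 1"] iw[of "int k"] by auto
    note p1 = pc[OF pid d(1,2)] pc[OF pw d(1,2)]
    have 1: "P (Suc 0) (adj (- int k - 1) \<circ> id) (adj (- int k - 1) \<circ> w)"
      by (rule step[OF pid pw d(1,2) a(1) P])
    have "P (Suc (Suc 0)) (adj (int k) \<circ> (adj (- int k - 1) \<circ> id))
        (adj (int k) \<circ> (adj (- int k - 1) \<circ> w))"
      by (rule step[OF p1 d(3,4) _ 1])
        (use a False in \<open>simp add: inv_adj_comp[OF pw] adj_apply\<close>)
    then show ?thesis
      using False by (simp add: sgen_pos_adj o_assoc numeral_2_eq_2)
  qed
qed

lemma card_invs_sgen:
  assumes "w \<in> weyl d" "k < d" "asc k w"
  shows "card (invs d (sgen k \<circ> w)) = card (invs d w) + (if k = 0 then 3 else 2)"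
  using sgen_ascent_induct[OF assms, of "\<lambda>i v u. card (invs d u) = card (invs d w) + i"]
  by (auto simp: card_invs_adj)

lemma rank_le_sgen:
  assumes y: "y \<in> weyl d" and w: "w \<in> weyl d" "k < d" "asc k w" and le: "rank_le d y w"
  shows "rank_le d (sgen k \<circ> y) (sgen k \<circ> w)" "rank_le d y (sgen k \<circ> w)"
proof -
  have pc: "v \<circ> y permutes {- int d..int d}" if "v permutes {- int d..int d}" for v
    using permutes_compose[OF weyl_permutes[OF y] that] .
  have "rank_le d (sgen k \<circ> y) (sgen k \<circ> w) \<and> rank_le d y (sgen k \<circ> w)"
  proof (rule sgen_ascent_induct[OF w, where P = "\<lambda>i v u. rank_le d (v \<circ> y) u \<and> rank_le d y u"])
    fix v u j
    assume vu: "v permutes {- int d..int d}" "u permutes {- int d..int d}"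
      "- int d \<le> j" "j < int d" "inv u j < inv u (j + 1)" "rank_le d (v \<circ> y) u \<and> rank_le d y u"
    then show "rank_le d (adj j \<circ> v \<circ> y) (adj j \<circ> u) \<and> rank_le d y (adj j \<circ> u)"
      using rank_le_adj(1)[OF pc[OF vu(1)] vu(2-5)] rank_le_adj(2)[OF weyl_permutes[OF y] vu(2-5)]
      by (simp add: comp_assoc)
  qed (use le in auto)
  then show "rank_le d (sgen k \<circ> y) (sgen k \<circ> w)" "rank_le d y (sgen k \<circ> w)" by auto
qed

subsection \<open>Length\<close>

text \<open>The number of letters \<open>sgen 0\<close> in any reduced word.\<close>

definition neg :: "nat \<Rightarrow> (int \<Rightarrow> int) \<Rightarrow> nat" where
  "neg d w = card {a \<in> {1..int d}. w a < 0}"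

lemma neg_id [simp]: "neg d id = 0" "neg d (\<lambda>a. a) = 0"
  by (auto simp: neg_def card_eq_0_iff)

lemma neg_sgen:
  assumes w: "w \<in> weyl d" and k: "k < d" and asc: "asc k w"
  shows "neg d (sgen k \<circ> w) = neg d w + (if k = 0 then 1 else 0)"
proof (cases "k = 0")
  case False
  then have "sgen k i < 0 \<longleftrightarrow> i < 0" for i
    by (auto simp: sgen_apply)
  with False show ?thesis by (simp add: neg_def)
next
  case True
  have pos: "0 < inv w 1" using asc True w by simp
  have le: "inv w 1 \<le> int d" using weyl_range[OF weyl_inv[OF w], of 1] k by auto
  have "sgen 0 (w a) < 0 \<longleftrightarrow> w a < 0 \<or> a = inv w 1" if "0 < a" for a
  proof -
    have "w a \<noteq> -1"
      using that pos w weyl_odd[OF w, of "inv w 1"] weyl_eq_iff[OF w, of a "- inv w 1"] by auto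
    moreover have "w a = 1 \<longleftrightarrow> a = inv w 1" using weyl_inv_apply[OF w] by metis
    ultimately show ?thesis by (auto simp: sgen_apply)
  qed
  then have "{a \<in> {1..int d}. sgen 0 (w a) < 0} = insert (inv w 1) {a \<in> {1..int d}. w a < 0}"
    using pos le by auto
  moreover have "finite {a \<in> {1..int d}. w a < 0}"
    by (rule finite_subset[of _ "{1..int d}"]) auto
  moreover have "inv w 1 \<notin> {a \<in> {1..int d}. w a < 0}"
    using w by auto
  ultimately show ?thesis
    using True by (simp add: neg_def)
qed

text \<open>Oddness gives \<open>g 0 = 0\<close>, so increasing steps yield \<open>g k \<ge> k\<close> from below, and \<open>g d \<le> d\<close>
  yields \<open>g k \<le> k\<close> from above.\<close>

lemma increasing_weyl_id:
  assumes g: "g \<in> weyl d" and inc: "\<And>k. k < d \<Longrightarrow> g (int k) < g (int k + 1)"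
  shows "g = id"
proof -
  have lo: "int k \<le> g (int k)" if "k \<le> d" for k
    using that
  proof (induction k)
    case (Suc k)
    then show ?case using inc[of k] by (auto simp: add.commute)
  qed (use g in auto)
  have hi: "g (int (d - k)) \<le> int (d - k)" if "k \<le> d" for k
    using that
  proof (induction k)
    case 0
    then show ?case using weyl_range[OF g, of "int d"] by simp
  next
    case (Suc k)
    have "int (d - Suc k) + 1 = int (d - k)" using Suc by auto
    then show ?case using Suc inc[of "d - Suc k"] by (auto split: if_splits)
  qed
  have nn: "g (int k) = int k" if "k \<le> d" for k
    using lo[OF that] hi[of "d - k"] that by auto
  show ?thesis
  proof
    fix i
    consider "0 \<le> i" "i \<le> int d" | "i < 0" "- int d \<le> i" | "i \<notin> {- int d..int d}" by fastforce
    then show "g i = id i"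
    proof cases
      case 1
      then show ?thesis using nn[of "nat i"] by simp
    next
      case 2
      then show ?thesis using nn[of "nat (- i)"] weyl_odd[OF g, of "- i"] by simp
    next
      case 3
      then show ?thesis using permutes_not_in[OF weyl_permutes[OF g]] by simp
    qed
  qed
qed

lemma ex_descent:
  assumes "w \<in> weyl d" "w \<noteq> id"
  shows "\<exists>k<d. \<not> asc k w"
proof (rule ccontr)
  assume "\<not> ?thesis"
  then have "inv w = id" using increasing_weyl_id[OF weyl_inv[OF assms(1)]] by auto
  then have "w = id" using weyl_inv_inv[OF assms(1)] by (metis inv_id)
  with assms show False by simp
qed

lemma weyl_induct [consumes 1, case_names id sgen]:
  assumes "w \<in> weyl d" "P id"
    "\<And>w k. w \<in> weyl d \<Longrightarrow> k < d \<Longrightarrow> asc k w \<Longrightarrow> P w \<Longrightarrow> P (sgen k \<circ> w)"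
  shows "P w"
  using assms(1)
proof (induction "card (invs d w)" arbitrary: w rule: less_induct)
  case less
  show ?case
  proof (cases "w = id")
    case False
    then obtain k where k: "k < d" "\<not> asc k w" using ex_descent less by blast
    let ?v = "sgen k \<circ> w"
    have v: "?v \<in> weyl d" "asc k ?v" using asc_sgen[OF less(2) k(1)] k less(2) by auto
    have "card (invs d w) = card (invs d ?v) + (if k = 0 then 3 else 2)"
      using card_invs_sgen[OF v(1) k(1) v(2)] by simp
    then have "P ?v" using less(1)[of ?v] v by simp
    from assms(3)[OF v(1) k(1) v(2) this] show ?thesis by simp
  qed (use assms in simp)
qed

text \<open>A word of length \<open>k\<close> changes \<open>card (invs d w) - neg d w\<close> by at most \<open>2 k\<close>, and a word
  obtained by removing descents attains this bound.\<close>

lemma weyl_len_invs: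
  assumes "w \<in> weyl d"
  shows "card (invs d w) = 2 * weyl_len d w + neg d w"
proof -
  define word where "word is = foldr (\<lambda>i g. sgen i \<circ> g) is id" for "is"
  have word: "word [] = id" "word (k # is) = sgen k \<circ> word is" for k "is"
    by (simp_all add: word_def)
  have weyl: "word is \<in> weyl d" if "set is \<subseteq> {..<d}" for "is"
    using that by (induction "is") (auto simp del: o_apply simp: word(1), simp add: word(2))
  have bound: "card (invs d (word is)) \<le> 2 * length is + neg d (word is)"
    if "set is \<subseteq> {..<d}" for "is"
    using that
  proof (induction "is")
    case Nil
    show ?case by (simp add: word(1))
  next
    case (Cons k "is")
    let ?u = "word is"
    have u: "?u \<in> weyl d" "k < d" using Cons weyl by auto
    show ?case
    proof (cases "asc k ?u")
      case True
      then show ?thesis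
        unfolding word(2) card_invs_sgen[OF u True] neg_sgen[OF u True]
        using Cons by simp
    next
      case False
      then have v: "sgen k \<circ> ?u \<in> weyl d" "asc k (sgen k \<circ> ?u)"
        using asc_sgen[OF u] u by auto
      have arith: "a \<le> 2 * length (k # is) + b"
        if "a' \<le> 2 * length is + b'" "a' = a + (if k = 0 then 3 else 2)"
          "b' = b + (if k = 0 then 1 else 0)" for a b a' b' :: nat
        using that by (simp split: if_splits)
      have "card (invs d (word is)) \<le> 2 * length is + neg d (word is)"
        using Cons by simp
      then show ?thesis
        using arith card_invs_sgen[OF v(1) u(2) v(2)] neg_sgen[OF v(1) u(2) v(2)]
        unfolding word(2) sgen_comp_cancel by metis
    qed
  qed
  have attained: "\<exists>is. set is \<subseteq> {..<d} \<and> w = word is \<and>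
      card (invs d w) = 2 * length is + neg d w"
    using assms
  proof (induction w rule: weyl_induct)
    case id
    show ?case by (intro exI[of _ "[]"]) (simp add: word(1))
  next
    case (sgen w k)
    then obtain "is" where "is": "set is \<subseteq> {..<d}" "w = word is"
      "card (invs d w) = 2 * length is + neg d w" by blast
    show ?case
      using "is" sgen card_invs_sgen[OF sgen(1-3)] neg_sgen[OF sgen(1-3)]
      by (intro exI[of _ "k # is"] conjI) (simp_all only: word(2), auto)
  qed
  obtain "is" where "is": "set is \<subseteq> {..<d}" "w = word is"
    "card (invs d w) = 2 * length is + neg d w"
    using attained by blast
  have "weyl_len d w = length is"
    unfolding weyl_len_def word_def[symmetric]
  proof (rule Least_equality)
    show "\<exists>is'. length is' = length is \<and> set is' \<subseteq> {..<d} \<and> w = word is'"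
      using "is" by blast
  next
    fix k assume "\<exists>is. length is = k \<and> set is \<subseteq> {..<d} \<and> w = word is"
    then show "length is \<le> k" using bound "is"(3) by fastforce
  qed
  with "is" show ?thesis by simp
qed

lemma weyl_len_id [simp]: "weyl_len d id = 0"
  using weyl_len_invs[of id d] by simp

lemma weyl_len_sgen:
  assumes "w \<in> weyl d" "k < d"
  shows "asc k w \<Longrightarrow> weyl_len d (sgen k \<circ> w) = Suc (weyl_len d w)"
    and "\<not> asc k w \<Longrightarrow> weyl_len d w = Suc (weyl_len d (sgen k \<circ> w))"
proof -
  have *: "weyl_len d (sgen k \<circ> u) = Suc (weyl_len d u)" if "asc k u" "u \<in> weyl d" for u
    using weyl_len_invs[of u d] weyl_len_invs[of "sgen k \<circ> u" d] that assms
      card_invs_sgen[OF that(2) assms(2) that(1)] neg_sgen[OF that(2) assms(2) that(1)]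
    by (simp split: if_splits)
  then show "asc k w \<Longrightarrow> weyl_len d (sgen k \<circ> w) = Suc (weyl_len d w)"
    using assms by simp
  show "weyl_len d w = Suc (weyl_len d (sgen k \<circ> w))" if "\<not> asc k w"
    using *[of "sgen k \<circ> w"] that assms asc_sgen[OF assms] by simp
qed

lemma weyl_len_sgen_gen [simp]: "k < d \<Longrightarrow> weyl_len d (sgen k) = 1"
  using weyl_len_sgen(1)[of id d k] by (simp add: inv_id)

lemma card_invs_inv:
  assumes "w \<in> weyl d"
  shows "card (invs d (inv w)) = card (invs d w)"
proof -
  have maps: "(u b, u a) \<in> invs d (inv u)" if "u \<in> weyl d" "(a, b) \<in> invs d u" for u a b
    using that(2) weyl_range[OF that(1), of a] weyl_range[OF that(1), of b]
    by (simp add: invs_def weyl_inv_apply(1)[OF that(1)])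
  have "bij_betw (\<lambda>(a, b). (w b, w a)) (invs d w) (invs d (inv w))"
    using maps[OF assms] maps[OF weyl_inv[OF assms]]
    by (intro bij_betw_byWitness[where f' = "\<lambda>(a, b). (inv w b, inv w a)"])
      (auto simp: weyl_inv_apply[OF assms] weyl_inv_inv[OF assms])
  then show ?thesis by (simp add: bij_betw_same_card)
qed

lemma neg_inv:
  assumes "w \<in> weyl d"
  shows "neg d (inv w) = neg d w"
proof -
  have maps: "- u a \<in> {a \<in> {1..int d}. inv u a < 0} \<and> - inv u (- u a) = a"
    if "u \<in> weyl d" "a \<in> {a \<in> {1..int d}. u a < 0}" for u a
    using that(2) weyl_range[OF that(1), of a] weyl_odd[OF that(1), of "- a"]
      weyl_odd[OF weyl_inv[OF that(1)], of "u a"]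
    by (simp add: weyl_inv_apply(1)[OF that(1)])
  have "bij_betw (\<lambda>a. - w a) {a \<in> {1..int d}. w a < 0} {a \<in> {1..int d}. inv w a < 0}"
    by (rule bij_betw_byWitness[where f' = "\<lambda>a. - inv w a"])
      (use maps[OF assms] maps[OF weyl_inv[OF assms]] in
        \<open>simp_all only: weyl_inv_inv[OF assms] image_subset_iff\<close>, blast+)
  then show ?thesis by (simp add: neg_def bij_betw_same_card)
qed

lemma weyl_len_inv: "w \<in> weyl d \<Longrightarrow> weyl_len d (inv w) = weyl_len d w"
  using weyl_len_invs[of w d] weyl_len_invs[of "inv w" d] card_invs_inv[of w d] neg_inv[of w d]
  by simp

lemma weyl_len_sgen_right:
  assumes "w \<in> weyl d" "k < d"
  shows "w (int k) < w (int k + 1) \<Longrightarrow> weyl_len d (w \<circ> sgen k) = Suc (weyl_len d w)"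
    and "\<not> w (int k) < w (int k + 1) \<Longrightarrow> weyl_len d w = Suc (weyl_len d (w \<circ> sgen k))"
  using weyl_len_sgen[OF weyl_inv[OF assms(1)] assms(2)] weyl_len_inv[of w d]
    weyl_len_inv[of "w \<circ> sgen k" d] assms by (simp_all add: inv_comp_sgen)

section \<open>Blocks and parabolic subgroups\<close>

text \<open>The largest element of the \<open>i\<close>-th block, for nonempty blocks; with it positive, negative and
  zero indices are treated alike.\<close>

definition upper :: "(nat \<Rightarrow> nat) \<Rightarrow> int \<Rightarrow> int" where
  "upper l i = (if 0 \<le> i then int (\<Sum>j\<le>nat i. l j) else - int (\<Sum>j\<le>nat (- i - 1). l j) - 1)"

lemma block_upper: "block l i = {upper l (i - 1) + 1..upper l i}"
proof -
  have S: "l 0 + (\<Sum>j=1..<Suc k. l j) = (\<Sum>j\<le>k. l j)" "l 0 + (\<Sum>j=1..k. l j) = (\<Sum>j\<le>k. l j)" for k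
    by (induction k) auto
  consider "i = 0" | k where "i = int (Suc k)" | k where "i = - int (Suc k)"
    by (metis int_cases3 gr0_implies_Suc)
  then show ?thesis
  proof cases
    case 1
    then show ?thesis by (simp add: block_def upper_def)
  next
    case (2 k)
    have "nat i = Suc k" "nat (i - 1) = k" "i > 0" "0 \<le> i - 1" using 2 by auto
    then show ?thesis by (simp only: block_def upper_def Let_def S) simp
  next
    case (3 k)
    have "nat (- i) = Suc k" "nat (- i - 1) = k" "nat (- (i - 1) - 1) = Suc k"
      "\<not> 0 \<le> i - 1" "\<not> 0 \<le> i" "i \<noteq> 0" "\<not> i > 0"
      using 3 by auto
    then show ?thesis
      by (simp only: block_def upper_def Let_def S if_False image_uminus_atLeastAtMost) simp
  qed
qed

lemma upper_uminus: "upper l (- i - 1) = - upper l i - 1"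
  by (auto simp: upper_def)

lemma upper_mono: "i \<le> j \<Longrightarrow> upper l i \<le> upper l j"
proof -
  have S: "int (\<Sum>j\<le>a. l j) \<le> int (\<Sum>j\<le>b. l j)" if "a \<le> b" for a b
    unfolding of_nat_le_iff using that by (intro sum_mono2) auto
  assume "i \<le> j"
  then have "nat i \<le> nat j" "nat (- j - 1) \<le> nat (- i - 1)" by auto
  from S[OF this(1)] S[OF this(2)] \<open>i \<le> j\<close> show ?thesis
    by (auto simp: upper_def simp del: of_nat_sum)
qed

lemma block_le_upper: "a \<in> block l i \<Longrightarrow> a \<le> upper l q \<longleftrightarrow> i \<le> q"
  using upper_mono[of i q l] upper_mono[of q "i - 1" l]
  by (cases "i \<le> q") (auto simp: block_upper)

lemma block_unique: "a \<in> block l i \<Longrightarrow> a \<in> block l j \<Longrightarrow> i = j"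
  using block_le_upper[of a l i] block_le_upper[of a l j] by (meson order_antisym order_refl)

lemma block_less: "a \<in> block l i \<Longrightarrow> b \<in> block l j \<Longrightarrow> i < j \<Longrightarrow> a < b"
  using block_le_upper[of a l i i] block_le_upper[of b l j i] by auto

lemma block_uminus: "- a \<in> block l (- i) \<longleftrightarrow> a \<in> block l i"
  using upper_uminus[of l i] upper_uminus[of l "i - 1"] by (auto simp: block_upper)

lemma zero_in_block_0: "0 \<in> block l 0"
  by (simp add: block_def)

lemma upper_top: "l \<in> Lam n d \<Longrightarrow> int n \<le> i \<Longrightarrow> upper l i = int d"
proof -
  assume l: "l \<in> Lam n d" and i: "int n \<le> i"
  have "(\<Sum>j\<le>nat i. l j) = (\<Sum>j\<le>n. l j)"
    using l i by (intro sum.mono_neutral_right) (auto simp: Lam_def)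
  with l i show ?thesis by (simp add: upper_def Lam_def)
qed

lemma upper_bottom: "l \<in> Lam n d \<Longrightarrow> i < - int n \<Longrightarrow> upper l i = - int d - 1"
  using upper_top[of l n d "- i - 1"] upper_uminus[of l i] by simp

lemma upper_bounds:
  assumes "l \<in> Lam n d"
  shows "- int d - 1 \<le> upper l i" "upper l i \<le> int d"
proof -
  have "upper l (min i (- int n - 1)) \<le> upper l i" "upper l i \<le> upper l (max i (int n))"
    by (intro upper_mono; simp)+
  moreover have "upper l (min i (- int n - 1)) = - int d - 1" "upper l (max i (int n)) = int d"
    using upper_bottom[OF assms, of "min i (- int n - 1)"] upper_top[OF assms, of "max i (int n)"]
    by auto
  ultimately show "- int d - 1 \<le> upper l i" "upper l i \<le> int d" by linarith+
qed

lemma block_subset: "l \<in> Lam n d \<Longrightarrow> block l i \<subseteq> {- int d..int d}"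
  using upper_bounds(1)[of l n d "i - 1"] upper_bounds(2)[of l n d i] by (auto simp: block_upper)

lemma block_outside: "l \<in> Lam n d \<Longrightarrow> i \<notin> idx n \<Longrightarrow> block l i = {}"
  using upper_top[of l n d] upper_bottom[of l n d]
  by (cases "i > int n") (auto simp: block_upper)

lemma ex_block:
  assumes l: "l \<in> Lam n d" and a: "- int d \<le> a" "a \<le> int d"
  shows "\<exists>i\<in>idx n. a \<in> block l i"
proof -
  have "a \<le> upper l j \<longrightarrow> (\<exists>i\<in>{- int n..j}. a \<in> block l i)" if "- int n - 1 \<le> j" for j
    using that
  proof (induction j rule: int_ge_induct)
    case base
    then show ?case using upper_bottom[OF l, of "- int n - 1"] a by auto
  next
    case (step j)
    show ?case
    proof
      assume "a \<le> upper l (j + 1)"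
      then consider "a \<le> upper l j" | "a \<in> block l (j + 1)" by (force simp: block_upper)
      then show "\<exists>i\<in>{- int n..j + 1}. a \<in> block l i"
      proof cases
        case 1
        then obtain i where "i \<in> {- int n..j}" "a \<in> block l i" using step by blast
        then show ?thesis by (intro bexI[of _ i]) auto
      next
        case 2
        then show ?thesis using step by (intro bexI[of _ "j + 1"]) auto
      qed
    qed
  qed
  from this[of "int n"] show ?thesis using upper_top[OF l, of "int n"] a by auto
qed

definition gens :: "nat \<Rightarrow> (nat \<Rightarrow> nat) \<Rightarrow> nat set" where
  "gens d l = {k. k < d \<and> (\<exists>i. int k \<in> block l i \<and> int k + 1 \<in> block l i)}"

lemma gens_less: "k \<in> gens d l \<Longrightarrow> k < d"
  by (simp add: gens_def)

lemma parabolicI: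
  assumes "w \<in> weyl d" "\<And>i a. a \<in> block l i \<Longrightarrow> w a \<in> block l i"
  shows "w \<in> parabolic d l"
proof -
  have "w ` block l i = block l i" for i
  proof (rule card_subset_eq)
    show "card (w ` block l i) = card (block l i)"
      by (rule card_image) (meson inj_onI weyl_eq_iff[OF assms(1)])
  qed (use assms in \<open>auto simp: block_upper\<close>)
  with assms show ?thesis by (simp add: parabolic_def)
qed

lemma parabolic_weyl: "w \<in> parabolic d l \<Longrightarrow> w \<in> weyl d"
  by (simp add: parabolic_def)

lemma parabolic_block_iff: "w \<in> parabolic d l \<Longrightarrow> w a \<in> block l i \<longleftrightarrow> a \<in> block l i"
  by (smt (verit) imageE image_eqI mem_Collect_eq parabolic_def weyl_eq_iff)

lemma parabolic_id [simp]: "id \<in> parabolic d l"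
  by (simp add: parabolic_def)

lemma parabolic_comp: "w \<in> parabolic d l \<Longrightarrow> w' \<in> parabolic d l \<Longrightarrow> w \<circ> w' \<in> parabolic d l"
  by (rule parabolicI) (auto simp: parabolic_weyl parabolic_block_iff)

lemma parabolic_inv: "w \<in> parabolic d l \<Longrightarrow> inv w \<in> parabolic d l"
  using parabolic_block_iff[of w d l "inv w _"] parabolic_weyl[of w d l]
  by (intro parabolicI) (auto simp: weyl_inv_apply)

lemma sgen_parabolic:
  assumes "k \<in> gens d l"
  shows "sgen k \<in> parabolic d l"
proof (rule parabolicI)
  obtain i where i: "int k \<in> block l i" "int k + 1 \<in> block l i"
    using assms by (auto simp: gens_def)
  have mi: "- int k \<in> block l (- i)" "- int k - 1 \<in> block l (- i)"
    using i block_uminus[of "int k" l i] block_uminus[of "int k + 1" l i] by simp_all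
  have z: "k = 0 \<Longrightarrow> i = 0" using i zero_in_block_0 block_unique by fastforce
  fix j a assume a: "a \<in> block l j"
  consider "a = int k" | "a = int k + 1" | "a = - int k" | "a = - int k - 1"
    | "a \<noteq> int k" "a \<noteq> int k + 1" "a \<noteq> - int k" "a \<noteq> - int k - 1" by blast
  then show "sgen k a \<in> block l j"
  proof cases
    case 1
    then have "j = i" using a i block_unique by blast
    then show ?thesis using 1 i z mi zero_in_block_0[of l] by (cases "k = 0") (auto simp: sgen_apply)
  next
    case 2
    then have "j = i" using a i block_unique by blast
    then show ?thesis using 2 i z mi zero_in_block_0[of l] by (cases "k = 0") (auto simp: sgen_apply)
  next
    case 3
    then have "j = - i" using a mi block_unique by blast
    then show ?thesis using 3 i z mi zero_in_block_0[of l] by (cases "k = 0") (auto simp: sgen_apply)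
  next
    case 4
    then have "j = - i" using a mi block_unique by blast
    then show ?thesis using 4 i z mi zero_in_block_0[of l] by (cases "k = 0") (auto simp: sgen_apply)
  next
    case 5
    then show ?thesis using a by (simp add: sgen_apply)
  qed
qed (use assms in \<open>simp add: gens_less\<close>)

text \<open>The hypothesis concerns neighbours \<open>k, k + 1\<close> with \<open>k \<ge> 0\<close>; oddness carries it over to
  negative neighbours.\<close>

lemma odd_mono_on_block:
  fixes f :: "int \<Rightarrow> int"
  assumes l: "l \<in> Lam n d" and odd: "\<And>a. f (- a) = - f a"
    and gens: "\<And>k. k \<in> gens d l \<Longrightarrow> f (int k) < f (int k + 1)"
    and ab: "a \<in> block l i" "b \<in> block l i" "a < b"
  shows "f a < f b"
proof -
  have adj: "f c < f (c + 1)" if c: "c \<in> block l j" "c + 1 \<in> block l j" for c j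
  proof (cases "0 \<le> c")
    case True
    have "c + 1 \<le> int d" using c block_subset[OF l] by fastforce
    then have "nat c \<in> gens d l" using c True by (auto simp: gens_def)
    from gens[OF this] show ?thesis using True by simp
  next
    case False
    have "- c - 1 \<in> block l (- j)" "- c \<in> block l (- j)"
      using c block_uminus[of c l j] block_uminus[of "c + 1" l j] by simp_all
    moreover have "- c \<le> int d" using c block_subset[OF l] by fastforce
    ultimately have "nat (- c - 1) \<in> gens d l" using False by (auto simp: gens_def)
    moreover have "- (c + 1) = - c - 1" by simp
    ultimately have "f (- (c + 1)) < f (- c)" using gens[of "nat (- c - 1)"] False by simp
    then show ?thesis by (simp only: odd neg_less_iff_less)
  qed
  have "b \<in> block l i \<longrightarrow> f a < f b"
    using ab(3)
  proof (induction b rule: int_gr_induct)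
    case base
    then show ?case using adj ab(1) by blast
  next
    case (step b)
    show ?case
    proof
      assume b: "b + 1 \<in> block l i"
      then have "b \<in> block l i" using ab(1) step by (auto simp: block_upper)
      with b step adj show "f a < f (b + 1)" by fastforce
    qed
  qed
  with ab show ?thesis by blast
qed

text \<open>Without descents inside the blocks, \<open>inv w\<close> is increasing on each block; as it preserves the
  blocks, it is increasing everywhere.\<close>

lemma ex_parabolic_descent:
  assumes l: "l \<in> Lam n d" and w: "w \<in> parabolic d l" "w \<noteq> id"
  shows "\<exists>k\<in>gens d l. \<not> asc k w"
proof (rule ccontr)
  assume "\<not> ?thesis"
  then have gens: "asc k w" if "k \<in> gens d l" for k using that by blast
  note iw = weyl_inv[OF parabolic_weyl[OF w(1)]]
  have "asc k w" if k: "k < d" for k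
  proof -
    obtain i j where ij: "int k \<in> block l i" "int k + 1 \<in> block l j"
      using ex_block[OF l, of "int k"] ex_block[OF l, of "int k + 1"] k by auto
    then have "i \<le> j" using block_less by (meson less_add_one linorder_not_less order_less_asym)
    show ?thesis
    proof (cases "i = j")
      case True
      then show ?thesis
        using odd_mono_on_block[OF l weyl_odd[OF iw] gens] ij by fastforce
    next
      case False
      have "inv w (int k) \<in> block l i" "inv w (int k + 1) \<in> block l j"
        using ij parabolic_block_iff[OF parabolic_inv[OF w(1)]] by auto
      then show ?thesis using False \<open>i \<le> j\<close> block_less by fastforce
    qed
  qed
  then show False using ex_descent[OF parabolic_weyl[OF w(1)] w(2)] by blast
qed

lemma parabolic_induct [consumes 2, case_names id sgen]:
  assumes l: "l \<in> Lam n d" and w: "w \<in> parabolic d l" and "P id"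
    "\<And>w k. w \<in> parabolic d l \<Longrightarrow> k \<in> gens d l \<Longrightarrow> asc k w \<Longrightarrow> P w \<Longrightarrow> P (sgen k \<circ> w)"
  shows "P w"
  using w
proof (induction "weyl_len d w" arbitrary: w rule: less_induct)
  case less
  show ?case
  proof (cases "w = id")
    case False
    then obtain k where k: "k \<in> gens d l" "\<not> asc k w"
      using ex_parabolic_descent[OF l] less by blast
    let ?v = "sgen k \<circ> w"
    have v: "?v \<in> parabolic d l" "asc k ?v"
      using asc_sgen[OF parabolic_weyl[OF less(2)] gens_less[OF k(1)]] k less(2)
        parabolic_comp sgen_parabolic by auto
    have "weyl_len d ?v < weyl_len d w"
      using weyl_len_sgen(2)[OF parabolic_weyl[OF less(2)] gens_less[OF k(1)] k(2)] by simp
    then have "P ?v" using less(1)[of ?v] v by simp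
    from assms(4)[OF v(1) k(1) v(2) this] show ?thesis by simp
  qed (use assms in simp)
qed

lemma weyl_len_eq_0: "w \<in> weyl d \<Longrightarrow> weyl_len d w = 0 \<Longrightarrow> w = id"
  using ex_descent[of w d] weyl_len_sgen(2)[of w d] by force

text \<open>If \<open>g\<close> has no descent inside the blocks, then \<open>inv g\<close> is increasing on each block, so an
  ascent of a block-preserving \<open>w\<close> remains an ascent of \<open>w \<circ> g\<close>.\<close>

lemma parabolic_len_add:
  assumes l: "l \<in> Lam n d" and g: "g \<in> weyl d" "\<And>k. k \<in> gens d l \<Longrightarrow> asc k g"
    and w: "w \<in> parabolic d l"
  shows "weyl_len d (w \<circ> g) = weyl_len d w + weyl_len d g"
  using l w
proof (induction w rule: parabolic_induct)
  case id
  then show ?case by (metis add_0 id_comp weyl_len_id)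
next
  case (sgen w k)
  have w: "w \<in> weyl d" "inv w \<in> parabolic d l"
    using sgen parabolic_weyl parabolic_inv by auto
  obtain i where "int k \<in> block l i" "int k + 1 \<in> block l i"
    using sgen(2) by (auto simp: gens_def)
  then have "inv w (int k) \<in> block l i" "inv w (int k + 1) \<in> block l i"
    using parabolic_block_iff[OF w(2)] by auto
  then have "inv g (inv w (int k)) < inv g (inv w (int k + 1))"
    using odd_mono_on_block[OF l weyl_odd[OF weyl_inv[OF g(1)]] g(2)] sgen(3) by blast
  then have "asc k (w \<circ> g)" using weyl_inv_comp[OF w(1) g(1)] by simp
  then show ?case
    using weyl_len_sgen(1)[of "w \<circ> g" d k] weyl_len_sgen(1)[of w d k] sgen w g gens_less
    by (metis add_Suc comp_assoc weyl_comp)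
qed

text \<open>Removing descents inside the blocks one after the other ends at a descent-free element. If two
  such elements differ by a factor \<open>u\<close> in the parabolic subgroup, then additivity in both
  directions forces \<open>u\<close> to have length zero.\<close>

lemma parabolic_decomposition:
  assumes l: "l \<in> Lam n d"
  shows "bij_betw (\<lambda>(w, g). w \<circ> g) (parabolic d l \<times> {g \<in> weyl d. \<forall>k\<in>gens d l. asc k g}) (weyl d)"
    (is "bij_betw ?f (?P \<times> ?G) _")
proof (rule bij_betw_imageI)
  show "inj_on ?f (?P \<times> ?G)"
  proof (rule inj_onI, clarify)
    fix w g w' g'
    assume w: "w \<in> ?P" "w' \<in> ?P" and g: "g \<in> weyl d" "\<forall>k\<in>gens d l. asc k g"
      "g' \<in> weyl d" "\<forall>k\<in>gens d l. asc k g'" and eq: "w \<circ> g = w' \<circ> g'"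
    define u where "u = inv w' \<circ> w"
    have u: "u \<in> ?P" unfolding u_def by (intro parabolic_comp parabolic_inv w)
    have g': "g' = u \<circ> g"
      unfolding u_def comp_assoc eq using weyl_inv_apply(1)[OF parabolic_weyl[OF w(2)]] by auto
    have "g = inv u \<circ> g'"
      unfolding g' using weyl_inv_apply(1)[OF parabolic_weyl[OF u]] by auto
    then have "weyl_len d g = weyl_len d (inv u) + weyl_len d g'"
      using parabolic_len_add[OF l g(3) _ parabolic_inv[OF u]] g by auto
    moreover have "weyl_len d g' = weyl_len d u + weyl_len d g"
      unfolding g' using parabolic_len_add[OF l g(1) _ u] g by auto
    ultimately have "weyl_len d u = 0" by linarith
    then have "u = id" using weyl_len_eq_0 parabolic_weyl[OF u] by blast
    then have "g' = g" using g' by simp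
    moreover have "w = w'"
    proof -
      have "w' \<circ> u = w"
        unfolding u_def using weyl_inv_apply(2)[OF parabolic_weyl[OF w(2)]] by auto
      with \<open>u = id\<close> show ?thesis by simp
    qed
    ultimately show "w = w' \<and> g = g'" by simp
  qed
next
  have "\<exists>w\<in>?P. \<exists>g\<in>?G. y = w \<circ> g" if "y \<in> weyl d" for y
    using that
  proof (induction "weyl_len d y" arbitrary: y rule: less_induct)
    case less
    show ?case
    proof (cases "y \<in> ?G")
      case True
      then show ?thesis by (intro bexI[of _ id] bexI[of _ y]) auto
    next
      case False
      then obtain k where k: "k \<in> gens d l" "\<not> asc k y" using less by auto
      have "weyl_len d (sgen k \<circ> y) < weyl_len d y"
        using weyl_len_sgen(2)[OF less(2) gens_less[OF k(1)] k(2)] by simp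
      then obtain w g where "w \<in> ?P" "g \<in> ?G" "sgen k \<circ> y = w \<circ> g"
        using less gens_less[OF k(1)] by (metis (no_types, lifting) sgen_weyl weyl_comp)
      then have "y = (sgen k \<circ> w) \<circ> g" "sgen k \<circ> w \<in> ?P"
        using parabolic_comp[OF sgen_parabolic[OF k(1)]] by (metis comp_assoc sgen_comp_cancel(1), blast)
      with \<open>g \<in> ?G\<close> show ?thesis by blast
    qed
  qed
  moreover have "w \<circ> g \<in> weyl d" if "w \<in> ?P" "g \<in> ?G" for w g
    using that parabolic_weyl by auto
  ultimately show "?f ` (?P \<times> ?G) = weyl d"
    by (intro set_eqI iffI) (force, fastforce)
qed

subsection \<open>Double cosets\<close>

lemma double_coset_weyl: "g \<in> weyl d \<Longrightarrow> w \<in> double_coset d l g m \<Longrightarrow> w \<in> weyl d"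
  unfolding double_coset_def using parabolic_weyl[of _ d] weyl_comp[of _ d] by blast

lemma double_coset_self: "g \<in> double_coset d l g m"
  unfolding double_coset_def by (force intro: exI[of _ id])

lemma double_coset_left:
  "w \<in> double_coset d l g m \<Longrightarrow> u \<in> parabolic d l \<Longrightarrow> u \<circ> w \<in> double_coset d l g m"
  unfolding double_coset_def by (smt (verit, best) comp_assoc mem_Collect_eq parabolic_comp)

lemma double_coset_right:
  "w \<in> double_coset d l g m \<Longrightarrow> u \<in> parabolic d m \<Longrightarrow> w \<circ> u \<in> double_coset d l g m"
  unfolding double_coset_def by (smt (verit, best) comp_assoc mem_Collect_eq parabolic_comp)

lemma double_coset_eq:
  assumes "w \<in> double_coset d l g m"
  shows "double_coset d l w m = double_coset d l g m"
proof -
  have sub: "double_coset d l w m \<subseteq> double_coset d l g m" if "w \<in> double_coset d l g m" for w g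
    using double_coset_left double_coset_right that
    by (fastforce simp: double_coset_def[of d l w m])
  obtain u v where uv: "u \<in> parabolic d l" "v \<in> parabolic d m" "w = u \<circ> g \<circ> v"
    using assms by (auto simp: double_coset_def)
  then have "g = inv u \<circ> w \<circ> inv v"
    using weyl_inv_apply[OF parabolic_weyl[OF uv(1)]] weyl_inv_apply[OF parabolic_weyl[OF uv(2)]]
    by (simp add: fun_eq_iff)
  then have "g \<in> double_coset d l w m"
    using uv parabolic_inv unfolding double_coset_def by blast
  with sub assms show ?thesis by blast
qed

lemma min_reps_weyl: "g \<in> min_reps d l m \<Longrightarrow> g \<in> weyl d"
  by (simp add: min_reps_def)

lemma min_reps_ascents:
  assumes "g \<in> min_reps d l m"
  shows "k \<in> gens d l \<Longrightarrow> asc k g" "k \<in> gens d m \<Longrightarrow> g (int k) < g (int k + 1)"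
proof -
  have min: "weyl_len d g \<le> weyl_len d w" if "w \<in> double_coset d l g m" for w
    using assms that by (simp add: min_reps_def)
  show "asc k g" if "k \<in> gens d l"
    using min[OF double_coset_left[OF double_coset_self sgen_parabolic[OF that]]]
      weyl_len_sgen(2)[OF min_reps_weyl[OF assms] gens_less[OF that]] by linarith
  show "g (int k) < g (int k + 1)" if "k \<in> gens d m"
    using min[OF double_coset_right[OF double_coset_self sgen_parabolic[OF that]]]
      weyl_len_sgen_right(2)[OF min_reps_weyl[OF assms] gens_less[OF that]] by linarith
qed

lemma finite_double_coset: "g \<in> weyl d \<Longrightarrow> finite (double_coset d l g m)"
  by (rule finite_subset[OF _ finite_weyl[of d]]) (auto simp: double_coset_weyl)

lemma ex_min_rep:
  assumes "w \<in> weyl d"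
  shows "\<exists>g\<in>min_reps d l m. double_coset d l g m = double_coset d l w m"
proof -
  obtain g where g: "g \<in> double_coset d l w m"
    "\<And>h. h \<in> double_coset d l w m \<Longrightarrow> weyl_len d g \<le> weyl_len d h"
    using ex_has_least_nat[of "\<lambda>g. g \<in> double_coset d l w m" w "weyl_len d"] double_coset_self
    by blast
  have "g \<in> min_reps d l m"
    unfolding min_reps_def using g double_coset_eq[OF g(1)] double_coset_weyl[OF assms g(1)] by auto
  with double_coset_eq[OF g(1)] show ?thesis by blast
qed

definition max_reps :: "nat \<Rightarrow> (nat \<Rightarrow> nat) \<Rightarrow> (int \<Rightarrow> int) \<Rightarrow> (nat \<Rightarrow> nat) \<Rightarrow> (int \<Rightarrow> int) set" where
  "max_reps d l g m = {h \<in> double_coset d l g m. \<forall>w\<in>double_coset d l g m. weyl_len d w \<le> weyl_len d h}"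

lemma ex_max_rep:
  assumes "g \<in> weyl d"
  shows "\<exists>h. h \<in> max_reps d l g m"
  using finite_has_greatest_value[OF finite_double_coset[OF assms], of l m "weyl_len d"]
    double_coset_self[of g d l m] unfolding max_reps_def by blast

lemma max_reps_descents:
  assumes "g \<in> weyl d" "h \<in> max_reps d l g m"
  shows "k \<in> gens d l \<Longrightarrow> \<not> asc k h" "k \<in> gens d m \<Longrightarrow> \<not> h (int k) < h (int k + 1)"
proof -
  have h: "h \<in> double_coset d l g m" "h \<in> weyl d"
    using assms double_coset_weyl[OF assms(1)] by (auto simp: max_reps_def)
  have max: "weyl_len d w \<le> weyl_len d h" if "w \<in> double_coset d l g m" for w
    using assms that by (simp add: max_reps_def)
  show "\<not> asc k h" if "k \<in> gens d l"
    using max[OF double_coset_left[OF h(1) sgen_parabolic[OF that]]]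
      weyl_len_sgen(1)[OF h(2) gens_less[OF that]] by linarith
  show "\<not> h (int k) < h (int k + 1)" if "k \<in> gens d m"
    using max[OF double_coset_right[OF h(1) sgen_parabolic[OF that]]]
      weyl_len_sgen_right(1)[OF h(2) gens_less[OF that]] by linarith
qed

section \<open>Matrices and double cosets\<close>

definition blk :: "(nat \<Rightarrow> nat) \<Rightarrow> int \<Rightarrow> int" where
  "blk l a = (THE i. a \<in> block l i)"

lemma blk_eqI: "a \<in> block l i \<Longrightarrow> blk l a = i"
  unfolding blk_def using block_unique by (intro the_equality) blast+

lemma blk_block:
  assumes "l \<in> Lam n d" "- int d \<le> a" "a \<le> int d"
  shows "a \<in> block l (blk l a)" "- int n \<le> blk l a" "blk l a \<le> int n"
proof -
  obtain i where "i \<in> idx n" "a \<in> block l i" using ex_block[OF assms] by blast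
  with blk_eqI show "a \<in> block l (blk l a)" "- int n \<le> blk l a" "blk l a \<le> int n" by force+
qed

lemma in_block_iff:
  assumes "l \<in> Lam n d"
  shows "a \<in> block l i \<longleftrightarrow> - int d \<le> a \<and> a \<le> int d \<and> blk l a = i"
  using blk_eqI[of a l i] block_subset[OF assms, of i] blk_block(1)[OF assms, of a] by auto

lemma blk_uminus: "l \<in> Lam n d \<Longrightarrow> - int d \<le> a \<Longrightarrow> a \<le> int d \<Longrightarrow> blk l (- a) = - blk l a"
  using blk_block(1)[of l n d a] block_uminus by (intro blk_eqI) blast

lemma blk_0 [simp]: "blk l 0 = 0"
  by (rule blk_eqI[OF zero_in_block_0])

lemma blk_mono:
  assumes "l \<in> Lam n d" "- int d \<le> a" "a \<le> b" "b \<le> int d"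
  shows "blk l a \<le> blk l b"
  using blk_block(1)[OF assms(1), of a] blk_block(1)[OF assms(1), of b] assms
    block_less[of b l "blk l b" a "blk l a"] by force

lemma blk_less_imp:
  assumes "l \<in> Lam n d" "- int d \<le> a" "a \<le> int d" "- int d \<le> b" "b \<le> int d" "blk l a < blk l b"
  shows "a < b"
  using blk_mono[OF assms(1), of b a] assms by force

lemma blk_le_iff:
  assumes "l \<in> Lam n d" "- int d \<le> a" "a \<le> int d"
  shows "blk l a \<le> i \<longleftrightarrow> a \<le> upper l i"
  using block_le_upper[OF blk_block(1)[OF assms]] by simp

lemma weyl_interval: "w \<in> weyl d \<Longrightarrow> b \<in> {- int d..int d} \<Longrightarrow> w b \<in> {- int d..int d}"
  using weyl_range[of w d b] by simp

lemma blk_weyl: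
  assumes "l \<in> Lam n d" "w \<in> weyl d" "b \<in> {- int d..int d}"
  shows "blk l (w b) \<in> idx n" "blk l (w (- b)) = - blk l (w b)"
  using blk_block[OF assms(1), of "w b"] blk_uminus[OF assms(1), of "w b"]
    weyl_interval[OF assms(2,3)] weyl_odd[OF assms(2), of b] by auto

lemma blk_idx: "l \<in> Lam n d \<Longrightarrow> b \<in> {- int d..int d} \<Longrightarrow> blk l b \<in> idx n"
  using blk_block[of l n d b] by auto

lemma kappa_card:
  assumes l: "l \<in> Lam n d" "m \<in> Lam n d" and w: "w \<in> weyl d"
  shows "kappa (l, w, m) i j = card {b \<in> {- int d..int d}. blk l (w b) = i \<and> blk m b = j}"
proof -
  have "block l i \<inter> w ` block m j = w ` {b \<in> {- int d..int d}. blk l (w b) = i \<and> blk m b = j}"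
    using weyl_range[OF w] by (auto simp: in_block_iff[OF l(1)] in_block_iff[OF l(2)])
  moreover have "card (w ` S) = card S" for S
    by (rule card_image) (meson inj_onI weyl_eq_iff[OF w])
  ultimately show ?thesis by (simp add: kappa_def)
qed

lemma sum_card_fibres:
  fixes f g :: "'a \<Rightarrow> int"
  assumes "finite D" "finite I" "finite J"
  shows "(\<Sum>i\<in>I. \<Sum>j\<in>J. card {b \<in> D. f b = i \<and> g b = j}) = card {b \<in> D. f b \<in> I \<and> g b \<in> J}"
proof -
  have "(\<Sum>i\<in>I. \<Sum>j\<in>J. card {b \<in> D. f b = i \<and> g b = j})
      = (\<Sum>p\<in>I \<times> J. card {b \<in> D. (f b, g b) = p})"
    by (simp add: sum.cartesian_product case_prod_unfold prod_eq_iff)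
  also have "\<dots> = card (\<Union>p\<in>I \<times> J. {b \<in> D. (f b, g b) = p})"
    using assms by (intro card_UN_disjoint[symmetric]) auto
  also have "(\<Union>p\<in>I \<times> J. {b \<in> D. (f b, g b) = p}) = {b \<in> D. f b \<in> I \<and> g b \<in> J}"
    by auto
  finally show ?thesis .
qed

lemma kappa_sum:
  assumes l: "l \<in> Lam n d" "m \<in> Lam n d" and w: "w \<in> weyl d" and fin: "finite I" "finite J"
  shows "(\<Sum>i\<in>I. \<Sum>j\<in>J. kappa (l, w, m) i j) =
     card {b \<in> {- int d..int d}. blk l (w b) \<in> I \<and> blk m b \<in> J}"
  unfolding kappa_card[OF l w] by (rule sum_card_fibres) (use fin in auto)

lemma card_block_pos: "0 < i \<Longrightarrow> card (block l (int i)) = l i"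
proof -
  assume "0 < i"
  then obtain k where k: "i = Suc k" using gr0_implies_Suc by blast
  have "nat (int i) = Suc k" "nat (int i - 1) = k" "0 \<le> int i" "0 \<le> int i - 1"
    using k by auto
  then have "upper l (int i) - upper l (int i - 1) = int (l i)"
    unfolding upper_def k by simp
  then show ?thesis by (simp add: block_upper)
qed

lemma card_block_0: "card (block l 0) = 2 * l 0 + 1"
  by (simp add: block_def)

lemma card_block_uminus: "card (block l (- i)) = card (block l i)"
proof -
  have "block l (- i) = uminus ` block l i"
  proof (intro set_eqI iffI)
    fix a assume "a \<in> block l (- i)"
    then have "- a \<in> block l i" using block_uminus[of "- a" l i] by simp
    then show "a \<in> uminus ` block l i" by (metis image_eqI minus_minus)
  qed (auto simp: block_uminus)
  then show ?thesis by (simp add: card_image)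
qed

lemma card_block_upper: "int (card (block l i)) = upper l i - upper l (i - 1)"
  using upper_mono[of "i - 1" i l] by (simp add: block_upper)

lemma card_weyl_preimage:
  assumes "w \<in> weyl d"
  shows "card {b \<in> {- int d..int d}. P (w b)} = card {b \<in> {- int d..int d}. P b}"
proof -
  have "bij_betw w {b \<in> {- int d..int d}. P (w b)} {b \<in> {- int d..int d}. P b}"
    using weyl_range[OF assms] weyl_range[OF weyl_inv[OF assms]]
    by (intro bij_betw_byWitness[where f' = "inv w"]) (auto simp: weyl_inv_apply[OF assms])
  then show ?thesis by (rule bij_betw_same_card)
qed

lemma block_blk: "l \<in> Lam n d \<Longrightarrow> block l i = {b \<in> {- int d..int d}. blk l b = i}"
  by (auto simp: in_block_iff)

lemma row_kappa:
  assumes l: "l \<in> Lam n d" "m \<in> Lam n d" and w: "w \<in> weyl d"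
  shows "row n (kappa (l, w, m)) i = card (block l i)"
proof -
  have "row n (kappa (l, w, m)) i = card {b \<in> {- int d..int d}. blk l (w b) \<in> {i} \<and> blk m b \<in> idx n}"
    using kappa_sum[OF l w, of "{i}" "idx n"] by (simp add: row_def)
  also have "\<dots> = card {b \<in> {- int d..int d}. blk l (w b) = i}"
    using blk_idx[OF l(2)] by (intro arg_cong[where f = card]) blast
  also have "\<dots> = card (block l i)"
    using card_weyl_preimage[OF w] by (simp add: block_blk[OF l(1)])
  finally show ?thesis .
qed

lemma col_kappa:
  assumes l: "l \<in> Lam n d" "m \<in> Lam n d" and w: "w \<in> weyl d"
  shows "col n (kappa (l, w, m)) j = card (block m j)"
proof -
  have "col n (kappa (l, w, m)) j = card {b \<in> {- int d..int d}. blk l (w b) \<in> idx n \<and> blk m b \<in> {j}}"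
    using kappa_sum[OF l w, of "idx n" "{j}"] by (simp add: col_def)
  also have "\<dots> = card (block m j)"
    unfolding block_blk[OF l(2)] using blk_weyl(1)[OF l(1) w]
    by (intro arg_cong[where f = card]) blast
  finally show ?thesis .
qed

lemma Lam_eqI:
  assumes "l \<in> Lam n d" "m \<in> Lam n d" "\<And>i. card (block l i) = card (block m i)"
  shows "l = m"
proof
  fix i show "l i = m i"
    using assms(3)[of "int i"] assms(3)[of 0]
    by (cases "i = 0") (auto simp: card_block_pos card_block_0)
qed

lemma kappa_uminus:
  assumes l: "l \<in> Lam n d" "m \<in> Lam n d" and w: "w \<in> weyl d"
  shows "kappa (l, w, m) (- i) (- j) = kappa (l, w, m) i j"
proof -
  have "bij_betw uminus {b \<in> {- int d..int d}. blk l (w b) = - i \<and> blk m b = - j}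
      {b \<in> {- int d..int d}. blk l (w b) = i \<and> blk m b = j}"
    by (rule bij_betw_byWitness[where f' = uminus])
      (use blk_weyl(2)[OF l(1) w] blk_weyl(2)[OF l(2) weyl_id] in \<open>force simp: id_def\<close>)+
  then show ?thesis by (simp add: kappa_card[OF l w] bij_betw_same_card)
qed

text \<open>Apart from \<open>0\<close>, the central cell consists of pairs of opposite elements.\<close>

lemma kappa_central:
  assumes l: "l \<in> Lam n d" "m \<in> Lam n d" and w: "w \<in> weyl d"
  shows "kappa (l, w, m) 0 0 =
     2 * card {b \<in> {- int d..int d}. 0 < b \<and> blk l (w b) = 0 \<and> blk m b = 0} + 1"
proof -
  let ?P = "{b \<in> {- int d..int d}. 0 < b \<and> blk l (w b) = 0 \<and> blk m b = 0}"
  have fin: "finite ?P" by (rule finite_subset[of _ "{- int d..int d}"]) auto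
  have "{b \<in> {- int d..int d}. blk l (w b) = 0 \<and> blk m b = 0} = insert 0 (?P \<union> uminus ` ?P)"
  proof (intro set_eqI iffI)
    fix b assume b: "b \<in> {b \<in> {- int d..int d}. blk l (w b) = 0 \<and> blk m b = 0}"
    then have "- b \<in> ?P" if "b < 0"
      using that blk_uminus[OF l(2), of b] blk_uminus[OF l(1), of "w b"] weyl_range[OF w, of b]
      by (auto simp: weyl_odd[OF w])
    moreover have "b \<in> ?P" if "0 < b" using that b by auto
    ultimately show "b \<in> insert 0 (?P \<union> uminus ` ?P)"
      by (metis (no_types, lifting) UnCI image_eqI insertCI linorder_neqE_linordered_idom minus_minus)
  next
    fix b assume "b \<in> insert 0 (?P \<union> uminus ` ?P)"
    then consider "b = 0" | "b \<in> ?P" | c where "c \<in> ?P" "b = - c" by blast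
    then show "b \<in> {b \<in> {- int d..int d}. blk l (w b) = 0 \<and> blk m b = 0}"
    proof cases
      case 3
      then show ?thesis
        using blk_uminus[OF l(2), of c] blk_uminus[OF l(1), of "w c"] weyl_range[OF w, of c]
        by (auto simp: weyl_odd[OF w])
    qed (use w in auto)
  qed
  moreover have "card (insert 0 (?P \<union> uminus ` ?P)) = Suc (card ?P + card (uminus ` ?P))"
    using fin by (subst card_insert_disjoint) (auto intro!: card_Un_disjoint)
  moreover have "card (uminus ` ?P) = card ?P" by (rule card_image) simp
  ultimately show ?thesis by (simp add: kappa_card[OF l w])
qed

lemma kappa_Xi:
  assumes l: "l \<in> Lam n d" "m \<in> Lam n d" and w: "w \<in> weyl d"
  shows "kappa (l, w, m) \<in> Xi n d"
proof -
  have "(\<Sum>i\<in>idx n. \<Sum>j\<in>idx n. kappa (l, w, m) i j) = card {- int d..int d}"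
    unfolding kappa_sum[OF l w finite_atLeastAtMost_int finite_atLeastAtMost_int]
    using blk_weyl(1)[OF l(1) w] blk_idx[OF l(2)]
    by (intro arg_cong[where f = card]) blast
  moreover have "kappa (l, w, m) i j = 0" if "i \<notin> idx n \<or> j \<notin> idx n" for i j
    using that block_outside[OF l(1)] block_outside[OF l(2)] by (auto simp: kappa_def)
  moreover have "odd (kappa (l, w, m) 0 0)" unfolding kappa_central[OF l w] by simp
  ultimately show ?thesis
    using kappa_uminus[OF l w] by (simp add: Xi_def)
qed

text \<open>Elements of the parabolic subgroups permute positions and values within the blocks.\<close>

lemma kappa_double_coset:
  assumes l: "l \<in> Lam n d" "m \<in> Lam n d" and g: "g \<in> weyl d" "h \<in> double_coset d l g m"
  shows "kappa (l, h, m) = kappa (l, g, m)"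
proof (intro ext)
  fix i j
  obtain u v where uv: "u \<in> parabolic d l" "v \<in> parabolic d m" "h = u \<circ> g \<circ> v"
    using g by (auto simp: double_coset_def)
  have v: "v \<in> weyl d" using uv parabolic_weyl by blast
  have h: "h \<in> weyl d" using double_coset_weyl[OF g] .
  have 1: "blk l (u a) = blk l a" if "- int d \<le> a" "a \<le> int d" for a
    using parabolic_block_iff[OF uv(1), of a "blk l a"] blk_block(1)[OF l(1) that] blk_eqI by blast
  have 2: "blk m (v a) = blk m a" if "- int d \<le> a" "a \<le> int d" for a
    using parabolic_block_iff[OF uv(2), of a "blk m a"] blk_block(1)[OF l(2) that] blk_eqI by blast
  have "kappa (l, h, m) i j = card {b \<in> {- int d..int d}. blk l (g (v b)) = i \<and> blk m (v b) = j}"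
    unfolding kappa_card[OF l h]
    using 1[of "g (v _)"] 2 weyl_interval[OF g(1) weyl_interval[OF v]]
    by (intro arg_cong[where f = card]) (auto simp: uv(3))
  also have "\<dots> = kappa (l, g, m) i j"
    unfolding kappa_card[OF l g(1)]
    by (rule card_weyl_preimage[OF v, of "\<lambda>b. blk l (g b) = i \<and> blk m b = j"])
  finally show "kappa (l, h, m) i j = kappa (l, g, m) i j" .
qed

text \<open>Unions of consecutive blocks are rays, so the sums that define the algebraic order are ranks at
  the ends of blocks.\<close>

lemma kappa_corner:
  assumes l: "l \<in> Lam n d" "m \<in> Lam n d" and w: "w \<in> weyl d"
  shows "(\<Sum>x\<in>{- int n..i}. \<Sum>y\<in>{j..int n}. kappa (l, w, m) x y) =
     rk d w (upper m (j - 1) + 1) (upper l i)"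
proof -
  have "blk l (w b) \<in> {- int n..i} \<and> blk m b \<in> {j..int n} \<longleftrightarrow>
      upper m (j - 1) + 1 \<le> b \<and> w b \<le> upper l i"
    if "b \<in> {- int d..int d}" for b
    using that blk_block[OF l(1), of "w b"] blk_block[OF l(2), of b] weyl_range[OF w, of b]
      blk_le_iff[OF l(1), of "w b" i] blk_le_iff[OF l(2), of b "j - 1"] by auto
  then show ?thesis
    unfolding kappa_sum[OF l w finite_atLeastAtMost_int finite_atLeastAtMost_int] rk_def
    by (intro arg_cong[where f = card]) auto
qed

lemma le_alg_kappa:
  assumes "l \<in> Lam n d" "m \<in> Lam n d" "y \<in> weyl d" "w \<in> weyl d" "rank_le d y w"
  shows "le_alg n (kappa (l, y, m)) (kappa (l, w, m))"
  using assms by (auto simp: le_alg_def row_kappa col_kappa kappa_corner rank_le_def)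

subsection \<open>Minimal representatives are determined by their matrix\<close>

lemma card_Int_downsets:
  fixes X Y :: "int set"
  assumes "finite B" "X \<subseteq> B" "Y \<subseteq> B"
    "\<And>a b. a \<in> X \<Longrightarrow> b \<in> B \<Longrightarrow> b < a \<Longrightarrow> b \<in> X" "\<And>a b. a \<in> Y \<Longrightarrow> b \<in> B \<Longrightarrow> b < a \<Longrightarrow> b \<in> Y"
  shows "card (X \<inter> Y) = min (card X) (card Y)"
proof -
  have fin: "finite X" "finite Y" using assms(1-3) by (auto dest: finite_subset)
  have "X \<subseteq> Y \<or> Y \<subseteq> X"
  proof (rule ccontr)
    assume "\<not> ?thesis"
    then obtain a b where "a \<in> X" "a \<notin> Y" "b \<in> Y" "b \<notin> X" by blast
    then show False using assms(2-5) by (cases a b rule: linorder_cases) blast+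
  qed
  then show ?thesis
    using card_mono[OF fin(1), of Y] card_mono[OF fin(2), of X] by (auto simp: Int_absorb1 Int_absorb2)
qed

text \<open>If \<open>g\<close> is increasing on the blocks of \<open>m\<close> and \<open>inv g\<close> is increasing on the blocks of \<open>l\<close>,
  the rank of \<open>g\<close> at an arbitrary point is the rank at a corner plus the size of an
  intersection of initial segments of a block, first in one direction and then in the other.
  All ingredients are read off from the matrix.\<close>

lemma min_reps_kappa_inj:
  assumes l: "l \<in> Lam n d" "m \<in> Lam n d" and g: "g \<in> min_reps d l m" "g' \<in> min_reps d l m"
    and eq: "kappa (l, g, m) = kappa (l, g', m)"
  shows "g = g'"
proof -
  let ?D = "{- int d..int d}"
  define C where "C h i j = card {b \<in> ?D. blk m b \<le> j \<and> blk l (h b) \<le> i}" for h :: "int \<Rightarrow> int" and i j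
  define S where "S h p i = card {b \<in> ?D. b \<le> p \<and> blk l (h b) \<le> i}" for h :: "int \<Rightarrow> int" and p i
  define G where "G h p q = card {b \<in> ?D. b \<le> p \<and> h b \<le> q}" for h :: "int \<Rightarrow> int" and p q
  have fin: "finite {b \<in> ?D. P b}" for P by (rule finite_subset[of _ ?D]) auto
  have split_card: "card {b \<in> ?D. P b} = card {b \<in> ?D. Q b} + card {b \<in> ?D. R b}"
    if "\<And>b. b \<in> ?D \<Longrightarrow> P b \<longleftrightarrow> Q b \<or> R b" "\<And>b. b \<in> ?D \<Longrightarrow> \<not> (Q b \<and> R b)" for P Q R
  proof -
    have "{b \<in> ?D. P b} = {b \<in> ?D. Q b} \<union> {b \<in> ?D. R b}" using that(1) by blast
    also have "card \<dots> = card {b \<in> ?D. Q b} + card {b \<in> ?D. R b}"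
      by (rule card_Un_disjoint[OF fin fin]) (use that(2) in blast)
    finally show ?thesis .
  qed
  have w: "g \<in> weyl d" "g' \<in> weyl d" using g min_reps_weyl by auto
  have C: "C g i j = C g' i j" for i j
  proof -
    have "C h i j = (\<Sum>x\<in>{- int n..i}. \<Sum>y\<in>{- int n..j}. kappa (l, h, m) x y)" if "h \<in> weyl d" for h
      unfolding C_def kappa_sum[OF l that finite_atLeastAtMost_int finite_atLeastAtMost_int]
      using blk_weyl(1)[OF l(1) that] blk_idx[OF l(2)]
      by (intro arg_cong[where f = card]) fastforce
    then show ?thesis using w eq by simp
  qed
  have S: "S h p i = C h i (blk m p - 1) +
      min (card {b \<in> ?D. blk m b = blk m p \<and> b \<le> p}) (C h i (blk m p) - C h i (blk m p - 1))"
    if h: "h \<in> min_reps d l m" and p: "p \<in> ?D" for h p i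
  proof -
    have hw: "h \<in> weyl d" using h min_reps_weyl by blast
    let ?B = "{b \<in> ?D. blk m b = blk m p}"
    have "S h p i = C h i (blk m p - 1) + card {b \<in> ?D. blk m b = blk m p \<and> b \<le> p \<and> blk l (h b) \<le> i}"
      unfolding S_def C_def using p blk_mono[OF l(2)] blk_less_imp[OF l(2)]
      by (intro split_card) fastforce+
    also have "{b \<in> ?D. blk m b = blk m p \<and> b \<le> p \<and> blk l (h b) \<le> i}
       = {b \<in> ?D. blk m b = blk m p \<and> b \<le> p} \<inter> {b \<in> ?D. blk m b = blk m p \<and> blk l (h b) \<le> i}"
      by auto
    also have "card \<dots> = min (card {b \<in> ?D. blk m b = blk m p \<and> b \<le> p})
        (card {b \<in> ?D. blk m b = blk m p \<and> blk l (h b) \<le> i})"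
    proof (rule card_Int_downsets[of ?B])
      fix a b assume a: "a \<in> {b \<in> ?D. blk m b = blk m p \<and> blk l (h b) \<le> i}" and b: "b \<in> ?B" "b < a"
      have "h b < h a"
        using odd_mono_on_block[OF l(2) weyl_odd[OF hw] min_reps_ascents(2)[OF h], of b "blk m p" a] a b
        by (auto simp: in_block_iff[OF l(2)])
      then have "blk l (h b) \<le> blk l (h a)"
        using a b weyl_range[OF hw, of a] weyl_range[OF hw, of b] by (intro blk_mono[OF l(1)]) auto
      then show "b \<in> {b \<in> ?D. blk m b = blk m p \<and> blk l (h b) \<le> i}" using a b by auto
    qed (use fin in auto)
    also have "card {b \<in> ?D. blk m b = blk m p \<and> blk l (h b) \<le> i} = C h i (blk m p) - C h i (blk m p - 1)"
    proof -
      have "C h i (blk m p) = C h i (blk m p - 1) + card {b \<in> ?D. blk m b = blk m p \<and> blk l (h b) \<le> i}"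
        unfolding C_def by (intro split_card) auto
      then show ?thesis by simp
    qed
    finally show ?thesis .
  qed
  have G: "G h p q = S h p (blk l q - 1) +
      min (card {b \<in> ?D. blk l b = blk l q \<and> b \<le> q}) (S h p (blk l q) - S h p (blk l q - 1))"
    if h: "h \<in> min_reps d l m" and q: "q \<in> ?D" for h p q
  proof -
    have hw: "h \<in> weyl d" using h min_reps_weyl by blast
    let ?B = "{b \<in> ?D. blk l b = blk l q}"
    have f: "h b \<le> q \<Longrightarrow> blk l (h b) \<le> blk l q" "blk l (h b) \<le> blk l q - 1 \<Longrightarrow> h b \<le> q"
      if "b \<in> ?D" for b
      using blk_mono[OF l(1), of "h b" q] blk_less_imp[OF l(1), of "h b" q]
        weyl_interval[OF hw that] q by auto
    have "G h p q = S h p (blk l q - 1) + card {b \<in> ?D. b \<le> p \<and> blk l (h b) = blk l q \<and> h b \<le> q}"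
      unfolding G_def S_def by (intro split_card) (use f in force)+
    also have "card {b \<in> ?D. b \<le> p \<and> blk l (h b) = blk l q \<and> h b \<le> q} =
        card {c \<in> ?D. inv h c \<le> p \<and> blk l c = blk l q \<and> c \<le> q}"
      using card_weyl_preimage[OF hw, of "\<lambda>c. inv h c \<le> p \<and> blk l c = blk l q \<and> c \<le> q"]
      by (simp add: weyl_inv_apply[OF hw])
    also have "{c \<in> ?D. inv h c \<le> p \<and> blk l c = blk l q \<and> c \<le> q}
       = {b \<in> ?D. blk l b = blk l q \<and> b \<le> q} \<inter> {b \<in> ?D. blk l b = blk l q \<and> inv h b \<le> p}"
      by auto
    also have "card \<dots> = min (card {b \<in> ?D. blk l b = blk l q \<and> b \<le> q})
        (card {b \<in> ?D. blk l b = blk l q \<and> inv h b \<le> p})"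
    proof (rule card_Int_downsets[of ?B])
      fix a b assume a: "a \<in> {b \<in> ?D. blk l b = blk l q \<and> inv h b \<le> p}" and b: "b \<in> ?B" "b < a"
      have "inv h b < inv h a"
        using odd_mono_on_block[OF l(1) weyl_odd[OF weyl_inv[OF hw]] min_reps_ascents(1)[OF h],
            of b "blk l q" a] a b
        by (auto simp: in_block_iff[OF l(1)])
      then show "b \<in> {b \<in> ?D. blk l b = blk l q \<and> inv h b \<le> p}" using a b by auto
    qed (use fin in auto)
    also have "card {b \<in> ?D. blk l b = blk l q \<and> inv h b \<le> p} = S h p (blk l q) - S h p (blk l q - 1)"
    proof -
      have "S h p (blk l q) = S h p (blk l q - 1) + card {b \<in> ?D. blk l (h b) = blk l q \<and> b \<le> p}"
        unfolding S_def by (intro split_card) auto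
      moreover have "card {b \<in> ?D. blk l (h b) = blk l q \<and> b \<le> p} =
          card {b \<in> ?D. blk l b = blk l q \<and> inv h b \<le> p}"
        using card_weyl_preimage[OF hw, of "\<lambda>c. blk l c = blk l q \<and> inv h c \<le> p"]
        by (simp add: weyl_inv_apply[OF hw])
      ultimately show ?thesis by simp
    qed
    finally show ?thesis .
  qed
  have GG: "G g p q = G g' p q" if "q \<in> ?D" "p \<le> int d" for p q
  proof (cases "p \<in> ?D")
    case True
    then show ?thesis using G[OF _ that(1)] S[OF _ True] g C by simp
  next
    case False
    then have "{b \<in> ?D. b \<le> p \<and> h b \<le> q} = {}" for h using that by auto
    then show ?thesis unfolding G_def by (simp only:)
  qed
  have *: "h a \<le> q \<longleftrightarrow> G h a q \<noteq> G h (a - 1) q" if "a \<in> ?D" for h a q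
  proof -
    have "G h a q = G h (a - 1) q + card {b \<in> ?D. b = a \<and> h a \<le> q}"
      unfolding G_def by (intro split_card) (auto, metis order_le_imp_less_or_eq)
    moreover have "{b \<in> ?D. b = a \<and> h a \<le> q} = (if h a \<le> q then {a} else {})" using that by auto
    ultimately show ?thesis by simp
  qed
  show ?thesis
  proof
    fix a show "g a = g' a"
    proof (cases "a \<in> ?D")
      case True
      then have "g a \<le> q \<longleftrightarrow> g' a \<le> q" if "q \<in> ?D" for q
        using that by (simp add: * GG)
      from this[of "g a"] this[of "g' a"] show ?thesis
        using weyl_range[OF w(1), of a] weyl_range[OF w(2), of a] True by auto
    next
      case False
      then show ?thesis
        using permutes_not_in[OF weyl_permutes[OF w(1)]] permutes_not_in[OF weyl_permutes[OF w(2)]] by simp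
    qed
  qed
qed

subsection \<open>Every matrix comes from a double coset\<close>

lemma sum_idx_even:
  fixes f :: "int \<Rightarrow> nat"
  assumes "\<And>i. f (- i) = f i"
  shows "(\<Sum>i\<in>idx n. f i) = f 0 + 2 * (\<Sum>i=1..n. f (int i))"
proof (induction n)
  case (Suc n)
  have "idx (Suc n) = insert (int (Suc n)) (insert (- int (Suc n)) (idx n))" by auto
  then have "(\<Sum>i\<in>idx (Suc n). f i) = f (int (Suc n)) + (f (- int (Suc n)) + (\<Sum>i\<in>idx n. f i))"
    by (simp only:) (subst sum.insert, simp, simp, subst sum.insert, auto)
  then show ?case using Suc assms[of "int (Suc n)"] by simp
qed simp

text \<open>The number of \<open>x\<close> is the count of smaller elements minus \<open>d\<close>. The order reversing involution
  \<open>\<sigma>\<close> exchanges smaller and larger elements, whence the change of sign. The fibres of \<open>b\<close> are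
  consecutive parts of \<open>X\<close>, so they match the blocks of the same sizes.\<close>

lemma symmetric_numbering:
  fixes b :: "'x \<Rightarrow> int"
  assumes fin: "finite X" and card: "card X = 2 * d + 1"
    and irrefl: "\<And>x. \<not> lt x x" and trans: "\<And>x y z. lt x y \<Longrightarrow> lt y z \<Longrightarrow> lt x z"
    and total: "\<And>x y. x \<noteq> y \<Longrightarrow> lt x y \<or> lt y x"
    and \<sigma>: "\<And>x. x \<in> X \<Longrightarrow> \<sigma> x \<in> X" "\<And>x. x \<in> X \<Longrightarrow> \<sigma> (\<sigma> x) = x"
      "\<And>x y. x \<in> X \<Longrightarrow> y \<in> X \<Longrightarrow> lt x y \<Longrightarrow> lt (\<sigma> y) (\<sigma> x)"
    and l: "l \<in> Lam n d" and b: "\<And>x y. lt x y \<Longrightarrow> b x \<le> b y"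
    and card_b: "\<And>i. card {x \<in> X. b x = i} = card (block l i)"
  shows "\<exists>f. bij_betw f X {- int d..int d} \<and> (\<forall>x\<in>X. f (\<sigma> x) = - f x \<and> f x \<in> block l (b x))"
proof -
  define f where "f x = int (card {y \<in> X. lt y x}) - int d" for x
  have finX: "finite {y \<in> X. P y}" for P using fin by simp
  have mono: "f x < f y" if "x \<in> X" "lt x y" for x y
  proof -
    have "{z \<in> X. lt z x} \<subset> {z \<in> X. lt z y}"
      using that trans irrefl by blast
    then show ?thesis unfolding f_def using psubset_card_mono[OF finX] by simp
  qed
  have inj: "inj_on f X"
    using mono total by (intro inj_onI) (metis less_irrefl)
  have cards: "card {y \<in> X. lt y x} + card {y \<in> X. lt x y} = 2 * d" if "x \<in> X" for x
  proof -
    have "X = insert x ({y \<in> X. lt y x} \<union> {y \<in> X. lt x y})" using that total by blast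
    then have "card X = card (insert x ({y \<in> X. lt y x} \<union> {y \<in> X. lt x y}))" by simp
    also have "\<dots> = Suc (card ({y \<in> X. lt y x} \<union> {y \<in> X. lt x y}))"
      using fin irrefl by (intro card_insert_disjoint) auto
    also have "card ({y \<in> X. lt y x} \<union> {y \<in> X. lt x y}) = card {y \<in> X. lt y x} + card {y \<in> X. lt x y}"
      by (rule card_Un_disjoint[OF finX finX]) (use trans irrefl in blast)
    finally show ?thesis using card by simp
  qed
  have "f ` X \<subseteq> {- int d..int d}"
    using cards unfolding f_def by force
  moreover have "card (f ` X) = card {- int d..int d}"
    using card card_image[OF inj] by simp
  ultimately have "f ` X = {- int d..int d}" by (intro card_subset_eq) auto
  then have bij: "bij_betw f X {- int d..int d}" using inj by (simp add: bij_betw_def)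
  have "f (\<sigma> x) = - f x" if x: "x \<in> X" for x
  proof -
    have "bij_betw \<sigma> {y \<in> X. lt x y} {y \<in> X. lt y (\<sigma> x)}"
      using \<sigma> x by (intro bij_betw_byWitness[where f' = \<sigma>]) (auto, metis)
    then have "card {y \<in> X. lt y (\<sigma> x)} = card {y \<in> X. lt x y}"
      using bij_betw_same_card by metis
    then show ?thesis using cards[OF x] by (simp add: f_def)
  qed
  moreover have "f x \<in> block l (b x)" if x: "x \<in> X" for x
  proof -
    have upper: "int (card {y \<in> X. b y \<le> i}) = upper l i + int d + 1" if "- int n - 1 \<le> i" for i
      using that
    proof (induction i rule: int_ge_induct)
      case base
      have "{y \<in> X. b y \<le> - int n - 1} = {}"
      proof (rule ccontr)
        assume "\<not> ?thesis"
        then obtain y where y: "y \<in> X" "b y \<le> - int n - 1" by blast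
        then have "card {x \<in> X. b x = b y} = 0"
          using block_outside[OF l, of "b y"] card_b[of "b y"] by simp
        with y fin show False by auto
      qed
      then have "int (card {y \<in> X. b y \<le> - int n - 1}) = 0" by (simp only: card.empty of_nat_0)
      then show ?case using upper_bottom[OF l, of "- int n - 1"] by linarith
    next
      case (step i)
      have "{y \<in> X. b y \<le> i + 1} = {y \<in> X. b y \<le> i} \<union> {y \<in> X. b y = i + 1}" by auto
      then have "card {y \<in> X. b y \<le> i + 1} = card {y \<in> X. b y \<le> i} + card {y \<in> X. b y = i + 1}"
        using fin by (simp only:) (intro card_Un_disjoint, auto)
      moreover have "int (card (block l (i + 1))) = upper l (i + 1) - upper l i"
        using card_block_upper[of l "i + 1"] by simp
      ultimately show ?case using step card_b[of "i + 1"] by linarith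
    qed
    have "x \<in> {y \<in> X. b y = b x}" using x by simp
    then have "card (block l (b x)) \<noteq> 0"
      using card_b[of "b x"] finX[of "\<lambda>y. b y = b x"] by (metis card_0_eq empty_iff)
    then have i: "- int n \<le> b x" using block_outside[OF l, of "b x"] by fastforce
    have "{y \<in> X. b y \<le> b x - 1} \<subseteq> {y \<in> X. lt y x}"
      using total b by (smt (verit, del_insts) Collect_mono_iff)
    then have "card {y \<in> X. b y \<le> b x - 1} \<le> card {y \<in> X. lt y x}"
      by (intro card_mono finX)
    moreover have "{y \<in> X. lt y x} \<subset> {y \<in> X. b y \<le> b x}"
      using b x irrefl by blast
    then have "card {y \<in> X. lt y x} < card {y \<in> X. b y \<le> b x}"
      by (intro psubset_card_mono finX)
    ultimately show ?thesis
      using upper[of "b x"] upper[of "b x - 1"] i by (simp add: block_upper f_def)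
  qed
  ultimately show ?thesis using bij by blast
qed

lemma Xi_uminus:
  assumes "A \<in> Xi n d"
  shows "A (- i) (- j) = A i j"
proof -
  have "\<forall>i\<in>idx n. \<forall>j\<in>idx n. A i j = A (- i) (- j)"
    and out: "\<And>i j. i \<notin> idx n \<or> j \<notin> idx n \<Longrightarrow> A i j = 0"
    using assms unfolding Xi_def by blast+
  then have "A i j = A (- i) (- j)" if "i \<in> idx n" "j \<in> idx n" using that by blast
  moreover have "A (- i) (- j) = 0 \<and> A i j = 0" if "i \<notin> idx n \<or> j \<notin> idx n"
    using that out[of i j] out[of "- i" "- j"] by auto
  ultimately show ?thesis by (cases "i \<in> idx n \<and> j \<in> idx n") metis+
qed

lemma row_Xi_uminus: "A \<in> Xi n d \<Longrightarrow> row n A (- i) = row n A i"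
proof -
  assume A: "A \<in> Xi n d"
  note Xi_uminus[OF A, of i]
  moreover have "(\<Sum>j\<in>idx n. A (- i) j) = (\<Sum>j\<in>idx n. A (- i) (- j))"
    by (rule sum.reindex_bij_witness[of _ uminus uminus]) auto
  ultimately show ?thesis by (simp add: row_def)
qed

text \<open>By symmetry the total \<open>2 d + 1\<close> has the parity of \<open>r 0\<close>, which is therefore odd, as the size
  of a central block has to be.\<close>

lemma ex_Lam_sizes:
  fixes r :: "int \<Rightarrow> nat"
  assumes "\<And>i. r (- i) = r i" "(\<Sum>i\<in>idx n. r i) = 2 * d + 1" "\<And>i. i \<notin> idx n \<Longrightarrow> r i = 0"
  shows "\<exists>l\<in>Lam n d. \<forall>i. card (block l i) = r i"
proof
  let ?l = "\<lambda>i. if i = 0 then (r 0 - 1) div 2 else r (int i)"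
  have sum: "2 * d + 1 = r 0 + 2 * (\<Sum>i=1..n. r (int i))"
    using sum_idx_even[of r n] assms(1,2) by simp
  then have "odd (r 0)" by presburger
  then have r0: "r 0 = 2 * ((r 0 - 1) div 2) + 1" by presburger
  have "(\<Sum>i\<le>n. ?l i) = (r 0 - 1) div 2 + (\<Sum>i=1..n. r (int i))"
    by (simp add: atMost_atLeast0 sum.atLeast_Suc_atMost)
  also have "\<dots> = d" using sum r0 by linarith
  finally show l: "?l \<in> Lam n d"
    using assms(3) by (auto simp: Lam_def)
  show "\<forall>i. card (block ?l i) = r i"
  proof
    fix i :: int
    have pos: "card (block ?l (int k)) = r (int k)" for k
      using card_block_pos[of k ?l] card_block_0[of ?l] r0 by (cases "k = 0") auto
    show "card (block ?l i) = r i"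
      using pos[of "nat i"] pos[of "nat (- i)"] card_block_uminus[of ?l i] assms(1)[of i]
      by (cases "0 \<le> i") auto
  qed
qed

text \<open>The unit entries of \<open>A\<close> are numbered in two ways by \<open>[-d, d]\<close>, row by row and column by
  column. The group element maps the second number of each entry to the first.\<close>

lemma kappa_surj:
  assumes A: "A \<in> Xi n d"
  shows "\<exists>l\<in>Lam n d. \<exists>m\<in>Lam n d. \<exists>w\<in>weyl d. kappa (l, w, m) = A"
proof -
  note sym = Xi_uminus[OF A]
  have out: "A i j = 0" if "i \<notin> idx n \<or> j \<notin> idx n" for i j
    using A that unfolding Xi_def by blast
  have total: "(\<Sum>i\<in>idx n. \<Sum>j\<in>idx n. A i j) = 2 * d + 1"
    using A unfolding Xi_def by blast
  have colsym: "col n A (- j) = col n A j" for j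
  proof -
    have "(\<Sum>i\<in>idx n. A i (- j)) = (\<Sum>i\<in>idx n. A (- i) (- j))"
      by (rule sum.reindex_bij_witness[of _ uminus uminus]) auto
    then show ?thesis by (simp add: col_def sym)
  qed
  obtain l where l: "l \<in> Lam n d" "\<And>i. card (block l i) = row n A i"
    using ex_Lam_sizes[of "row n A" n d] row_Xi_uminus[OF A] total out by (auto simp: row_def)
  have "(\<Sum>j\<in>idx n. \<Sum>i\<in>idx n. A i j) = 2 * d + 1"
    using total by (subst sum.swap)
  then obtain m where m: "m \<in> Lam n d" "\<And>j. card (block m j) = col n A j"
    using ex_Lam_sizes[of "col n A" n d] colsym out by (auto simp: col_def)
  \<comment> \<open>\<open>(i, j, k)\<close> is the \<open>k\<close>-th unit of the entry at \<open>(i, j)\<close>\<close>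
  define X where "X = {(i, j, k). k < A i j}"
  have in_idx: "i \<in> idx n \<and> j \<in> idx n" if "k < A i j" for i j k
    using out[of i j] that by fastforce
  have X_Sigma: "X = (SIGMA i:idx n. SIGMA j:idx n. {..<A i j})"
    unfolding X_def using in_idx by (intro set_eqI) (simp split: prod.splits, blast)
  have fin: "finite X" unfolding X_Sigma by auto
  have cardX: "card X = 2 * d + 1" unfolding X_Sigma by (simp add: total)
  define \<sigma> :: "int \<times> int \<times> nat \<Rightarrow> int \<times> int \<times> nat"
    where "\<sigma> = (\<lambda>(i, j, k). (- i, - j, A i j - 1 - k))"
  have \<sigma>: "\<sigma> x \<in> X" "\<sigma> (\<sigma> x) = x" if "x \<in> X" for x
    using that by (auto simp: X_def \<sigma>_def sym split: prod.splits)
  have "\<exists>f. bij_betw f X {- int d..int d} \<and> (\<forall>x\<in>X. f (\<sigma> x) = - f x \<and> f x \<in> block l (fst x))"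
  proof (rule symmetric_numbering[where lt = "\<lambda>(i, j, k) (i', j', k').
        i < i' \<or> i = i' \<and> (j < j' \<or> j = j' \<and> k < k')", OF fin cardX])
    fix i
    have "{x \<in> X. fst x = i} = Pair i ` (SIGMA j:idx n. {..<A i j})"
      unfolding X_Sigma using in_idx by force
    then have "card {x \<in> X. fst x = i} = card (SIGMA j:idx n. {..<A i j})"
      by (simp add: card_image inj_on_def)
    then show "card {x \<in> X. fst x = i} = card (block l i)"
      by (simp add: l(2) row_def)
  next
    fix x y :: "int \<times> int \<times> nat" assume xy: "x \<in> X" "y \<in> X"
      "(\<lambda>(i, j, k) (i', j', k'). i < i' \<or> i = i' \<and> (j < j' \<or> j = j' \<and> k < k')) x y"
    obtain i j k i' j' k' where [simp]: "x = (i, j, k)" "y = (i', j', k')" by (metis prod_cases3)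
    show "(\<lambda>(i, j, k) (i', j', k'). i < i' \<or> i = i' \<and> (j < j' \<or> j = j' \<and> k < k')) (\<sigma> y) (\<sigma> x)"
      using xy by (auto simp: \<sigma>_def X_def)
  qed (use \<sigma> l in \<open>auto split: prod.splits\<close>)
  then obtain f where f: "bij_betw f X {- int d..int d}"
    "\<And>x. x \<in> X \<Longrightarrow> f (\<sigma> x) = - f x" "\<And>x. x \<in> X \<Longrightarrow> f x \<in> block l (fst x)" by blast
  have "\<exists>f. bij_betw f X {- int d..int d} \<and> (\<forall>x\<in>X. f (\<sigma> x) = - f x \<and> f x \<in> block m (fst (snd x)))"
  proof (rule symmetric_numbering[where lt = "\<lambda>(i, j, k) (i', j', k').
        j < j' \<or> j = j' \<and> (i < i' \<or> i = i' \<and> k < k')", OF fin cardX])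
    fix j
    have "{x \<in> X. fst (snd x) = j} = (\<lambda>(i, k). (i, j, k)) ` (SIGMA i:idx n. {..<A i j})"
      unfolding X_Sigma using in_idx by force
    then have "card {x \<in> X. fst (snd x) = j} = card (SIGMA i:idx n. {..<A i j})"
      by (simp add: card_image inj_on_def)
    then show "card {x \<in> X. fst (snd x) = j} = card (block m j)"
      by (simp add: m(2) col_def)
  next
    fix x y :: "int \<times> int \<times> nat" assume xy: "x \<in> X" "y \<in> X"
      "(\<lambda>(i, j, k) (i', j', k'). j < j' \<or> j = j' \<and> (i < i' \<or> i = i' \<and> k < k')) x y"
    obtain i j k i' j' k' where [simp]: "x = (i, j, k)" "y = (i', j', k')" by (metis prod_cases3)
    show "(\<lambda>(i, j, k) (i', j', k'). j < j' \<or> j = j' \<and> (i < i' \<or> i = i' \<and> k < k')) (\<sigma> y) (\<sigma> x)"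
      using xy by (auto simp: \<sigma>_def X_def)
  qed (use \<sigma> m in \<open>auto split: prod.splits\<close>)
  then obtain f' where f': "bij_betw f' X {- int d..int d}"
    "\<And>x. x \<in> X \<Longrightarrow> f' (\<sigma> x) = - f' x" "\<And>x. x \<in> X \<Longrightarrow> f' x \<in> block m (fst (snd x))" by blast
  define w where "w a = (if a \<in> {- int d..int d} then f (inv_into X f' a) else a)" for a
  have wf: "w (f' x) = f x" if "x \<in> X" for x
    using that f'(1) unfolding w_def
    by (metis bij_betw_inv_into_left bij_betw_apply)
  have "bij_betw (f \<circ> inv_into X f') {- int d..int d} {- int d..int d}"
    by (rule bij_betw_trans[OF bij_betw_inv_into[OF f'(1)] f(1)])
  then have "bij_betw w {- int d..int d} {- int d..int d}"
    by (rule bij_betw_cong[THEN iffD1, rotated]) (simp add: w_def)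
  then have perm: "w permutes {- int d..int d}"
    by (rule bij_imp_permutes) (unfold w_def, rule if_not_P)
  have "w (- a) = - w a" for a
  proof (cases "a \<in> {- int d..int d}")
    case True
    then obtain x where x: "x \<in> X" "a = f' x" using f'(1) unfolding bij_betw_def by blast
    then show ?thesis using wf[of x] wf[of "\<sigma> x"] \<sigma>(1) f(2) f'(2) by metis
  next
    case False
    then show ?thesis unfolding w_def by auto
  qed
  then have w: "w \<in> weyl d" using perm by (simp add: weyl_def)
  have bl: "blk l (w (f' x)) = fst x" "blk m (f' x) = fst (snd x)" if "x \<in> X" for x
    using wf[OF that] blk_eqI[OF f(3)[OF that]] blk_eqI[OF f'(3)[OF that]] by auto
  have "kappa (l, w, m) i j = A i j" for i j
  proof -
    have "{b \<in> {- int d..int d}. blk l (w b) = i \<and> blk m b = j} = f' ` {x \<in> X. fst x = i \<and> fst (snd x) = j}"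
    proof (intro set_eqI iffI)
      fix b assume b: "b \<in> {b \<in> {- int d..int d}. blk l (w b) = i \<and> blk m b = j}"
      then have "b \<in> {- int d..int d}" by blast
      then obtain x where x: "x \<in> X" "b = f' x" using f'(1) unfolding bij_betw_def by blast
      then have "fst x = i" "fst (snd x) = j"
        using b bl by auto
      with x show "b \<in> f' ` {x \<in> X. fst x = i \<and> fst (snd x) = j}" by blast
    next
      fix b assume "b \<in> f' ` {x \<in> X. fst x = i \<and> fst (snd x) = j}"
      then obtain x where x: "x \<in> X" "fst x = i" "fst (snd x) = j" "b = f' x" by blast
      have "f' x \<in> {- int d..int d}" using bij_betw_apply[OF f'(1) x(1)] .
      moreover have "blk l (w (f' x)) = i" "blk m (f' x) = j"
        using x bl by auto
      ultimately show "b \<in> {b \<in> {- int d..int d}. blk l (w b) = i \<and> blk m b = j}"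
        using x(4) by simp
    qed
    moreover have "card (f' ` {x \<in> X. fst x = i \<and> fst (snd x) = j}) =
        card {x \<in> X. fst x = i \<and> fst (snd x) = j}"
      by (rule card_image) (use f'(1) in \<open>auto simp: bij_betw_def intro: inj_on_subset\<close>)
    moreover have "{x \<in> X. fst x = i \<and> fst (snd x) = j} = (\<lambda>k. (i, j, k)) ` {..<A i j}"
      by (auto simp: X_def)
    moreover have "card ((\<lambda>k. (i, j, k)) ` {..<A i j}) = A i j"
      by (subst card_image) (auto simp: inj_on_def)
    ultimately show ?thesis unfolding kappa_card[OF l(1) m(1) w] by simp
  qed
  with l m w show ?thesis by blast
qed

lemma kappa_bij: "bij_betw kappa (triples n d) (Xi n d)"
proof (rule bij_betw_imageI)
  show "inj_on kappa (triples n d)"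
  proof (rule inj_onI)
    fix x y assume x: "x \<in> triples n d" "y \<in> triples n d" "kappa x = kappa y"
    obtain l g m l' g' m' where xy: "x = (l, g, m)" "y = (l', g', m')" by (metis prod_cases3)
    note eq = x(3)[unfolded xy]
    have lm: "l \<in> Lam n d" "m \<in> Lam n d" "l' \<in> Lam n d" "m' \<in> Lam n d"
      and g: "g \<in> min_reps d l m" "g' \<in> min_reps d l' m'" using x xy by (auto simp: triples_def)
    have w: "g \<in> weyl d" "g' \<in> weyl d" using g min_reps_weyl by blast+
    have "l = l'"
      using row_kappa[OF lm(1,2) w(1)] row_kappa[OF lm(3,4) w(2)] eq
      by (intro Lam_eqI[OF lm(1,3)]) simp
    moreover have "m = m'"
      using col_kappa[OF lm(1,2) w(1)] col_kappa[OF lm(3,4) w(2)] eq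
      by (intro Lam_eqI[OF lm(2,4)]) simp
    ultimately show "x = y"
      using min_reps_kappa_inj[OF lm(1,2) g(1)] g(2) eq xy by blast
  qed
next
  show "kappa ` triples n d = Xi n d"
  proof (intro set_eqI iffI)
    fix A assume "A \<in> Xi n d"
    then obtain l m w where lmw: "l \<in> Lam n d" "m \<in> Lam n d" "w \<in> weyl d" "kappa (l, w, m) = A"
      using kappa_surj by blast
    obtain g where g: "g \<in> min_reps d l m" "double_coset d l g m = double_coset d l w m"
      using ex_min_rep[OF lmw(3)] by blast
    have "kappa (l, g, m) = A"
      using kappa_double_coset[OF lmw(1-3)] lmw(4) g double_coset_self[of g d l m] by metis
    moreover have "(l, g, m) \<in> triples n d" using lmw g by (simp add: triples_def)
    ultimately show "A \<in> kappa ` triples n d" by blast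
  next
    fix A assume "A \<in> kappa ` triples n d"
    then show "A \<in> Xi n d" using kappa_Xi min_reps_weyl by (auto simp: triples_def)
  qed
qed

lemma finite_Lam [simp]: "finite (Lam n d)"
proof (rule finite_subset)
  let ?F = "{l :: nat \<Rightarrow> nat. \<forall>i. (i \<in> {..n} \<longrightarrow> l i \<in> {..d}) \<and> (i \<notin> {..n} \<longrightarrow> l i = 0)}"
  show "Lam n d \<subseteq> ?F"
  proof
    fix l assume l: "l \<in> Lam n d"
    have "l i \<le> d" if "i \<le> n" for i
      using member_le_sum[of i "{..n}" l] that l by (simp add: Lam_def)
    then show "l \<in> ?F" using l by (simp add: Lam_def)
  qed
  show "finite ?F"
    by (rule finite_set_of_finite_funs) simp_all
qed

lemma finite_Xi: "finite (Xi n d)"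
proof -
  have "finite (triples n d)"
    by (rule finite_subset[of _ "Lam n d \<times> weyl d \<times> Lam n d"])
      (auto simp: triples_def min_reps_weyl)
  then show ?thesis using bij_betw_finite[OF kappa_bij] by blast
qed

subsection \<open>The algebraic order\<close>

definition corner :: "nat \<Rightarrow> mat \<Rightarrow> int \<Rightarrow> int \<Rightarrow> nat" where
  "corner n A i j = (\<Sum>x\<in>{- int n..i}. \<Sum>y\<in>{j..int n}. A x y)"

text \<open>Strictly increasing along the algebraic order, hence a measure for inductions.\<close>

definition corner_total :: "nat \<Rightarrow> mat \<Rightarrow> nat" where
  "corner_total n A = (\<Sum>i\<in>idx n. \<Sum>j\<in>idx n. if i < j then corner n A i j else 0)"

text \<open>Inclusion and exclusion for a single entry, with all terms on the positive side.\<close>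

lemma corner_entry:
  assumes "i \<in> idx n" "j \<in> idx n"
  shows "corner n A i j + corner n A (i - 1) (j + 1) = A i j + corner n A (i - 1) j + corner n A i (j + 1)"
proof -
  have i: "{- int n..i} = insert i {- int n..i - 1}" and j: "{j..int n} = insert j {j + 1..int n}"
    using assms by auto
  have 1: "(\<Sum>x\<in>{- int n..i}. f x) = f i + (\<Sum>x\<in>{- int n..i - 1}. f x)" for f :: "int \<Rightarrow> nat"
    unfolding i by (rule sum.insert) auto
  have 2: "(\<Sum>y\<in>{j..int n}. f y) = f j + (\<Sum>y\<in>{j + 1..int n}. f y)" for f :: "int \<Rightarrow> nat"
    unfolding j by (rule sum.insert) auto
  show ?thesis unfolding corner_def by (simp add: 1 2 sum.distrib)
qed

text \<open>The corner sums above the diagonal determine the entries above the diagonal, hence by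
  symmetry the entries below it, and then the row sums determine the diagonal.\<close>

lemma Xi_eqI_corner:
  assumes A: "A \<in> Xi n d" and B: "B \<in> Xi n d"
    and row: "\<And>k. k \<in> idx n \<Longrightarrow> row n A k = row n B k"
    and corner: "\<And>i j. i \<in> idx n \<Longrightarrow> j \<in> idx n \<Longrightarrow> i < j \<Longrightarrow> corner n A i j = corner n B i j"
  shows "A = B"
proof -
  have c: "corner n A i j = corner n B i j" if "- int n - 1 \<le> i" "i < j" "j \<le> int n + 1" for i j
  proof (cases "i \<in> idx n \<and> j \<in> idx n")
    case False
    then have "{- int n..i} = {} \<or> {j..int n} = {}" using that by auto
    then show ?thesis by (auto simp: corner_def)
  qed (use corner that in blast)
  have up: "A i j = B i j" if "i \<in> idx n" "j \<in> idx n" "i < j" for i j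
    using corner_entry[OF that(1,2), of A] corner_entry[OF that(1,2), of B] that
      c[of i j] c[of "i - 1" "j + 1"] c[of "i - 1" j] c[of i "j + 1"] by simp
  have off: "A i j = B i j" if "i \<in> idx n" "j \<in> idx n" "i \<noteq> j" for i j
  proof (cases "i < j")
    case False
    then have "A (- i) (- j) = B (- i) (- j)" using that by (intro up) auto
    then show ?thesis by (simp only: Xi_uminus[OF A] Xi_uminus[OF B])
  qed (use up that in blast)
  have diag: "A i i = B i i" if i: "i \<in> idx n" for i
  proof -
    have "row n C i = C i i + (\<Sum>j\<in>idx n - {i}. C i j)" for C
      unfolding row_def using i by (intro sum.remove) auto
    moreover have "(\<Sum>j\<in>idx n - {i}. A i j) = (\<Sum>j\<in>idx n - {i}. B i j)"
      using off i by (intro sum.cong) auto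
    ultimately show ?thesis using row[OF i] by simp
  qed
  show ?thesis
  proof (intro ext)
    fix i j
    show "A i j = B i j"
    proof (cases "i \<in> idx n \<and> j \<in> idx n")
      case True
      then show ?thesis using off diag by (cases "i = j") auto
    next
      case False
      then have "A i j = 0" "B i j = 0" using A B unfolding Xi_def by blast+
      then show ?thesis by simp
    qed
  qed
qed

lemma less_alg_corner_total:
  assumes A: "A \<in> Xi n d" and B: "B \<in> Xi n d" and less: "less_alg n A B"
  shows "corner_total n A < corner_total n B"
proof (rule ccontr)
  assume nl: "\<not> corner_total n A < corner_total n B"
  have le: "corner n A i j \<le> corner n B i j" if "i \<in> idx n" "j \<in> idx n" "i < j" for i j
    using less that by (auto simp: less_alg_def le_alg_def corner_def)
  have "corner n A i j = corner n B i j" if ij: "i \<in> idx n" "j \<in> idx n" "i < j" for i j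
  proof (rule ccontr)
    assume "corner n A i j \<noteq> corner n B i j"
    with le[OF ij] have lt: "corner n A i j < corner n B i j" by simp
    have "(\<Sum>j\<in>idx n. if i < j then corner n A i j else 0) < (\<Sum>j\<in>idx n. if i < j then corner n B i j else 0)"
      using le ij lt by (intro sum_strict_mono_ex1) auto
    moreover have "(\<Sum>j\<in>idx n. if x < j then corner n A x j else 0) \<le> (\<Sum>j\<in>idx n. if x < j then corner n B x j else 0)"
      if "x \<in> idx n" for x
      using le that by (intro sum_mono) auto
    ultimately have "corner_total n A < corner_total n B"
      unfolding corner_total_def using ij by (intro sum_strict_mono_ex1) auto
    with nl show False by simp
  qed
  then have "A = B" using less by (intro Xi_eqI_corner[OF A B]) (auto simp: less_alg_def le_alg_def)
  with less show False by (simp add: less_alg_def)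
qed

lemma le_alg_trans:
  assumes "le_alg n A B" "le_alg n B C"
  shows "le_alg n A C"
  unfolding le_alg_def
proof (intro conjI ballI impI)
  fix i j assume ij: "i \<in> idx n" "j \<in> idx n" "i < j"
  have "(\<Sum>x\<in>{- int n..i}. \<Sum>y\<in>{j..int n}. A x y) \<le> (\<Sum>x\<in>{- int n..i}. \<Sum>y\<in>{j..int n}. B x y)"
    using assms(1) ij by (simp add: le_alg_def)
  also have "\<dots> \<le> (\<Sum>x\<in>{- int n..i}. \<Sum>y\<in>{j..int n}. C x y)"
    using assms(2) ij by (simp add: le_alg_def)
  finally show "(\<Sum>x\<in>{- int n..i}. \<Sum>y\<in>{j..int n}. A x y) \<le> (\<Sum>x\<in>{- int n..i}. \<Sum>y\<in>{j..int n}. C x y)" .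
qed (use assms in \<open>simp_all add: le_alg_def\<close>)

lemma less_alg_trans:
  assumes "A \<in> Xi n d" "B \<in> Xi n d" "C \<in> Xi n d" "less_alg n A B" "less_alg n B C"
  shows "less_alg n A C"
proof -
  have "corner_total n A < corner_total n C"
    using less_alg_corner_total[OF assms(1,2,4)] less_alg_corner_total[OF assms(2,3,5)] by simp
  then have "A \<noteq> C" by auto
  then show ?thesis using assms(4,5) le_alg_trans unfolding less_alg_def by blast
qed

lemma Xi_i_down: "A \<in> Xi n d \<Longrightarrow> B \<in> Xi_i n d \<Longrightarrow> less_alg n A B \<Longrightarrow> A \<in> Xi_i n d"
  by (auto simp: Xi_i_def less_alg_def le_alg_def)

text \<open>The identity does not move any position to a lower block, so all corner sums above the diagonal
  vanish.\<close>

lemma kappa_id_minimal: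
  assumes m: "m \<in> Lam n d" and B: "B \<in> Xi n d" "le_alg n B (kappa (m, id, m))"
  shows "B = kappa (m, id, m)"
proof (rule Xi_eqI_corner[OF B(1) kappa_Xi[OF m m weyl_id]])
  fix i j assume ij: "i \<in> idx n" "j \<in> idx n" "i < j"
  have "corner n (kappa (m, id, m)) i j = 0"
    using upper_mono[of i "j - 1" m] ij
    unfolding corner_def kappa_corner[OF m m weyl_id] rk_def by (auto simp: card_eq_0_iff)
  moreover have "corner n B i j \<le> corner n (kappa (m, id, m)) i j"
    using B(2) ij unfolding le_alg_def corner_def by blast
  ultimately show "corner n B i j = corner n (kappa (m, id, m)) i j" by linarith
qed (use B in \<open>auto simp: le_alg_def\<close>)

subsection \<open>The normalization exponents\<close>

lemma finite_interval_filter [simp]: "finite {b. - int d \<le> b \<and> b \<le> int d \<and> P b}"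
  by (rule finite_subset[of _ "{- int d..int d}"]) auto

definition inverted :: "(int \<Rightarrow> int) \<Rightarrow> int \<Rightarrow> int \<Rightarrow> bool" where
  "inverted w a b \<longleftrightarrow> a < b \<and> w b < w a \<or> b < a \<and> w a < w b"

lemma card_inverted_sum:
  "(\<Sum>a\<in>{- int d..int d}. card {b \<in> {- int d..int d}. inverted w a b}) = 2 * card (invs d w)"
proof -
  let ?D = "{- int d..int d}"
  have "(\<Sum>a\<in>?D. card {b \<in> ?D. inverted w a b}) = card (SIGMA a:?D. {b \<in> ?D. inverted w a b})"
    by (rule card_SigmaI[symmetric]) auto
  also have "(SIGMA a:?D. {b \<in> ?D. inverted w a b}) = invs d w \<union> prod.swap ` invs d w"
  proof (intro set_eqI iffI)
    fix p assume p: "p \<in> (SIGMA a:?D. {b \<in> ?D. inverted w a b})"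
    obtain a b where "p = (a, b)" by (cases p)
    with p show "p \<in> invs d w \<union> prod.swap ` invs d w"
      by (cases "a < b") (auto simp: invs_def inverted_def intro!: image_eqI[of _ _ "(b, a)"])
  qed (auto simp: invs_def inverted_def)
  also have "card \<dots> = card (invs d w) + card (prod.swap ` invs d w)"
    by (rule card_Un_disjoint) (simp, simp, auto simp: invs_def)
  also have "card (prod.swap ` invs d w) = card (invs d w)"
    by (rule card_image) simp
  finally show ?thesis by simp
qed

lemma card_inverted_0:
  assumes w: "w \<in> weyl d"
  shows "card {b \<in> {- int d..int d}. inverted w 0 b} = 2 * neg d w"
proof -
  let ?N = "{a \<in> {1..int d}. w a < 0}"
  have fin: "finite ?N" by (rule finite_subset[of _ "{1..int d}"]) auto
  have "{b \<in> {- int d..int d}. inverted w 0 b} = ?N \<union> uminus ` ?N"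
  proof (intro set_eqI iffI)
    fix b assume b: "b \<in> {b \<in> {- int d..int d}. inverted w 0 b}"
    show "b \<in> ?N \<union> uminus ` ?N"
    proof (cases "0 < b")
      case False
      then have "- b \<in> ?N" using b w weyl_odd[OF w, of b] by (auto simp: inverted_def)
      then show ?thesis by (intro UnI2 image_eqI[of _ _ "- b"]) (rule minus_minus[symmetric])
    qed (use b w in \<open>auto simp: inverted_def\<close>)
  qed (use w weyl_odd[OF w] in \<open>auto simp: inverted_def\<close>)
  moreover have "card (?N \<union> uminus ` ?N) = card ?N + card (uminus ` ?N)"
  proof (rule card_Un_disjoint[OF fin finite_imageI[OF fin]])
    have "0 < a" "b < 0" if "a \<in> ?N" "b \<in> uminus ` ?N" for a b using that by auto
    then show "?N \<inter> uminus ` ?N = {}" by (meson disjoint_iff less_asym)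
  qed
  moreover have "card (uminus ` ?N) = card ?N" by (rule card_image) simp
  ultimately show ?thesis by (simp add: neg_def)
qed

text \<open>The sum of the entries in other columns that are weakly inverted with the cell \<open>(i, j)\<close>; it is
  a factor in the definition of \<open>lhat\<close>.\<close>

definition strip :: "nat \<Rightarrow> mat \<Rightarrow> int \<Rightarrow> int \<Rightarrow> nat" where
  "strip n A i j = (\<Sum>x\<in>{- int n..i}. \<Sum>y\<in>{j<..int n}. A x y) +
     (\<Sum>x\<in>{i..int n}. \<Sum>y\<in>{- int n..<j}. A x y)"

text \<open>An element of maximal length is decreasing on the blocks of \<open>m\<close>, and its inverse is
  decreasing on the blocks of \<open>l\<close>, so it inverts all positions whose cells permit it. The
  positions that are inverted with \<open>a\<close> and lie outside of its block are therefore counted by a sum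
  of matrix entries over two strips.\<close>

lemma inverted_max_rep:
  assumes l: "l \<in> Lam n d" "m \<in> Lam n d" and g: "g \<in> weyl d" "h \<in> max_reps d l g m"
    and ab: "a \<in> {- int d..int d}" "b \<in> {- int d..int d}"
  shows "inverted h a b \<longleftrightarrow> blk l (h b) \<le> blk l (h a) \<and> blk m a < blk m b \<or>
     blk l (h a) \<le> blk l (h b) \<and> blk m b < blk m a \<or> blk m a = blk m b \<and> a \<noteq> b"
proof -
  have h: "h \<in> weyl d" using g double_coset_weyl by (auto simp: max_reps_def)
  have anti_m: "h b < h a" if "a \<in> block m j" "b \<in> block m j" "a < b" for a b j
  proof -
    have "- h a < - h b"
    proof (rule odd_mono_on_block[OF l(2) _ _ that, where f = "\<lambda>a. - h a"])
      fix k assume k: "k \<in> gens d m"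
      have "h (int k) \<noteq> h (int k + 1)" using weyl_eq_iff[OF h] by simp
      then show "- h (int k) < - h (int k + 1)" using max_reps_descents(2)[OF g k] by simp
    qed (simp add: weyl_odd[OF h])
    then show ?thesis by simp
  qed
  have anti_l: "inv h b < inv h a" if "a \<in> block l j" "b \<in> block l j" "a < b" for a b j
  proof -
    have "- inv h a < - inv h b"
    proof (rule odd_mono_on_block[OF l(1) _ _ that, where f = "\<lambda>a. - inv h a"])
      fix k assume k: "k \<in> gens d l"
      have "inv h (int k) \<noteq> inv h (int k + 1)" using weyl_eq_iff[OF weyl_inv[OF h]] by simp
      then show "- inv h (int k) < - inv h (int k + 1)" using max_reps_descents(1)[OF g k] by simp
    qed (simp add: weyl_odd[OF weyl_inv[OF h]])
    then show ?thesis by simp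
  qed
  have main: "h b < h a \<longleftrightarrow> blk m a = blk m b \<or> blk l (h b) \<le> blk l (h a)"
    if "a \<in> {- int d..int d}" "b \<in> {- int d..int d}" "a < b" for a b
  proof -
    note D = weyl_interval[OF h that(1)] weyl_interval[OF h that(2)]
    show ?thesis
    proof (cases "blk m a = blk m b")
      case True
      then show ?thesis using anti_m[of a "blk m a" b] that by (auto simp: in_block_iff[OF l(2)])
    next
      case False
      consider "blk l (h b) < blk l (h a)" | "blk l (h b) = blk l (h a)" | "blk l (h a) < blk l (h b)"
        by linarith
      then show ?thesis
      proof cases
        case 1
        then show ?thesis using blk_less_imp[OF l(1), of "h b" "h a"] D by auto
      next
        case 2
        have "\<not> h a < h b"
          using anti_l[of "h a" "blk l (h a)" "h b"] 2 D that weyl_inv_apply(1)[OF h]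
          by (auto simp: in_block_iff[OF l(1)])
        moreover have "h a \<noteq> h b" using weyl_eq_iff[OF h] that by auto
        ultimately show ?thesis using 2 by auto
      next
        case 3
        then show ?thesis using blk_less_imp[OF l(1), of "h a" "h b"] D False by auto
      qed
    qed
  qed
  show ?thesis
  proof (cases a b rule: linorder_cases)
    case less
    then show ?thesis using main[OF ab less] blk_mono[OF l(2), of a b] ab
      by (auto simp: inverted_def)
  next
    case greater
    then show ?thesis using main[OF ab(2,1) greater] blk_mono[OF l(2), of b a] ab
      by (auto simp: inverted_def)
  qed (simp add: inverted_def)
qed

lemma strip_kappa:
  assumes l: "l \<in> Lam n d" "m \<in> Lam n d" and h: "h \<in> weyl d"
  shows "strip n (kappa (l, h, m)) i j = card {b \<in> {- int d..int d}.
     blk l (h b) \<le> i \<and> j < blk m b \<or> i \<le> blk l (h b) \<and> blk m b < j}"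
proof -
  let ?D = "{- int d..int d}"
  let ?P = "{b \<in> ?D. blk l (h b) \<in> {- int n..i} \<and> blk m b \<in> {j<..int n}}"
  let ?Q = "{b \<in> ?D. blk l (h b) \<in> {i..int n} \<and> blk m b \<in> {- int n..<j}}"
  have "strip n (kappa (l, h, m)) i j = card ?P + card ?Q"
    unfolding strip_def by (subst (1 2) kappa_sum[OF l h]) auto
  also have "\<dots> = card (?P \<union> ?Q)"
    by (rule card_Un_disjoint[symmetric]) (auto intro: finite_subset[of _ ?D])
  also have "?P \<union> ?Q = {b \<in> ?D. blk l (h b) \<le> i \<and> j < blk m b \<or> i \<le> blk l (h b) \<and> blk m b < j}"
    using blk_weyl(1)[OF l(1) h] blk_idx[OF l(2)] by fastforce
  finally show ?thesis .
qed

lemma inverted_max_parabolic: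
  assumes m: "m \<in> Lam n d" and hm: "hm \<in> max_reps d m id m"
    and ab: "a \<in> {- int d..int d}" "b \<in> {- int d..int d}"
  shows "inverted hm a b \<longleftrightarrow> blk m a = blk m b \<and> a \<noteq> b"
proof -
  have "hm \<in> double_coset d m id m" using hm by (simp add: max_reps_def)
  then have "hm \<in> parabolic d m" by (auto simp: double_coset_def intro: parabolic_comp)
  then have "blk m (hm c) = blk m c" if "c \<in> {- int d..int d}" for c
    using parabolic_block_iff[of hm d m c "blk m c"] blk_block(1)[OF m, of c] that
    by (intro blk_eqI) simp
  then show ?thesis
    using inverted_max_rep[OF m m weyl_id hm ab] ab by auto
qed

lemma strip_max_rep:
  assumes l: "l \<in> Lam n d" "m \<in> Lam n d" and g: "g \<in> weyl d" "h \<in> max_reps d l g m"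
    and hm: "hm \<in> max_reps d m id m" and a: "a \<in> {- int d..int d}"
  shows "card {b \<in> {- int d..int d}. inverted h a b} =
     strip n (kappa (l, h, m)) (blk l (h a)) (blk m a) + card {b \<in> {- int d..int d}. inverted hm a b}"
proof -
  let ?D = "{- int d..int d}"
  let ?P = "{b \<in> ?D. blk l (h b) \<le> blk l (h a) \<and> blk m a < blk m b \<or>
      blk l (h a) \<le> blk l (h b) \<and> blk m b < blk m a}"
  let ?Q = "{b \<in> ?D. blk m a = blk m b \<and> a \<noteq> b}"
  have h: "h \<in> weyl d" using g double_coset_weyl by (auto simp: max_reps_def)
  have "{b \<in> ?D. inverted h a b} = ?P \<union> ?Q"
    using inverted_max_rep[OF l g a] by blast
  moreover have "{b \<in> ?D. inverted hm a b} = ?Q"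
    using inverted_max_parabolic[OF l(2) hm a] by blast
  moreover have "card (?P \<union> ?Q) = card ?P + card ?Q"
    by (rule card_Un_disjoint) (auto intro: finite_subset[of _ ?D])
  ultimately show ?thesis by (simp only: strip_kappa[OF l h])
qed

text \<open>Each pair of opposite nonzero positions is counted once in \<open>I_c\<close>; the central cell
  contributes half of its nonzero positions.\<close>

lemma sum_I_c:
  fixes F :: "int \<Rightarrow> int \<Rightarrow> nat"
  assumes l: "l \<in> Lam n d" "m \<in> Lam n d" and h: "h \<in> weyl d"
    and F: "\<And>a. a \<in> {- int d..int d} \<Longrightarrow>
      F (blk l (h (- a))) (blk m (- a)) = F (blk l (h a)) (blk m a)"
  shows "(\<Sum>a\<in>{- int d..int d} - {0}. F (blk l (h a)) (blk m a)) =
     2 * (\<Sum>(i, j)\<in>I_c n. natural (kappa (l, h, m)) i j * F i j)"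
proof -
  let ?D = "{- int d..int d}" and ?c = "\<lambda>a. (blk l (h a), blk m a)"
  define H where "H = {a \<in> ?D - {0}. ?c a \<in> I_c n \<and> (?c a = (0, 0) \<longrightarrow> 0 < a)}"
  have finH: "finite H" unfolding H_def by (rule finite_subset[of _ ?D]) auto
  have finI: "finite (I_c n)" by (simp add: I_c_def)
  have neg: "?c (- a) = (- blk l (h a), - blk m a)" if "a \<in> ?D" for a
    using blk_weyl(2)[OF l(1) h that] blk_weyl(2)[OF l(2) weyl_id that] by simp
  have idx: "blk l (h a) \<in> idx n" "blk m a \<in> idx n" if "a \<in> ?D" for a
    using blk_weyl(1)[OF l(1) h that] blk_idx[OF l(2) that] .
  have D: "?D - {0} = H \<union> uminus ` H"
  proof (intro set_eqI iffI)
    fix a assume a: "a \<in> ?D - {0}"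
    show "a \<in> H \<union> uminus ` H"
    proof (cases "a \<in> H")
      case False
      have "- a \<in> H"
        using False a neg[of a] idx[of a] unfolding H_def I_c_def by auto
      then show ?thesis by (intro UnI2 image_eqI[of _ _ "- a"]) (rule minus_minus[symmetric])
    qed simp
  qed (auto simp: H_def)
  have disj: "H \<inter> uminus ` H = {}"
  proof (rule ccontr)
    assume "H \<inter> uminus ` H \<noteq> {}"
    then obtain a where a: "a \<in> H" "- a \<in> H" by auto
    then have "a \<in> ?D" by (simp add: H_def)
    with a neg[of a] show False unfolding H_def I_c_def by auto
  qed
  let ?F = "\<lambda>a. F (blk l (h a)) (blk m a)"
  have 1: "(\<Sum>a\<in>?D - {0}. ?F a) = (\<Sum>a\<in>H. ?F a) + (\<Sum>a\<in>uminus ` H. ?F a)"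
    unfolding D using finH disj by (intro sum.union_disjoint) auto
  have 2: "(\<Sum>a\<in>uminus ` H. ?F a) = (\<Sum>a\<in>H. ?F (- a))"
    by (subst sum.reindex) simp_all
  have 3: "(\<Sum>a\<in>H. ?F (- a)) = (\<Sum>a\<in>H. ?F a)"
    by (intro sum.cong F) (auto simp: H_def)
  have "(\<Sum>a\<in>H. ?F a) = (\<Sum>p\<in>I_c n. \<Sum>a\<in>{a \<in> H. ?c a = p}. ?F a)"
    using finH finI by (intro sum.group[symmetric]) (auto simp: H_def)
  also have "\<dots> = (\<Sum>(i, j)\<in>I_c n. natural (kappa (l, h, m)) i j * F i j)"
  proof (rule sum.cong[OF refl], clarify)
    fix i j assume ij: "(i, j) \<in> I_c n"
    have "(\<Sum>a\<in>{a \<in> H. ?c a = (i, j)}. F (blk l (h a)) (blk m a)) = card {a \<in> H. ?c a = (i, j)} * F i j"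
      by simp
    moreover have "card {a \<in> H. ?c a = (i, j)} = natural (kappa (l, h, m)) i j"
    proof (cases "(i, j) = (0, 0)")
      case True
      have "{a \<in> H. ?c a = (0, 0)} = {b \<in> ?D. 0 < b \<and> blk l (h b) = 0 \<and> blk m b = 0}"
        by (auto simp: H_def I_c_def)
      then show ?thesis using True kappa_central[OF l h] by (simp add: natural_def)
    next
      case False
      have "blk l (h 0) = 0" using h by simp
      then have "{a \<in> H. ?c a = (i, j)} = {b \<in> ?D. blk l (h b) = i \<and> blk m b = j}"
        using False ij by (auto simp: H_def)
      then show ?thesis using False kappa_card[OF l h] by (auto simp: natural_def)
    qed
    ultimately show "(\<Sum>a\<in>{a \<in> H. ?c a = (i, j)}. F (blk l (h a)) (blk m a)) =
        natural (kappa (l, h, m)) i j * F i j" by simp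
  qed
  finally show ?thesis using 1 2 3 by simp
qed

text \<open>Counted from the nonzero positions, the inversions of an element add up to four times its
  length. Those of \<open>h\<close> within blocks are the inversions of \<open>hm\<close>, the others are counted by strips. The position
  \<open>0\<close> alone accounts for the sign changes and gives the second exponent.\<close>

lemma lhat_max_rep:
  assumes l: "l \<in> Lam n d" "m \<in> Lam n d" and g: "g \<in> weyl d" "h \<in> max_reps d l g m"
    and hm: "hm \<in> max_reps d m id m"
  shows "lhat n (kappa (l, g, m)) = int (weyl_len d h) - int (weyl_len d hm)"
    and "lhat_c n (kappa (l, g, m)) = int (neg d h) - int (neg d hm)"
proof -
  let ?D = "{- int d..int d}"
  let ?A = "kappa (l, h, m)"
  have h: "h \<in> weyl d" "h \<in> double_coset d l g m"
    using g double_coset_weyl by (auto simp: max_reps_def)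
  have hmw: "hm \<in> weyl d" using hm double_coset_weyl[OF weyl_id] by (auto simp: max_reps_def)
  have A: "kappa (l, g, m) = ?A" using kappa_double_coset[OF l g(1) h(2)] by simp
  note strip = strip_max_rep[OF l g hm]
  have strip0: "2 * neg d h = strip n ?A 0 0 + 2 * neg d hm"
    using strip[of 0] h hmw card_inverted_0[OF h(1)] card_inverted_0[OF hmw] by simp
  have sum: "(\<Sum>a\<in>?D. card {b \<in> ?D. inverted w a b}) =
      card {b \<in> ?D. inverted w 0 b} + (\<Sum>a\<in>?D - {0}. card {b \<in> ?D. inverted w a b})" for w
    by (rule sum.remove) auto
  have nz: "(\<Sum>a\<in>?D - {0}. card {b \<in> ?D. inverted w a b}) = 4 * weyl_len d w" if "w \<in> weyl d" for w
    using sum[of w] card_inverted_sum[of d w] card_inverted_0[OF that] weyl_len_invs[OF that] by linarith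
  have "4 * weyl_len d h = (\<Sum>a\<in>?D - {0}. strip n ?A (blk l (h a)) (blk m a)) + 4 * weyl_len d hm"
    unfolding nz[OF h(1), symmetric] nz[OF hmw, symmetric] sum.distrib[symmetric]
    by (intro sum.cong refl strip) auto
  also have "(\<Sum>a\<in>?D - {0}. strip n ?A (blk l (h a)) (blk m a)) =
      2 * (\<Sum>(i, j)\<in>I_c n. natural ?A i j * strip n ?A i j)"
  proof (rule sum_I_c[OF l h(1)])
    fix a assume a: "a \<in> ?D"
    have "{b \<in> ?D. inverted w (- a) b} = uminus ` {b \<in> ?D. inverted w a b}" if "w \<in> weyl d" for w
    proof (intro set_eqI iffI)
      fix b assume "b \<in> {b \<in> ?D. inverted w (- a) b}"
      then have "- b \<in> {b \<in> ?D. inverted w a b}" by (auto simp: inverted_def weyl_odd[OF that])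
      then show "b \<in> uminus ` {b \<in> ?D. inverted w a b}" by (intro image_eqI[of _ _ "- b"]) (rule minus_minus[symmetric])
    qed (auto simp: inverted_def weyl_odd[OF that])
    then have "card {b \<in> ?D. inverted w (- a) b} = card {b \<in> ?D. inverted w a b}" if "w \<in> weyl d" for w
      using that by (simp add: card_image)
    then show "strip n ?A (blk l (h (- a))) (blk m (- a)) = strip n ?A (blk l (h a)) (blk m a)"
      using strip[of a] strip[of "- a"] a h(1) hmw by fastforce
  qed
  finally have main: "2 * weyl_len d h = (\<Sum>(i, j)\<in>I_c n. natural ?A i j * strip n ?A i j) + 2 * weyl_len d hm"
    by linarith
  show "lhat n (kappa (l, g, m)) = int (weyl_len d h) - int (weyl_len d hm)"
    unfolding A lhat_def strip_def[symmetric] using main by linarith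
  have "lhat_c n ?A = int (strip n ?A 0 0 div 2)"
    by (simp add: lhat_c_def strip_def add.commute)
  then show "lhat_c n (kappa (l, g, m)) = int (neg d h) - int (neg d hm)"
    unfolding A using strip0 by linarith
qed

section \<open>The Hecke algebra and its bar involution\<close>

lemma mon_mult [simp]: "mon a b * mon a' b' = mon (a + a') (b + b')"
  by (simp add: mon_def mult_single)

lemma mon_0 [simp]: "mon 0 0 = 1"
  unfolding mon_def by (metis single_one zero_prod_def)

lemma lau_bar_mon [simp]: "lau_bar (mon a b) = mon (- a) (- b)"
  by (simp add: mon_def)

definition par :: "nat \<Rightarrow> lau2" where
  "par k = (if k = 0 then mon 2 0 else mon 0 2)"

definition par_inv :: "nat \<Rightarrow> lau2" where
  "par_inv k = (if k = 0 then mon (- 2) 0 else mon 0 (- 2))"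

lemma par_par_inv [simp]: "par k * par_inv k = 1" "par_inv k * par k = 1" "lau_bar (par k) = par_inv k" "lau_bar (par_inv k) = par k"
  by (simp_all add: par_def par_inv_def)

lemma par_cancel: "par k * x = par k * y \<longleftrightarrow> x = y"
proof
  assume "par k * x = par k * y"
  then have "par_inv k * par k * x = par_inv k * par k * y" by (simp only: mult.assoc)
  then show "x = y" by simp
qed simp

lemma ring_inv_eqI:
  assumes "x * y = 1" "y * x = 1"
  shows "ring_inv x = y"
  unfolding ring_inv_def
proof (rule the_equality)
  fix z assume "x * z = 1 \<and> z * x = 1"
  then show "z = y" by (metis assms(2) mult.assoc mult.left_neutral mult.right_neutral)
qed (use assms in simp)

text \<open>The inverse of the product of the parameters of the letters in a reduced word of \<open>w\<close>. It is the
  leading coefficient of the bar conjugate of \<open>T w\<close>.\<close>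

definition bar_lead :: "nat \<Rightarrow> (int \<Rightarrow> int) \<Rightarrow> lau2" where
  "bar_lead d w = mon (- 2 * int (neg d w)) (- 2 * (int (weyl_len d w) - int (neg d w)))"

lemma bar_lead_sgen:
  assumes "w \<in> weyl d" "k < d" "asc k w"
  shows "bar_lead d (sgen k \<circ> w) = par_inv k * bar_lead d w"
  unfolding bar_lead_def weyl_len_sgen(1)[OF assms] neg_sgen[OF assms] par_inv_def
  by (cases "k = 0") (auto intro!: arg_cong2[where f = mon])

lemma weyl_len_id_apply [simp]: "weyl_len d (\<lambda>i. i) = 0"
  using weyl_len_id[of d] by (simp only: id_def)

context hecke_algebra
begin

definition coef :: "'h \<Rightarrow> (int \<Rightarrow> int) \<Rightarrow> lau2" where
  "coef h w = representation (T ` weyl d) h (T w)"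

lemma coef_expansion: "(\<Sum>w\<in>weyl d. scale (coef h w) (T w)) = h"
proof -
  have "(\<Sum>b\<in>T ` weyl d. scale (representation (T ` weyl d) h b) b) = h"
    by (rule sum_representation_eq) (auto simp: independent_T span_T)
  then show ?thesis by (simp add: sum.reindex[OF inj_T] coef_def)
qed

lemma coef_add: "coef (x + y) w = coef x w + coef y w"
  by (simp add: coef_def representation_add independent_T span_T)

lemma coef_scale: "coef (scale a x) w = a * coef x w"
  by (simp add: coef_def representation_scale independent_T span_T)

lemma coef_zero [simp]: "coef 0 w = 0"
  by (simp add: coef_def representation_zero)

lemma coef_sum: "coef (sum f I) w = (\<Sum>i\<in>I. coef (f i) w)"
  by (induction I rule: infinite_finite_induct) (auto simp: coef_add)

lemma coef_T: "w \<in> weyl d \<Longrightarrow> y \<in> weyl d \<Longrightarrow> coef (T w) y = (if y = w then 1 else 0)"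
  using inj_on_eq_iff[OF inj_T] by (simp add: coef_def representation_basis independent_T)

lemma hecke_eqI: "(\<And>w. w \<in> weyl d \<Longrightarrow> coef x w = coef y w) \<Longrightarrow> x = y"
  using coef_expansion[of x] coef_expansion[of y] by (metis (no_types, lifting) sum.cong)

lemma hecke_induct [case_names zero T add]:
  assumes "P 0" "\<And>a w. w \<in> weyl d \<Longrightarrow> P (scale a (T w))" "\<And>x y. P x \<Longrightarrow> P y \<Longrightarrow> P (x + y)"
  shows "P h"
proof -
  have "P (\<Sum>w\<in>S. scale (coef h w) (T w))" if "finite S" "S \<subseteq> weyl d" for S
    using that by (induction S) (auto intro: assms)
  from this[of "weyl d"] show ?thesis by (simp add: coef_expansion)
qed

lemma T_id: "T id = 1"
proof -
  have "T id * h = h" for h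
  proof (induction h rule: hecke_induct)
    case (T a w)
    have "T id * T w = T w" using T_mult[of id w] T by simp
    then show ?case by (metis scale_mult_right)
  qed (simp_all add: distrib_left)
  from this[of 1] show ?thesis by simp
qed

lemma T_id_apply [simp]: "T id = 1" "T (\<lambda>i. i) = 1"
  using T_id by (simp_all add: id_def)

lemma T_sq:
  assumes "k < d"
  shows "T (sgen k) * T (sgen k) = scale (par k) 1 + scale (par k - 1) (T (sgen k))"
proof -
  have "(T (sgen k) + 1) * (T (sgen k) - scale (par k) 1) = 0"
    using quadratic_0 quadratic[of k] assms by (cases "k = 0") (auto simp: par_def)
  moreover have "T (sgen k) * scale (par k) 1 = scale (par k) (T (sgen k))"
    using scale_mult_right[of "par k" "T (sgen k)" 1] by simp
  ultimately show ?thesis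
    by (simp add: algebra_simps)
qed

lemma T_left_asc: "w \<in> weyl d \<Longrightarrow> k < d \<Longrightarrow> asc k w \<Longrightarrow> T (sgen k) * T w = T (sgen k \<circ> w)"
  by (rule T_mult) (simp_all add: weyl_len_sgen(1))

lemma T_left_desc:
  assumes "w \<in> weyl d" "k < d" "\<not> asc k w"
  shows "T (sgen k) * T w = scale (par k) (T (sgen k \<circ> w)) + scale (par k - 1) (T w)"
proof -
  let ?v = "sgen k \<circ> w"
  have v: "?v \<in> weyl d" "asc k ?v" using assms asc_sgen by auto
  have w: "T w = T (sgen k) * T ?v" using T_left_asc[OF v(1) assms(2) v(2)] unfolding sgen_comp_cancel by (rule sym)
  have "T (sgen k) * T w = (T (sgen k) * T (sgen k)) * T ?v" by (subst w) (simp add: mult.assoc)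
  also have "\<dots> = scale (par k) (T ?v) + scale (par k - 1) (T (sgen k) * T ?v)"
    by (simp add: T_sq[OF assms(2)] distrib_right scale_mult_left[symmetric])
  finally show ?thesis by (simp only: w)
qed

lemma T_right_asc:
  "w \<in> weyl d \<Longrightarrow> k < d \<Longrightarrow> w (int k) < w (int k + 1) \<Longrightarrow> T w * T (sgen k) = T (w \<circ> sgen k)"
  by (rule T_mult) (simp_all add: weyl_len_sgen_right(1))

lemma right_asc_flip:
  assumes "w \<in> weyl d" "k < d"
  shows "(w \<circ> sgen k) (int k) < (w \<circ> sgen k) (int k + 1) \<longleftrightarrow> \<not> w (int k) < w (int k + 1)"
proof -
  have "inv (sgen k \<circ> inv w) = w \<circ> sgen k"
    using inv_sgen_comp[OF weyl_inv[OF assms(1)] assms(2)] assms(1) by simp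
  then show ?thesis
    using asc_sgen[OF weyl_inv[OF assms(1)] assms(2)] assms(1) by (simp only: weyl_inv_inv)
qed

lemma T_right_desc:
  assumes "w \<in> weyl d" "k < d" "\<not> w (int k) < w (int k + 1)"
  shows "T w * T (sgen k) = scale (par k) (T (w \<circ> sgen k)) + scale (par k - 1) (T w)"
proof -
  let ?v = "w \<circ> sgen k"
  have v: "?v \<in> weyl d" "?v (int k) < ?v (int k + 1)"
    using assms right_asc_flip[OF assms(1,2)] by auto
  have w: "T w = T ?v * T (sgen k)" using T_right_asc[OF v(1) assms(2) v(2)] unfolding sgen_comp_cancel by (rule sym)
  have "T w * T (sgen k) = T ?v * (T (sgen k) * T (sgen k))" by (subst w) (simp add: mult.assoc)
  also have "\<dots> = scale (par k) (T ?v) + scale (par k - 1) (T ?v * T (sgen k))"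
    by (simp add: T_sq[OF assms(2)] distrib_left scale_mult_right[symmetric])
  finally show ?thesis by (simp only: w)
qed

text \<open>Left and right multiplication by a generator both have the form of the operator \<open>F\<close> below,
  with \<open>\<tau>\<close> the multiplication by the generator in the group and \<open>D\<close> the set of its ascents.\<close>

lemma generator_operator:
  assumes F: "\<And>x y. F (x + y) = F x + F y" "\<And>a x. F (scale a x) = scale a (F x)"
    and \<tau>: "\<And>w. w \<in> weyl d \<Longrightarrow> \<tau> w \<in> weyl d" "\<And>w. \<tau> (\<tau> w) = w"
      "\<And>w. w \<in> weyl d \<Longrightarrow> D (\<tau> w) \<longleftrightarrow> \<not> D w"
    and FT: "\<And>w. w \<in> weyl d \<Longrightarrow> D w \<Longrightarrow> F (T w) = T (\<tau> w)"
      "\<And>w. w \<in> weyl d \<Longrightarrow> \<not> D w \<Longrightarrow> F (T w) = scale (par k) (T (\<tau> w)) + scale (par k - 1) (T w)"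
  shows "y \<in> weyl d \<Longrightarrow> coef (F h) y =
      (if D y then par k * coef h (\<tau> y) else coef h (\<tau> y) + (par k - 1) * coef h y)" (is "_ \<Longrightarrow> ?A")
    and "F h = scale (par k) h \<longleftrightarrow> (\<forall>y\<in>weyl d. coef h (\<tau> y) = coef h y)" (is ?B)
proof -
  have F0: "F 0 = 0" using F(2)[of 0 0] by simp
  show 1: "coef (F h) y = (if D y then par k * coef h (\<tau> y) else coef h (\<tau> y) + (par k - 1) * coef h y)"
    if y: "y \<in> weyl d" for y
  proof (induction h rule: hecke_induct)
    case zero
    then show ?case by (simp add: F0)
  next
    case (T a w)
    have eq: "\<tau> y = w \<longleftrightarrow> y = \<tau> w" using \<tau>(2) by metis
    show ?case
    proof (cases "D w")
      case True
      then show ?thesis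
        using T y \<tau>(3)[OF T] eq
        by (auto simp: F FT coef_scale coef_T \<tau>(1) coef_add)
    next
      case False
      then show ?thesis
        using T y \<tau>(3)[OF T] \<tau>(3)[OF y] eq
        by (auto simp: F FT coef_scale coef_T \<tau>(1) coef_add)
    qed
  next
    case (add u v)
    then show ?case by (simp add: F coef_add algebra_simps)
  qed
  show ?B
  proof
    assume inv: "F h = scale (par k) h"
    show "\<forall>y\<in>weyl d. coef h (\<tau> y) = coef h y"
    proof
      fix y assume y: "y \<in> weyl d"
      have "coef (F h) y = par k * coef h y" using inv by (simp add: coef_scale)
      then show "coef h (\<tau> y) = coef h y"
        using 1[OF y] par_cancel[of k "coef h (\<tau> y)" "coef h y"]
        by (cases "D y") (auto simp: left_diff_distrib)
    qed
  next
    assume inv: "\<forall>y\<in>weyl d. coef h (\<tau> y) = coef h y"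
    show "F h = scale (par k) h"
      by (rule hecke_eqI) (use 1 inv in \<open>simp add: coef_scale left_diff_distrib\<close>)
  qed
qed

lemma left_operator:
  assumes "k < d"
  shows "y \<in> weyl d \<Longrightarrow> coef (T (sgen k) * h) y =
      (if asc k y then par k * coef h (sgen k \<circ> y) else coef h (sgen k \<circ> y) + (par k - 1) * coef h y)"
    and "T (sgen k) * h = scale (par k) h \<longleftrightarrow> (\<forall>y\<in>weyl d. coef h (sgen k \<circ> y) = coef h y)"
  by (rule generator_operator[where \<tau> = "\<lambda>w. sgen k \<circ> w" and D = "asc k" and F = "\<lambda>h. T (sgen k) * h"];
      use assms in \<open>simp add: distrib_left scale_mult_right T_left_asc T_left_desc asc_sgen
        del: o_apply\<close>)+

lemma right_operator:
  assumes "k < d"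
  shows "h * T (sgen k) = scale (par k) h \<longleftrightarrow> (\<forall>y\<in>weyl d. coef h (y \<circ> sgen k) = coef h y)"
  by (rule generator_operator(2)[where \<tau> = "\<lambda>w. w \<circ> sgen k" and D = "\<lambda>w. w (int k) < w (int k + 1)"
        and F = "\<lambda>h. h * T (sgen k)"];
      use assms right_asc_flip in \<open>simp add: distrib_right scale_mult_left T_right_asc T_right_desc\<close>)

subsection \<open>The bar involution\<close>

text \<open>The bar conjugate of \<open>T w\<close>.\<close>

definition T_bar :: "(int \<Rightarrow> int) \<Rightarrow> 'h" where
  "T_bar w = ring_inv (T (inv w))"

lemma T_sgen_inverse:
  assumes "k < d"
  shows "T (sgen k) * (scale (par_inv k) (T (sgen k)) + scale (par_inv k - 1) 1) = 1"
    and "(scale (par_inv k) (T (sgen k)) + scale (par_inv k - 1) 1) * T (sgen k) = 1"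
proof -
  have 1: "scale (par_inv k) (T (sgen k) * T (sgen k)) + scale (par_inv k - 1) (T (sgen k)) = 1"
    by (simp add: T_sq[OF assms] scale_right_distrib right_diff_distrib scale_left_diff_distrib
        algebra_simps)
  have 2: "T (sgen k) * scale a 1 = scale a (T (sgen k))" for a
    using scale_mult_right[of a "T (sgen k)" 1] by simp
  have 3: "scale a 1 * T (sgen k) = scale a (T (sgen k))" for a
    using scale_mult_left[of a 1 "T (sgen k)"] by simp
  show "T (sgen k) * (scale (par_inv k) (T (sgen k)) + scale (par_inv k - 1) 1) = 1"
    using 1 by (simp add: distrib_left 2 scale_mult_right[symmetric])
  show "(scale (par_inv k) (T (sgen k)) + scale (par_inv k - 1) 1) * T (sgen k) = 1"
    using 1 by (simp add: distrib_right 3 scale_mult_left[symmetric])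
qed

lemma T_invertible:
  assumes "w \<in> weyl d"
  shows "\<exists>y. T w * y = 1 \<and> y * T w = 1"
  using assms
proof (induction w rule: weyl_induct)
  case id
  then show ?case by (intro exI[of _ 1]) (simp add: T_id)
next
  case (sgen w k)
  then obtain y where y: "T w * y = 1" "y * T w = 1" by blast
  let ?z = "scale (par_inv k) (T (sgen k)) + scale (par_inv k - 1) 1"
  note z = T_sgen_inverse[OF sgen(2)]
  have "T w * (y * ?z) = ?z" "y * (?z * (T (sgen k) * T w)) = 1"
    using y z by (metis mult.assoc mult.left_neutral)+
  then show ?case
    using y z unfolding T_left_asc[OF sgen(1-3), symmetric]
    by (intro exI[of _ "y * ?z"]) (simp add: mult.assoc)
qed

lemma T_bar_inverse:
  assumes "w \<in> weyl d"
  shows "T (inv w) * T_bar w = 1" "T_bar w * T (inv w) = 1"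
proof -
  obtain y where "T (inv w) * y = 1" "y * T (inv w) = 1"
    using T_invertible[OF weyl_inv[OF assms]] by blast
  then show "T (inv w) * T_bar w = 1" "T_bar w * T (inv w) = 1"
    unfolding T_bar_def using ring_inv_eqI by metis+
qed

lemma T_bar_id [simp]: "T_bar id = 1" "T_bar (\<lambda>i. i) = 1"
  by (simp_all add: T_bar_def T_id ring_inv_eqI inv_id id_def[symmetric])

lemma T_bar_sgen: "k < d \<Longrightarrow> T_bar (sgen k) = scale (par_inv k) (T (sgen k)) + scale (par_inv k - 1) 1"
  unfolding T_bar_def by (simp add: ring_inv_eqI T_sgen_inverse)

lemma T_bar_asc:
  assumes "w \<in> weyl d" "k < d" "asc k w"
  shows "T_bar (sgen k \<circ> w) = T_bar (sgen k) * T_bar w"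
proof -
  have "T (inv (sgen k \<circ> w)) = T (inv w) * T (sgen k)"
    using T_right_asc[OF weyl_inv[OF assms(1)] assms(2,3)] by (simp add: inv_sgen_comp[OF assms(1,2)])
  moreover have "(T (inv w) * T (sgen k)) * (T_bar (sgen k) * T_bar w) = 1"
    using T_bar_inverse[OF assms(1)] T_bar_inverse[OF sgen_weyl[OF assms(2)]]
    by (metis inv_sgen mult.assoc mult.left_neutral)
  moreover have "(T_bar (sgen k) * T_bar w) * (T (inv w) * T (sgen k)) = 1"
    using T_bar_inverse[OF assms(1)] T_bar_inverse[OF sgen_weyl[OF assms(2)]]
    by (metis inv_sgen mult.assoc mult.left_neutral)
  ultimately show ?thesis
    unfolding T_bar_def[of "sgen k \<circ> w"] using ring_inv_eqI by simp
qed

lemma T_bar_sgen_sq: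
  assumes "k < d"
  shows "T_bar (sgen k) * T_bar (sgen k) = scale (par_inv k) 1 + scale (par_inv k - 1) (T_bar (sgen k))"
proof -
  have "T_bar (sgen k) * T_bar (sgen k) =
      scale (par_inv k) (T_bar (sgen k) * T (sgen k)) + scale (par_inv k - 1) (T_bar (sgen k) * 1)"
    unfolding scale_mult_right distrib_left[symmetric] by (simp only: T_bar_sgen[OF assms])
  then show ?thesis using T_bar_inverse(2)[OF sgen_weyl[OF assms]] by simp
qed

lemma T_bar_desc:
  assumes "w \<in> weyl d" "k < d" "\<not> asc k w"
  shows "T_bar (sgen k) * T_bar w = scale (par_inv k) (T_bar (sgen k \<circ> w)) + scale (par_inv k - 1) (T_bar w)"
proof -
  let ?v = "sgen k \<circ> w"
  have v: "?v \<in> weyl d" "asc k ?v" using assms asc_sgen by auto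
  have w: "T_bar w = T_bar (sgen k) * T_bar ?v" using T_bar_asc[OF v(1) assms(2) v(2)] unfolding sgen_comp_cancel .
  have "T_bar (sgen k) * T_bar w = (T_bar (sgen k) * T_bar (sgen k)) * T_bar ?v" by (subst w) (simp add: mult.assoc)
  also have "\<dots> = scale (par_inv k) (T_bar ?v) + scale (par_inv k - 1) (T_bar (sgen k) * T_bar ?v)"
    by (simp add: T_bar_sgen_sq[OF assms(2)] distrib_right scale_mult_left[symmetric])
  finally show ?thesis by (simp only: w)
qed

lemma hbar_eq: "hbar h = (\<Sum>w\<in>weyl d. scale (lau_bar (coef h w)) (T_bar w))"
  by (simp add: hbar_def coef_def T_bar_def)

lemma hbar_add: "hbar (x + y) = hbar x + hbar y"
  by (simp add: hbar_eq coef_add lau_bar_add scale_left_distrib sum.distrib)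

lemma hbar_scale: "hbar (scale a x) = scale (lau_bar a) (hbar x)"
  by (simp add: hbar_eq coef_scale lau_bar_mult scale_sum_right)

lemma hbar_zero [simp]: "hbar 0 = 0"
  by (simp add: hbar_eq)

lemma hbar_sum: "hbar (sum f I) = (\<Sum>i\<in>I. hbar (f i))"
  by (induction I rule: infinite_finite_induct) (auto simp: hbar_add)

lemma hbar_T: "w \<in> weyl d \<Longrightarrow> hbar (T w) = T_bar w"
proof -
  assume w: "w \<in> weyl d"
  have "hbar (T w) = (\<Sum>y\<in>weyl d. if y = w then T_bar w else 0)"
    unfolding hbar_eq by (rule sum.cong) (auto simp: coef_T w)
  then show ?thesis using w by simp
qed

lemma hbar_sgen_mult:
  assumes "k < d"
  shows "hbar (T (sgen k) * h) = T_bar (sgen k) * hbar h"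
proof (induction h rule: hecke_induct)
  case (T a w)
  have "hbar (T (sgen k) * T w) = T_bar (sgen k) * T_bar w"
  proof (cases "asc k w")
    case True
    then show ?thesis using T assms by (simp add: T_left_asc hbar_T T_bar_asc)
  next
    case False
    then show ?thesis using T assms
      by (simp add: T_left_desc hbar_T T_bar_desc hbar_add hbar_scale lau_bar_diff)
  qed
  then show ?case using T
    by (simp add: scale_mult_right[symmetric] hbar_scale hbar_T)
qed (simp_all add: distrib_left hbar_add)

text \<open>It suffices to let \<open>x\<close> be a generator, and the quadratic relation of its inverse is the bar
  conjugate of its own quadratic relation (\<open>T_bar_desc\<close>).\<close>

lemma hbar_mult: "hbar (x * y) = hbar x * hbar y"
proof (induction x rule: hecke_induct)
  case (T a w)
  from T have "hbar (T w * y) = T_bar w * hbar y"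
  proof (induction w rule: weyl_induct)
    case (sgen w k)
    then show ?case
      by (simp add: T_left_asc[symmetric] T_bar_asc mult.assoc hbar_sgen_mult del: o_apply)
  qed (simp add: T_id)
  then show ?case using T by (simp add: scale_mult_left[symmetric] hbar_scale hbar_T)
qed (simp_all add: distrib_right hbar_add)

lemma hbar_one [simp]: "hbar 1 = 1"
  using hbar_T[OF weyl_id] by (simp add: T_id)

lemma hbar_T_bar:
  assumes "w \<in> weyl d"
  shows "hbar (T_bar w) = T w"
proof -
  have "T_bar (inv w) * hbar (T_bar w) = hbar (T (inv w) * T_bar w)"
    using assms by (simp add: hbar_mult hbar_T)
  also have "\<dots> = 1" using T_bar_inverse(1)[OF assms] by simp
  finally have 1: "T_bar (inv w) * hbar (T_bar w) = 1" .
  have "T w * T_bar (inv w) = 1" using T_bar_inverse(1)[OF weyl_inv[OF assms]] assms by simp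
  then show ?thesis using 1 by (metis mult.assoc mult.left_neutral mult.right_neutral)
qed

lemma hbar_hbar [simp]: "hbar (hbar h) = h"
  by (induction h rule: hecke_induct) (auto simp: hbar_scale hbar_T hbar_T_bar hbar_add)

text \<open>Triangularity. The elements that occur in \<open>T_bar (sgen k \<circ> w)\<close> are among those that occur in
  \<open>T_bar w\<close> and their products with the generator; the lifting property keeps them below
  \<open>sgen k \<circ> w\<close> in the rank order.\<close>

lemma T_bar_triangular:
  assumes "w \<in> weyl d"
  shows "coef (T_bar w) w = bar_lead d w \<and>
    (\<forall>y\<in>weyl d. coef (T_bar w) y \<noteq> 0 \<longrightarrow> rank_le d y w \<and> (y = w \<or> weyl_len d y < weyl_len d w))"
  using assms
proof (induction w rule: weyl_induct)
  case id
  have 1: "coef (T_bar id) y = (if y = id then 1 else 0)" if "y \<in> weyl d" for y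
    using coef_T[OF weyl_id that] unfolding T_id T_bar_id .
  show ?case
  proof (intro conjI ballI impI)
    show "coef (T_bar id) id = bar_lead d id" using 1[OF weyl_id] by (simp add: bar_lead_def)
    fix y assume "y \<in> weyl d" "coef (T_bar id) y \<noteq> 0"
    then have "y = id" using 1 by metis
    then show "rank_le d y id" "y = id \<or> weyl_len d y < weyl_len d id" by (simp_all only: rank_le_refl simp_thms)
  qed
next
  case (sgen w k)
  let ?sw = "sgen k \<circ> w"
  note len = weyl_len_sgen(1)[OF sgen(1-3)]
  have IH: "rank_le d y w" "y = w \<or> weyl_len d y < weyl_len d w"
    if "y \<in> weyl d" "coef (T_bar w) y \<noteq> 0" for y
    using sgen(4) that by blast+
  have exp: "coef (T_bar ?sw) y = par_inv k * coef (T (sgen k) * T_bar w) y + (par_inv k - 1) * coef (T_bar w) y" for y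
  proof -
    have "T_bar ?sw = scale (par_inv k) (T (sgen k) * T_bar w) + scale (par_inv k - 1) (T_bar w)"
      by (simp add: T_bar_asc[OF sgen(1-3)] T_bar_sgen[OF sgen(2)] distrib_right scale_mult_left[symmetric])
    then show ?thesis by (simp add: coef_add coef_scale)
  qed
  have "coef (T_bar ?sw) ?sw = bar_lead d ?sw"
  proof -
    have sw: "?sw \<in> weyl d" "\<not> asc k ?sw" using sgen asc_sgen by auto
    have "coef (T_bar w) ?sw = 0"
    proof (rule ccontr)
      assume "coef (T_bar w) ?sw \<noteq> 0"
      from IH(2)[OF sw(1) this] len show False by (metis lessI not_less_iff_gr_or_eq order_less_irrefl)
    qed
    then show ?thesis
      using exp[of ?sw] left_operator(1)[OF sgen(2) sw(1), of "T_bar w"] sw(2) sgen(4)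
      by (simp add: bar_lead_sgen[OF sgen(1-3)])
  qed
  moreover have "rank_le d y ?sw \<and> (y = ?sw \<or> weyl_len d y < weyl_len d ?sw)"
    if y: "y \<in> weyl d" "coef (T_bar ?sw) y \<noteq> 0" for y
  proof -
    have sy: "sgen k \<circ> y \<in> weyl d" using y sgen(2) by simp
    have "coef (T_bar w) y \<noteq> 0 \<or> coef (T_bar w) (sgen k \<circ> y) \<noteq> 0"
      using y exp[of y] left_operator(1)[OF sgen(2) y(1), of "T_bar w"] by (auto split: if_splits)
    then show ?thesis
    proof
      assume c: "coef (T_bar w) y \<noteq> 0"
      from IH[OF y(1) this] show ?thesis
        using rank_le_sgen(2)[OF y(1) sgen(1-3)] len by auto
    next
      assume c: "coef (T_bar w) (sgen k \<circ> y) \<noteq> 0"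
      have "weyl_len d y \<le> Suc (weyl_len d (sgen k \<circ> y))"
        using weyl_len_sgen[OF y(1) sgen(2)] by (cases "asc k y") auto
      moreover have "sgen k \<circ> y = w \<Longrightarrow> y = ?sw" by auto
      moreover have "rank_le d y ?sw"
        using rank_le_sgen(1)[OF sy sgen(1-3) IH(1)[OF sy c]] by simp
      ultimately show ?thesis using IH(2)[OF sy c] len by linarith
    qed
  qed
  ultimately show ?case by blast
qed

subsection \<open>Invariants of parabolic subgroups\<close>

definition left_invariant :: "(nat \<Rightarrow> nat) \<Rightarrow> 'h \<Rightarrow> bool" where
  "left_invariant l z \<longleftrightarrow> (\<forall>k\<in>gens d l. T (sgen k) * z = scale (par k) z)"

definition right_invariant :: "(nat \<Rightarrow> nat) \<Rightarrow> 'h \<Rightarrow> bool" where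
  "right_invariant m z \<longleftrightarrow> (\<forall>k\<in>gens d m. z * T (sgen k) = scale (par k) z)"

lemma left_invariant_iff: "left_invariant l z \<longleftrightarrow> (\<forall>k\<in>gens d l. \<forall>y\<in>weyl d. coef z (sgen k \<circ> y) = coef z y)"
  unfolding left_invariant_def using left_operator(2)[OF gens_less] by blast

lemma right_invariant_iff: "right_invariant m z \<longleftrightarrow> (\<forall>k\<in>gens d m. \<forall>y\<in>weyl d. coef z (y \<circ> sgen k) = coef z y)"
  unfolding right_invariant_def using right_operator[OF gens_less] by blast

lemma left_invariant_coef:
  assumes l: "l \<in> Lam n d" and z: "left_invariant l z" and w: "w \<in> parabolic d l" and y: "y \<in> weyl d"
  shows "coef z (w \<circ> y) = coef z y"
  using l w
proof (induction w rule: parabolic_induct)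
  case (sgen w k)
  have "w \<circ> y \<in> weyl d" using sgen(1) y parabolic_weyl by simp
  then have "coef z (sgen k \<circ> (w \<circ> y)) = coef z (w \<circ> y)"
    using z sgen(2) unfolding left_invariant_iff by blast
  then show ?case using sgen(4) unfolding comp_assoc by (rule trans)
qed simp

lemma right_invariant_coef:
  assumes m: "m \<in> Lam n d" and z: "right_invariant m z" and w: "w \<in> parabolic d m" and y: "y \<in> weyl d"
  shows "coef z (y \<circ> w) = coef z y"
proof -
  have "\<forall>y\<in>weyl d. coef z (y \<circ> w) = coef z y"
    using m w
  proof (induction w rule: parabolic_induct)
    case (sgen w k)
    show ?case
    proof
      fix y assume y: "y \<in> weyl d"
      have "y \<circ> sgen k \<in> weyl d" using y sgen(2) gens_less by simp
      then have "coef z ((y \<circ> sgen k) \<circ> w) = coef z (y \<circ> sgen k)" using sgen(4) by blast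
      also have "\<dots> = coef z y" using z sgen(2) y unfolding right_invariant_iff by blast
      finally show "coef z (y \<circ> (sgen k \<circ> w)) = coef z y" by (simp add: comp_assoc)
    qed
  qed simp
  with y show ?thesis by blast
qed

definition coset_sum :: "(nat \<Rightarrow> nat) \<Rightarrow> (int \<Rightarrow> int) \<Rightarrow> (nat \<Rightarrow> nat) \<Rightarrow> 'h" where
  "coset_sum l g m = (\<Sum>w\<in>double_coset d l g m. T w)"

lemma coef_coset_sum:
  assumes "g \<in> weyl d" "y \<in> weyl d"
  shows "coef (coset_sum l g m) y = (if y \<in> double_coset d l g m then 1 else 0)"
proof -
  have "coef (coset_sum l g m) y = (\<Sum>w\<in>double_coset d l g m. if y = w then 1 else 0)"
    unfolding coset_sum_def coef_sum
    by (rule sum.cong) (use assms double_coset_weyl coef_T in auto)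
  then show ?thesis using finite_double_coset[OF assms(1)] by simp
qed

lemma coset_sum_invariant:
  assumes g: "g \<in> weyl d"
  shows "left_invariant l (coset_sum l g m)" "right_invariant m (coset_sum l g m)"
proof -
  have "sgen k \<circ> y \<in> double_coset d l g m \<longleftrightarrow> y \<in> double_coset d l g m" if "k \<in> gens d l" for k y
    using double_coset_left[OF _ sgen_parabolic[OF that]] by (metis sgen_comp_cancel(1))
  then show "left_invariant l (coset_sum l g m)"
    unfolding left_invariant_iff using g by (simp add: coef_coset_sum gens_less)
  have "y \<circ> sgen k \<in> double_coset d l g m \<longleftrightarrow> y \<in> double_coset d l g m" if "k \<in> gens d m" for k y
    using double_coset_right[OF _ sgen_parabolic[OF that]] by (metis sgen_comp_cancel(2))
  then show "right_invariant m (coset_sum l g m)"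
    unfolding right_invariant_iff using g by (simp add: coef_coset_sum gens_less)
qed

lemma double_coset_id: "double_coset d m id m = parabolic d m"
proof (intro set_eqI iffI)
  fix w assume "w \<in> parabolic d m"
  then show "w \<in> double_coset d m id m"
    using double_coset_left[OF double_coset_self[of id d m m]] by fastforce
qed (auto simp: double_coset_def intro: parabolic_comp)

lemma xx_eq_coset_sum: "xx m = coset_sum m id m"
  by (simp add: xx_def coset_sum_def double_coset_id)

lemma xx_invariant: "left_invariant m (xx m)" "right_invariant m (xx m)"
  unfolding xx_eq_coset_sum by (rule coset_sum_invariant[OF weyl_id])+

lemma left_invariant_mult: "left_invariant l z \<Longrightarrow> left_invariant l (z * h)"
  unfolding left_invariant_def by (metis mult.assoc scale_mult_left)

lemma right_invariant_mult: "right_invariant m z \<Longrightarrow> right_invariant m (h * z)"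
  unfolding right_invariant_def by (metis mult.assoc scale_mult_right)

text \<open>An invariant element has constant coefficients on the cosets of the parabolic subgroup. By
  additivity of lengths the sum of \<open>T w\<close> over a coset is \<open>xx l\<close> times the basis element of its
  descent-free representative.\<close>

lemma left_invariant_range:
  assumes l: "l \<in> Lam n d"
  shows "left_invariant l z \<longleftrightarrow> z \<in> range (\<lambda>h. xx l * h)"
proof
  assume z: "left_invariant l z"
  let ?G = "{g \<in> weyl d. \<forall>k\<in>gens d l. asc k g}"
  have "z = (\<Sum>y\<in>weyl d. scale (coef z y) (T y))" by (simp add: coef_expansion)
  also have "\<dots> = (\<Sum>p\<in>parabolic d l \<times> ?G. scale (coef z (fst p \<circ> snd p)) (T (fst p \<circ> snd p)))"
    using sum.reindex_bij_betw[OF parabolic_decomposition[OF l], of "\<lambda>y. scale (coef z y) (T y)"]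
    by (simp add: case_prod_unfold)
  also have "\<dots> = (\<Sum>p\<in>parabolic d l \<times> ?G. T (fst p) * scale (coef z (snd p)) (T (snd p)))"
  proof (rule sum.cong[OF refl])
    fix p assume p: "p \<in> parabolic d l \<times> ?G"
    obtain w g where [simp]: "p = (w, g)" by (cases p)
    have wg: "w \<in> parabolic d l" "g \<in> weyl d" "\<And>k. k \<in> gens d l \<Longrightarrow> asc k g" using p by auto
    have "T (w \<circ> g) = T w * T g"
      using T_mult[OF parabolic_weyl[OF wg(1)] wg(2)] parabolic_len_add[OF l wg(2,3,1)] by simp
    then show "scale (coef z (fst p \<circ> snd p)) (T (fst p \<circ> snd p)) =
        T (fst p) * scale (coef z (snd p)) (T (snd p))"
      using left_invariant_coef[OF l z wg(1,2)] by (simp add: scale_mult_right)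
  qed
  also have "\<dots> = xx l * (\<Sum>g\<in>?G. scale (coef z g) (T g))"
    by (simp add: xx_def sum_product sum.cartesian_product case_prod_unfold)
  finally show "z \<in> range (\<lambda>h. xx l * h)" by blast
qed (auto intro: left_invariant_mult xx_invariant)

text \<open>The same decomposition after inversion in the group.\<close>

lemma right_invariant_range:
  assumes m: "m \<in> Lam n d"
  shows "right_invariant m z \<longleftrightarrow> z \<in> range (\<lambda>h. h * xx m)"
proof
  assume z: "right_invariant m z"
  let ?G = "{g \<in> weyl d. \<forall>k\<in>gens d m. asc k g}"
  have inv_bij: "bij_betw inv (weyl d) (weyl d)"
    by (rule bij_betw_byWitness[where f' = inv]) auto
  have inv_bij_m: "bij_betw inv (parabolic d m) (parabolic d m)"
    by (rule bij_betw_byWitness[where f' = inv]) (auto simp: parabolic_inv weyl_inv_inv[OF parabolic_weyl])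
  have "z = (\<Sum>y\<in>weyl d. scale (coef z y) (T y))" by (simp add: coef_expansion)
  also have "\<dots> = (\<Sum>y\<in>weyl d. scale (coef z (inv y)) (T (inv y)))"
    using sum.reindex_bij_betw[OF inv_bij, of "\<lambda>y. scale (coef z y) (T y)"] by simp
  also have "\<dots> = (\<Sum>p\<in>parabolic d m \<times> ?G. scale (coef z (inv (fst p \<circ> snd p))) (T (inv (fst p \<circ> snd p))))"
    using sum.reindex_bij_betw[OF parabolic_decomposition[OF m],
        of "\<lambda>y. scale (coef z (inv y)) (T (inv y))"]
    by (simp add: case_prod_unfold)
  also have "\<dots> = (\<Sum>p\<in>parabolic d m \<times> ?G. scale (coef z (inv (snd p))) (T (inv (snd p))) * T (inv (fst p)))"
  proof (rule sum.cong[OF refl])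
    fix p assume p: "p \<in> parabolic d m \<times> ?G"
    obtain w g where [simp]: "p = (w, g)" by (cases p)
    have wg: "w \<in> parabolic d m" "g \<in> weyl d" "\<And>k. k \<in> gens d m \<Longrightarrow> asc k g" using p by auto
    note w = parabolic_weyl[OF wg(1)]
    have "weyl_len d (inv g \<circ> inv w) = weyl_len d (inv g) + weyl_len d (inv w)"
      using parabolic_len_add[OF m wg(2,3,1)] weyl_len_inv[OF weyl_comp[OF w wg(2)]]
        weyl_len_inv[OF w] weyl_len_inv[OF wg(2)] weyl_inv_comp[OF w wg(2)] by simp
    then have "T (inv g \<circ> inv w) = T (inv g) * T (inv w)"
      using T_mult[OF weyl_inv[OF wg(2)] weyl_inv[OF w]] by simp
    then show "scale (coef z (inv (fst p \<circ> snd p))) (T (inv (fst p \<circ> snd p))) =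
        scale (coef z (inv (snd p))) (T (inv (snd p))) * T (inv (fst p))"
      using right_invariant_coef[OF m z parabolic_inv[OF wg(1)] weyl_inv[OF wg(2)]]
      by (simp add: scale_mult_left weyl_inv_comp[OF w wg(2)])
  qed
  also have "\<dots> = (\<Sum>g\<in>?G. scale (coef z (inv g)) (T (inv g))) * (\<Sum>w\<in>parabolic d m. T (inv w))"
    by (simp add: sum_product sum.cartesian_product case_prod_unfold)
      (rule sum.reindex_bij_witness[of _ prod.swap prod.swap], auto)
  also have "(\<Sum>w\<in>parabolic d m. T (inv w)) = xx m"
    unfolding xx_def by (rule sum.reindex_bij_betw[OF inv_bij_m])
  finally show "z \<in> range (\<lambda>h. h * xx m)" by blast
qed (auto intro: right_invariant_mult xx_invariant)

text \<open>Conjugation turns the eigenvalue equation for \<open>T (sgen k)\<close> into the one for its inverse.\<close>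

lemma left_invariant_hbar:
  assumes "left_invariant l z"
  shows "left_invariant l (hbar z)"
  unfolding left_invariant_def
proof
  fix k assume k: "k \<in> gens d l"
  have "T_bar (sgen k) * hbar z = hbar (T (sgen k) * z)" using hbar_sgen_mult[OF gens_less[OF k]] by simp
  also have "\<dots> = scale (par_inv k) (hbar z)" using assms k by (simp add: left_invariant_def hbar_scale)
  finally have "T (sgen k) * (T_bar (sgen k) * hbar z) = scale (par_inv k) (T (sgen k) * hbar z)"
    by (simp add: scale_mult_right)
  moreover have "T (sgen k) * (T_bar (sgen k) * hbar z) = hbar z"
    using T_bar_inverse(1)[OF sgen_weyl[OF gens_less[OF k]]] by (simp add: mult.assoc[symmetric])
  ultimately have "scale (par k) (hbar z) = scale (par k * par_inv k) (T (sgen k) * hbar z)"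
    by (metis scale_scale)
  then show "T (sgen k) * hbar z = scale (par k) (hbar z)" by simp
qed

lemma right_invariant_hbar:
  assumes "right_invariant m z"
  shows "right_invariant m (hbar z)"
  unfolding right_invariant_def
proof
  fix k assume k: "k \<in> gens d m"
  have "hbar z * T_bar (sgen k) = hbar (z * T (sgen k))"
    using gens_less[OF k] by (simp add: hbar_mult hbar_T)
  also have "\<dots> = scale (par_inv k) (hbar z)" using assms k by (simp add: right_invariant_def hbar_scale)
  finally have "(hbar z * T_bar (sgen k)) * T (sgen k) = scale (par_inv k) (hbar z * T (sgen k))"
    by (simp add: scale_mult_left)
  moreover have "(hbar z * T_bar (sgen k)) * T (sgen k) = hbar z"
    using T_bar_inverse(2)[OF sgen_weyl[OF gens_less[OF k]]] by (simp add: mult.assoc)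
  ultimately have "scale (par k) (hbar z) = scale (par k * par_inv k) (hbar z * T (sgen k))"
    by (metis scale_scale)
  then show "hbar z * T (sgen k) = scale (par k) (hbar z)" by simp
qed

lemma invariant_coef:
  assumes l: "l \<in> Lam n d" "m \<in> Lam n d" and z: "left_invariant l z" "right_invariant m z"
    and g: "g \<in> weyl d" "w \<in> double_coset d l g m"
  shows "coef z w = coef z g"
proof -
  obtain u v where uv: "u \<in> parabolic d l" "v \<in> parabolic d m" "w = u \<circ> g \<circ> v"
    using g by (auto simp: double_coset_def)
  then show ?thesis
    using right_invariant_coef[OF l(2) z(2) uv(2), of "u \<circ> g"] left_invariant_coef[OF l(1) z(1) uv(1) g(1)]
      parabolic_weyl[OF uv(1)] g(1) by simp
qed

text \<open>The bar conjugate of \<open>T w\<close> involves, besides \<open>w\<close>, only shorter elements. So among the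
  elements of the double coset only \<open>h\<close> itself contributes to the coefficient at \<open>h\<close>.\<close>

lemma hbar_coset_sum:
  assumes l: "l \<in> Lam n d" "m \<in> Lam n d" and g: "g \<in> weyl d" "h \<in> max_reps d l g m"
  shows "coef (hbar (coset_sum l g m)) g = bar_lead d h"
    and "y \<in> weyl d \<Longrightarrow> coef (hbar (coset_sum l g m)) y \<noteq> 0 \<Longrightarrow>
      le_alg n (kappa (l, y, m)) (kappa (l, g, m))"
proof -
  let ?D = "double_coset d l g m"
  have D: "w \<in> weyl d" if "w \<in> ?D" for w using double_coset_weyl[OF g(1) that] .
  have exp: "coef (hbar (coset_sum l g m)) y = (\<Sum>w\<in>?D. coef (T_bar w) y)" for y
    using D by (simp add: coset_sum_def hbar_sum coef_sum hbar_T)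
  have h: "h \<in> ?D" "\<And>w. w \<in> ?D \<Longrightarrow> weyl_len d w \<le> weyl_len d h"
    using g by (auto simp: max_reps_def)
  have "coef (hbar (coset_sum l g m)) h = (\<Sum>w\<in>?D. if w = h then bar_lead d h else 0)"
    unfolding exp
  proof (rule sum.cong[OF refl])
    fix w assume w: "w \<in> ?D"
    show "coef (T_bar w) h = (if w = h then bar_lead d h else 0)"
      using T_bar_triangular[OF D[OF w]] h(2)[OF w] D[OF h(1)] by force
  qed
  then have "coef (hbar (coset_sum l g m)) h = bar_lead d h"
    using h(1) finite_double_coset[OF g(1)] by simp
  moreover have "coef (hbar (coset_sum l g m)) h = coef (hbar (coset_sum l g m)) g"
    by (rule invariant_coef[OF l left_invariant_hbar right_invariant_hbar g(1) h(1)]) (rule coset_sum_invariant[OF g(1)])+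
  ultimately show "coef (hbar (coset_sum l g m)) g = bar_lead d h" by simp
  assume y: "y \<in> weyl d" "coef (hbar (coset_sum l g m)) y \<noteq> 0"
  then obtain w where w: "w \<in> ?D" "coef (T_bar w) y \<noteq> 0"
    unfolding exp by (meson sum.neutral)
  then have "rank_le d y w" using T_bar_triangular[OF D[OF w(1)]] y(1) by blast
  then have "le_alg n (kappa (l, y, m)) (kappa (l, w, m))"
    by (rule le_alg_kappa[OF l y(1) D[OF w(1)]])
  then show "le_alg n (kappa (l, y, m)) (kappa (l, g, m))"
    using kappa_double_coset[OF l g(1) w(1)] by simp
qed

text \<open>The matrix of the trivial double coset is minimal for the algebraic order, so no other double
  coset can occur here.\<close>

lemma hbar_xx:
  assumes m: "m \<in> Lam n d" and hm: "hm \<in> max_reps d m id m"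
  shows "hbar (xx m) = scale (bar_lead d hm) (xx m)"
proof (rule hecke_eqI)
  fix y assume y: "y \<in> weyl d"
  show "coef (hbar (xx m)) y = coef (scale (bar_lead d hm) (xx m)) y"
  proof (cases "y \<in> double_coset d m id m")
    case True
    have "coef (hbar (xx m)) y = coef (hbar (xx m)) id"
      by (rule invariant_coef[OF m m left_invariant_hbar right_invariant_hbar weyl_id True]) (rule xx_invariant)+
    then show ?thesis
      using hbar_coset_sum(1)[OF m m weyl_id hm] coef_coset_sum[OF weyl_id y] True
      by (simp add: xx_eq_coset_sum coef_scale)
  next
    case False
    have "coef (hbar (xx m)) y = 0"
    proof (rule ccontr)
      assume "coef (hbar (xx m)) y \<noteq> 0"
      then have "le_alg n (kappa (m, y, m)) (kappa (m, id, m))"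
        using hbar_coset_sum(2)[OF m m weyl_id hm y] by (simp add: xx_eq_coset_sum)
      then have eq: "kappa (m, y, m) = kappa (m, id, m)"
        by (rule kappa_id_minimal[OF m kappa_Xi[OF m m y]])
      obtain g where g: "g \<in> min_reps d m m" "double_coset d m g m = double_coset d m y m"
        using ex_min_rep[OF y] by blast
      have "kappa (m, g, m) = kappa (m, y, m)"
        using kappa_double_coset[OF m m y] g(2) double_coset_self by metis
      moreover have "id \<in> min_reps d m m" by (simp add: min_reps_def)
      ultimately have "g = id" using min_reps_kappa_inj[OF m m g(1)] eq by metis
      then show False using g(2) False double_coset_self by metis
    qed
    then show ?thesis using coef_coset_sum[OF weyl_id y] False by (simp add: xx_eq_coset_sum coef_scale)
  qed
qed

end

section \<open>The Schur algebras in coordinates\<close>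

lemma sum_fun_apply: "(sum f I) x = (\<Sum>i\<in>I. f i x)"
  by (induction I rule: infinite_finite_induct) auto

lemma kappa_Xi_i:
  assumes "l \<in> Lam n d" "m \<in> Lam n d" "g \<in> weyl d"
  shows "kappa (l, g, m) \<in> Xi_i n d \<longleftrightarrow> l \<in> Lam_i n d \<and> m \<in> Lam_i n d"
  using assms kappa_Xi[OF assms]
  by (auto simp: Xi_i_def Lam_i_def row_kappa col_kappa card_block_0)

lemma inv_kappa: "t \<in> triples n d \<Longrightarrow> the_inv_into (triples n d) kappa (kappa t) = t"
  using kappa_bij[of n d] by (simp add: bij_betw_def the_inv_into_f_f)

lemma Xi_triple:
  assumes "A \<in> Xi n d"
  obtains l g m where "(l, g, m) \<in> triples n d" "A = kappa (l, g, m)"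
    "l \<in> Lam n d" "m \<in> Lam n d" "g \<in> min_reps d l m" "g \<in> weyl d"
proof -
  have "A \<in> kappa ` triples n d" using assms kappa_bij[of n d] by (simp add: bij_betw_def)
  then obtain l g m where "(l, g, m) \<in> triples n d" "A = kappa (l, g, m)" by auto
  then show thesis using that by (auto simp: triples_def dest: min_reps_weyl)
qed

context hecke_algebra
begin

subsection \<open>Right linear maps\<close>

lemma dsum_iff:
  "p \<in> dsum X \<longleftrightarrow> (\<forall>l\<in>X. p l \<in> range (\<lambda>h. xx l * h)) \<and> (\<forall>l. l \<notin> X \<longrightarrow> p l = 0)"
  unfolding dsum_def mem_Collect_eq by (metis (full_types))

lemma range_xx_zero: "0 \<in> range (\<lambda>h. xx l * h)"
  by (rule image_eqI[of _ _ 0]) auto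

lemma range_xx_add:
  "x \<in> range (\<lambda>h. xx l * h) \<Longrightarrow> y \<in> range (\<lambda>h. xx l * h) \<Longrightarrow> x + y \<in> range (\<lambda>h. xx l * h)"
  by (auto simp: distrib_left[symmetric])

lemma range_xx_mult: "x \<in> range (\<lambda>h. xx l * h) \<Longrightarrow> x * y \<in> range (\<lambda>h. xx l * h)"
  by (auto simp: mult.assoc)

lemma range_xx_scale: "x \<in> range (\<lambda>h. xx l * h) \<Longrightarrow> scale a x \<in> range (\<lambda>h. xx l * h)"
  by (auto simp: scale_mult_right)

lemma range_xx_sum:
  "(\<And>i. i \<in> I \<Longrightarrow> f i \<in> range (\<lambda>h. xx l * h)) \<Longrightarrow> sum f I \<in> range (\<lambda>h. xx l * h)"
  by (induction I rule: infinite_finite_induct) (simp_all add: range_xx_zero range_xx_add)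

lemma range_xx_self: "xx l \<in> range (\<lambda>h. xx l * h)"
  by (rule image_eqI[of _ _ 1]) auto

lemma dsum_zero: "0 \<in> dsum X"
  by (simp add: dsum_iff range_xx_zero)

lemma dsum_add: "p \<in> dsum X \<Longrightarrow> p' \<in> dsum X \<Longrightarrow> p + p' \<in> dsum X"
  by (simp add: dsum_iff range_xx_add)

lemma dsum_mult: "p \<in> dsum X \<Longrightarrow> (\<lambda>l. p l * h) \<in> dsum X"
  by (simp add: dsum_iff range_xx_mult)

lemma dsum_sum: "(\<And>i. i \<in> I \<Longrightarrow> f i \<in> dsum X) \<Longrightarrow> sum f I \<in> dsum X"
  by (induction I rule: infinite_finite_induct) (simp_all add: dsum_zero dsum_add)

lemma dsum_inj_at: "l \<in> X \<Longrightarrow> z \<in> range (\<lambda>h. xx l * h) \<Longrightarrow> inj_at l z \<in> dsum X"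
  by (auto simp: dsum_iff inj_at_def range_xx_zero)

lemma dsum_mono: "X \<subseteq> Y \<Longrightarrow> dsum X \<subseteq> dsum Y"
  unfolding dsum_iff subset_iff using range_xx_zero by metis

lemma End_HD:
  assumes "f \<in> End_H X"
  shows "p \<in> dsum X \<Longrightarrow> f p \<in> dsum X"
    and "p \<in> dsum X \<Longrightarrow> p' \<in> dsum X \<Longrightarrow> f (p + p') = f p + f p'"
    and "p \<in> dsum X \<Longrightarrow> f (\<lambda>l. p l * h) = (\<lambda>l. f p l * h)"
    and "p \<notin> dsum X \<Longrightarrow> f p = 0"
  using assms by (auto simp: End_H_def)

lemma End_H_zero: "f \<in> End_H X \<Longrightarrow> f 0 = 0"
  using End_HD(2)[of f X 0 0] by (simp add: dsum_zero)

lemma End_H_sum: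
  assumes f: "f \<in> End_H X" and I: "finite I" "\<And>i. i \<in> I \<Longrightarrow> p i \<in> dsum X"
  shows "f (sum p I) = (\<Sum>i\<in>I. f (p i))"
  using I
proof (induction I)
  case (insert i I)
  have "f (p i + sum p I) = f (p i) + f (sum p I)"
    using insert(4) by (intro End_HD(2)[OF f] dsum_sum) auto
  also have "f (sum p I) = (\<Sum>i\<in>I. f (p i))" using insert by blast
  finally show ?case unfolding sum.insert[OF insert(1,2)] .
qed (simp only: sum.empty End_H_zero[OF f])

text \<open>Every element of \<open>dsum X\<close> is a sum of right multiples of the generators.\<close>

lemma End_H_eval:
  assumes f: "f \<in> End_H X" and X: "finite X" and p: "\<And>l. l \<in> X \<Longrightarrow> p l = xx l * h l" "\<And>l. l \<notin> X \<Longrightarrow> p l = 0"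
  shows "f p k = (\<Sum>l\<in>X. f (inj_at l (xx l)) k * h l)"
proof -
  have gen: "inj_at l (xx l) \<in> dsum X" if "l \<in> X" for l
    using that by (rule dsum_inj_at[OF _ range_xx_self])
  have "p = (\<Sum>l\<in>X. (\<lambda>k. inj_at l (xx l) k * h l))"
  proof
    fix k
    have "(\<Sum>l\<in>X. inj_at l (xx l) k * h l) = (\<Sum>l\<in>X. if l = k then xx k * h k else 0)"
      by (rule sum.cong) (auto simp: inj_at_def)
    then show "p k = (\<Sum>l\<in>X. (\<lambda>k. inj_at l (xx l) k * h l)) k"
      using X p by (simp add: sum_fun_apply)
  qed
  then have "f p = (\<Sum>l\<in>X. f (\<lambda>k. inj_at l (xx l) k * h l))"
    using End_H_sum[OF f X, of "\<lambda>l k. inj_at l (xx l) k * h l"] gen dsum_mult by simp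
  also have "\<dots> = (\<Sum>l\<in>X. (\<lambda>k. f (inj_at l (xx l)) k * h l))"
    using End_HD(3)[OF f gen] by (intro sum.cong) auto
  finally show ?thesis by (simp add: sum_fun_apply)
qed

lemma End_H_eqI:
  assumes f: "f \<in> End_H X" "g \<in> End_H X" and X: "finite X"
    and eq: "\<And>l. l \<in> X \<Longrightarrow> f (inj_at l (xx l)) = g (inj_at l (xx l))"
  shows "f = g"
proof
  fix p show "f p = g p"
  proof (cases "p \<in> dsum X")
    case True
    then have "\<forall>l\<in>X. \<exists>h. p l = xx l * h" by (auto simp: dsum_iff)
    then obtain h where h: "\<And>l. l \<in> X \<Longrightarrow> p l = xx l * h l" by metis
    have z: "p l = 0" if "l \<notin> X" for l using True that by (simp add: dsum_iff)
    show ?thesis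
      using End_H_eval[OF f(1) X h z] End_H_eval[OF f(2) X h z] eq by (intro ext) simp
  next
    case False
    then show ?thesis using End_HD(4)[OF f(1)] End_HD(4)[OF f(2)] by simp
  qed
qed

definition component :: "'h endo \<Rightarrow> (nat \<Rightarrow> nat) \<Rightarrow> (nat \<Rightarrow> nat) \<Rightarrow> 'h" where
  "component f l m = f (inj_at m (xx m)) l"

lemma generator_dsum: "m \<in> X \<Longrightarrow> inj_at m (xx m) \<in> dsum X"
  by (rule dsum_inj_at[OF _ range_xx_self])

lemma component_outside: "f \<in> Schur_j n \<Longrightarrow> m \<in> Lam n d \<Longrightarrow> l \<notin> Lam n d \<Longrightarrow> component f l m = 0"
  using End_HD(1)[of f "Lam n d" "inj_at m (xx m)"] generator_dsum
  by (simp add: component_def Schur_j_def dsum_iff)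

lemma Schur_scale_arg:
  assumes f: "f \<in> Schur_j n" and m: "m \<in> Lam n d"
  shows "f (inj_at m (scale a (xx m))) = (\<lambda>l. scale a (component f l m))"
proof -
  have "inj_at m (scale a (xx m)) = (\<lambda>l. inj_at m (xx m) l * scale a 1)"
    by (auto simp: inj_at_def scale_mult_right[symmetric])
  then show ?thesis
    using End_HD(3)[OF f[unfolded Schur_j_def] generator_dsum[OF m], of "scale a 1"]
    by (simp add: component_def scale_mult_right[symmetric])
qed

text \<open>Right linearity makes the components invariant on the right, and the codomain makes them
  invariant on the left.\<close>

lemma component_invariant:
  assumes f: "f \<in> Schur_j n" and l: "l \<in> Lam n d" "m \<in> Lam n d"
  shows "left_invariant l (component f l m)" "right_invariant m (component f l m)"
proof -
  note fE = f[unfolded Schur_j_def]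
  have "f (inj_at m (xx m)) \<in> dsum (Lam n d)"
    by (rule End_HD(1)[OF fE generator_dsum[OF l(2)]])
  then show "left_invariant l (component f l m)"
    using left_invariant_range[OF l(1)] l(1) by (simp add: component_def dsum_iff)
  show "right_invariant m (component f l m)"
    unfolding right_invariant_def
  proof
    fix k assume k: "k \<in> gens d m"
    have "(\<lambda>l. inj_at m (xx m) l * T (sgen k)) = inj_at m (scale (par k) (xx m))"
      using xx_invariant(2)[of m] k by (auto simp: inj_at_def right_invariant_def)
    then have "(\<lambda>l. f (inj_at m (xx m)) l * T (sgen k)) = (\<lambda>l. scale (par k) (component f l m))"
      using End_HD(3)[OF fE generator_dsum[OF l(2)], of "T (sgen k)"] Schur_scale_arg[OF f l(2)] by simp
    then show "component f l m * T (sgen k) = scale (par k) (component f l m)"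
      unfolding component_def by (rule fun_cong)
  qed
qed

lemma Schur_j_eqI:
  assumes f: "f \<in> Schur_j n" "g \<in> Schur_j n"
    and eq: "\<And>l m. l \<in> Lam n d \<Longrightarrow> m \<in> Lam n d \<Longrightarrow> component f l m = component g l m"
  shows "f = g"
proof (rule End_H_eqI[OF f[unfolded Schur_j_def] finite_Lam], rule ext)
  fix m l assume m: "m \<in> Lam n d"
  show "f (inj_at m (xx m)) l = g (inj_at m (xx m)) l"
    using eq[OF _ m, of l] component_outside[OF f(1) m, of l] component_outside[OF f(2) m, of l]
    by (cases "l \<in> Lam n d") (auto simp: component_def)
qed

text \<open>A right invariant \<open>Z l m\<close> is a left multiple \<open>h * xx m\<close>, so left multiplication by \<open>h\<close>
  is a right linear map with this component; its values lie in the summand at \<open>l\<close> by left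
  invariance.\<close>

lemma Schur_j_exists:
  assumes Z: "\<And>l m. l \<in> Lam n d \<Longrightarrow> m \<in> Lam n d \<Longrightarrow> left_invariant l (Z l m) \<and> right_invariant m (Z l m)"
  shows "\<exists>f\<in>Schur_j n. \<forall>m\<in>Lam n d. f (inj_at m (xx m)) = (\<lambda>l. if l \<in> Lam n d then Z l m else 0)"
proof -
  let ?L = "Lam n d"
  have "\<forall>l\<in>?L. \<forall>m\<in>?L. \<exists>h. Z l m = h * xx m"
    using Z right_invariant_range by blast
  then obtain h where h: "\<And>l m. l \<in> ?L \<Longrightarrow> m \<in> ?L \<Longrightarrow> Z l m = h l m * xx m"
    by metis
  define f where "f p = (if p \<in> dsum ?L then (\<lambda>l. if l \<in> ?L then \<Sum>m\<in>?L. h l m * p m else 0) else 0)" for p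
  have mem: "h l m * x \<in> range (\<lambda>h. xx l * h)" if "l \<in> ?L" "m \<in> ?L" "x \<in> range (\<lambda>h. xx m * h)" for l m x
  proof -
    have "\<exists>y. x = xx m * y" using that(3) by auto
    then obtain y where "x = xx m * y" ..
    then have "h l m * x = Z l m * y" using h that by (simp add: mult.assoc)
    moreover have "Z l m \<in> range (\<lambda>h. xx l * h)" using Z that left_invariant_range by blast
    ultimately show ?thesis using range_xx_mult by simp
  qed
  have "f \<in> Schur_j n"
    unfolding Schur_j_def End_H_def mem_Collect_eq
  proof (intro conjI ballI allI impI)
    fix p assume p: "p \<in> dsum ?L"
    show "f p \<in> dsum ?L"
      using p mem by (auto simp: f_def dsum_iff intro!: range_xx_sum)
    show "f (\<lambda>l. p l * x) = (\<lambda>l. f p l * x)" for x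
      using p dsum_mult[OF p] by (auto simp: f_def sum_distrib_right mult.assoc)
    fix p' assume p': "p' \<in> dsum ?L"
    show "f (p + p') = f p + f p'"
      using p p' dsum_add[OF p p'] by (auto simp: f_def distrib_left sum.distrib)
  qed (simp add: f_def)
  moreover have "f (inj_at m (xx m)) = (\<lambda>l. if l \<in> ?L then Z l m else 0)" if m: "m \<in> ?L" for m
  proof
    fix l
    have "(\<Sum>k\<in>?L. h l k * inj_at m (xx m) k) = (\<Sum>k\<in>?L. if k = m then h l m * xx m else 0)"
      by (rule sum.cong) (auto simp: inj_at_def)
    then show "f (inj_at m (xx m)) l = (if l \<in> ?L then Z l m else 0)"
      using m h generator_dsum[OF m] by (simp add: f_def)
  qed
  ultimately show ?thesis by blast
qed

lemma Schur_j_zero: "0 \<in> Schur_j n"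
  by (auto simp: Schur_j_def End_H_def dsum_zero)

lemma Schur_j_add: "f \<in> Schur_j n \<Longrightarrow> g \<in> Schur_j n \<Longrightarrow> f + g \<in> Schur_j n"
  unfolding Schur_j_def End_H_def mem_Collect_eq
  by (auto simp: dsum_add distrib_right)

lemma Schur_j_scale: "f \<in> Schur_j n \<Longrightarrow> end_scale a f \<in> Schur_j n"
  unfolding Schur_j_def End_H_def mem_Collect_eq end_scale_def
  by (auto simp: dsum_iff range_xx_scale scale_right_distrib scale_mult_left)

lemma Schur_j_sum: "(\<And>i. i \<in> I \<Longrightarrow> f i \<in> Schur_j n) \<Longrightarrow> sum f I \<in> Schur_j n"
  by (induction I rule: infinite_finite_induct) (auto simp: Schur_j_zero Schur_j_add)

lemma component_add: "component (f + g) l m = component f l m + component g l m"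
  by (simp add: component_def)

lemma component_scale: "component (end_scale a f) l m = scale a (component f l m)"
  by (simp add: component_def end_scale_def)

subsection \<open>Coordinates\<close>

text \<open>The coefficient of \<open>std n A\<close> in the expansion of \<open>f\<close>; the monomial undoes the
  normalization.\<close>

definition coord :: "nat \<Rightarrow> 'h endo \<Rightarrow> mat \<Rightarrow> lau2" where
  "coord n f A = (case the_inv_into (triples n d) kappa A of (l, g, m) \<Rightarrow>
     mon (lhat_c n A) (lhat_a n A) * coef (component f l m) g)"

lemma coord_kappa: "(l, g, m) \<in> triples n d \<Longrightarrow> coord n f (kappa (l, g, m)) =
    mon (lhat_c n (kappa (l, g, m))) (lhat_a n (kappa (l, g, m))) * coef (component f l m) g"
  by (simp add: coord_def inv_kappa)

lemma coord_add: "coord n (f + g) A = coord n f A + coord n g A"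
  by (simp add: coord_def component_add coef_add distrib_left split: prod.split)

lemma coord_scale: "coord n (end_scale a f) A = a * coord n f A"
  by (simp add: coord_def component_scale coef_scale mult.left_commute split: prod.split)

lemma coord_zero [simp]: "coord n 0 A = 0"
  by (simp add: coord_def component_def split: prod.split)

lemma coord_sum: "coord n (sum f I) A = (\<Sum>i\<in>I. coord n (f i) A)"
proof (induction I rule: infinite_finite_induct)
  case (insert i I)
  show ?case unfolding sum.insert[OF insert(1,2)] coord_add insert(3) ..
next
  case (infinite I)
  show ?case unfolding sum.infinite[OF infinite] by (rule coord_zero)
qed (simp only: sum.empty coord_zero)

lemma mon_cancel: "mon a b * x = mon a b * y \<longleftrightarrow> x = y"
proof
  assume "mon a b * x = mon a b * y"
  then have "mon (- a) (- b) * mon a b * x = mon (- a) (- b) * mon a b * y" by (simp only: mult.assoc)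
  then show "x = y" by simp
qed simp

text \<open>Components have constant coefficients on double cosets, and each double coset contains a
  minimal representative.\<close>

lemma coord_eqI:
  assumes f: "f \<in> Schur_j n" "f' \<in> Schur_j n"
    and eq: "\<And>A. A \<in> Xi n d \<Longrightarrow> coord n f A = coord n f' A"
  shows "f = f'"
proof (rule Schur_j_eqI[OF f], rule hecke_eqI)
  fix l m w assume lm: "l \<in> Lam n d" "m \<in> Lam n d" and w: "w \<in> weyl d"
  obtain g where g: "g \<in> min_reps d l m" "double_coset d l g m = double_coset d l w m"
    using ex_min_rep[OF w] by blast
  have gw: "g \<in> weyl d" using g min_reps_weyl by blast
  have t: "(l, g, m) \<in> triples n d" using lm g by (simp add: triples_def)
  have "w \<in> double_coset d l g m" using g double_coset_self by metis
  then have "coef (component F l m) w = coef (component F l m) g" if "F \<in> Schur_j n" for F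
    by (rule invariant_coef[OF lm component_invariant[OF that lm] gw])
  moreover have "coef (component f l m) g = coef (component f' l m) g"
    using eq[OF kappa_Xi[OF lm gw]] by (simp add: coord_kappa[OF t] mon_cancel)
  ultimately show "coef (component f l m) w = coef (component f' l m) w" using f by simp
qed

lemma e_mat:
  assumes t: "(l, g, m) \<in> triples n d"
  shows "e_mat n (kappa (l, g, m)) \<in> Schur_j n"
    and "k \<in> Lam n d \<Longrightarrow> component (e_mat n (kappa (l, g, m))) l' k =
      (if k = m \<and> l' = l then coset_sum l g m else 0)"
proof -
  let ?P = "\<lambda>f. f \<in> Schur_j n \<and> (\<forall>k\<in>Lam n d. f (inj_at k (xx k)) =
      (if k = m then inj_at l (\<Sum>w\<in>double_coset d l g m. T w) else 0))"
  have lm: "l \<in> Lam n d" "m \<in> Lam n d" "g \<in> weyl d"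
    using t min_reps_weyl by (auto simp: triples_def)
  let ?Z = "\<lambda>l' m'. if l' = l \<and> m' = m then coset_sum l g m else 0"
  have "left_invariant l' (?Z l' m') \<and> right_invariant m' (?Z l' m')" for l' m'
    using coset_sum_invariant[OF lm(3)] by (auto simp: left_invariant_def right_invariant_def)
  then obtain f where f: "f \<in> Schur_j n"
    "\<And>k. k \<in> Lam n d \<Longrightarrow> f (inj_at k (xx k)) = (\<lambda>l'. if l' \<in> Lam n d then ?Z l' k else 0)"
    using Schur_j_exists[of n ?Z] by blast
  have Pf: "?P f"
    using f lm by (auto simp: inj_at_def coset_sum_def)
  have uniq: "f' = f" if "?P f'" for f'
    by (rule End_H_eqI[where X = "Lam n d"]) (use that Pf in \<open>auto simp: Schur_j_def\<close>)
  have "e_mat n (kappa (l, g, m)) = (THE f. ?P f)"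
    by (simp add: e_mat_def inv_kappa[OF t])
  also have "\<dots> = f" using Pf uniq by (rule the_equality)
  finally have e: "e_mat n (kappa (l, g, m)) = f" .
  show "e_mat n (kappa (l, g, m)) \<in> Schur_j n" using e f by simp
  show "component (e_mat n (kappa (l, g, m))) l' k = (if k = m \<and> l' = l then coset_sum l g m else 0)"
    if "k \<in> Lam n d"
    unfolding e component_def f(2)[OF that] using lm by auto
qed

lemma std_Schur_j: "A \<in> Xi n d \<Longrightarrow> std n A \<in> Schur_j n"
  by (elim Xi_triple) (simp add: std_def Schur_j_scale e_mat(1))

lemma component_std:
  assumes t: "(l, g, m) \<in> triples n d" and "k \<in> Lam n d"
  shows "component (std n (kappa (l, g, m))) l' k = (if k = m \<and> l' = l then
    scale (mon (- lhat_c n (kappa (l, g, m))) (- lhat_a n (kappa (l, g, m)))) (coset_sum l g m) else 0)"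
  using e_mat(2)[OF t assms(2)] by (simp add: std_def component_scale)

lemma coord_std:
  assumes A: "A \<in> Xi n d" and B: "B \<in> Xi n d"
  shows "coord n (std n A) B = (if B = A then 1 else 0)"
proof -
  obtain l g m where lgm: "(l, g, m) \<in> triples n d" "A = kappa (l, g, m)"
    "l \<in> Lam n d" "m \<in> Lam n d" "g \<in> min_reps d l m" "g \<in> weyl d" by (rule Xi_triple[OF A])
  obtain l' g' m' where lgm': "(l', g', m') \<in> triples n d" "B = kappa (l', g', m')"
    "l' \<in> Lam n d" "m' \<in> Lam n d" "g' \<in> min_reps d l' m'" "g' \<in> weyl d" by (rule Xi_triple[OF B])
  show ?thesis
  proof (cases "l' = l \<and> m' = m")
    case False
    then have "A \<noteq> B" using lgm lgm' inv_kappa by (metis prod.inject)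
    with False show ?thesis
      unfolding lgm'(2) coord_kappa[OF lgm'(1)] lgm(2) component_std[OF lgm(1) lgm'(4)] by auto
  next
    case True
    have "g' \<in> double_coset d l g m \<longleftrightarrow> g' = g"
    proof
      assume "g' \<in> double_coset d l g m"
      then have "kappa (l, g', m) = kappa (l, g, m)" by (rule kappa_double_coset[OF lgm(3,4,6)])
      then show "g' = g" using min_reps_kappa_inj[OF lgm(3,4) _ lgm(5)] lgm'(5) True by blast
    qed (simp add: double_coset_self)
    moreover have "g' = g \<longleftrightarrow> B = A"
      using lgm lgm' True inv_kappa by (metis prod.inject)
    ultimately show ?thesis
      unfolding lgm'(2) coord_kappa[OF lgm'(1)]
      using True lgm(2) component_std[OF lgm(1) lgm'(4), of l']
      by (auto simp: coef_scale coef_coset_sum[OF lgm(6) lgm'(6)])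
  qed
qed

lemma std_expansion:
  assumes f: "f \<in> Schur_j n"
  shows "f = (\<Sum>A\<in>Xi n d. end_scale (coord n f A) (std n A))"
proof (rule coord_eqI[OF f])
  show "(\<Sum>A\<in>Xi n d. end_scale (coord n f A) (std n A)) \<in> Schur_j n"
    by (intro Schur_j_sum Schur_j_scale std_Schur_j)
  fix B assume B: "B \<in> Xi n d"
  have "coord n (\<Sum>A\<in>Xi n d. end_scale (coord n f A) (std n A)) B =
      (\<Sum>A\<in>Xi n d. if A = B then coord n f B else 0)"
    unfolding coord_sum coord_scale by (rule sum.cong) (auto simp: coord_std B)
  then show "coord n f B = coord n (\<Sum>A\<in>Xi n d. end_scale (coord n f A) (std n A)) B"
    using B finite_Xi by simp
qed

subsection \<open>The bar involution of the Schur algebra\<close>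

definition max_rep :: "(nat \<Rightarrow> nat) \<Rightarrow> int \<Rightarrow> int" where
  "max_rep m = (SOME h. h \<in> max_reps d m id m)"

lemma max_rep: "max_rep m \<in> max_reps d m id m"
  unfolding max_rep_def using ex_max_rep[OF weyl_id] by (rule someI_ex)

text \<open>As \<open>xx m\<close> is bar invariant up to a unit, conjugation of a map is conjugation of its components
  up to a unit that depends on the source only.\<close>

lemma sbar:
  assumes f: "f \<in> Schur_j n"
  shows "sbar n f \<in> Schur_j n"
    and "l \<in> Lam n d \<Longrightarrow> m \<in> Lam n d \<Longrightarrow>
      component (sbar n f) l m = scale (lau_bar (bar_lead d (max_rep m))) (hbar (component f l m))"
proof -
  let ?P = "\<lambda>g. g \<in> Schur_j n \<and> (\<forall>m\<in>Lam n d.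
     g (inj_at m (xx m)) = (\<lambda>l. hbar (f (inj_at m (hbar (xx m))) l)))"
  let ?Z = "\<lambda>l m. scale (lau_bar (bar_lead d (max_rep m))) (hbar (component f l m))"
  have val: "hbar (f (inj_at m (hbar (xx m))) l) = ?Z l m" if m: "m \<in> Lam n d" for l m
    unfolding hbar_xx[OF m max_rep] Schur_scale_arg[OF f m] by (simp add: hbar_scale)
  have scale: "left_invariant l z \<Longrightarrow> left_invariant l (scale a z)" "right_invariant m z \<Longrightarrow> right_invariant m (scale a z)" for l m z a
    by (auto simp: left_invariant_def right_invariant_def scale_mult_left[symmetric] scale_mult_right[symmetric] mult.commute)
  have "left_invariant l (?Z l m) \<and> right_invariant m (?Z l m)" if "l \<in> Lam n d" "m \<in> Lam n d" for l m
    using component_invariant[OF f that] by (intro conjI scale left_invariant_hbar right_invariant_hbar)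
  then obtain g where g: "g \<in> Schur_j n"
    "\<And>m. m \<in> Lam n d \<Longrightarrow> g (inj_at m (xx m)) = (\<lambda>l. if l \<in> Lam n d then ?Z l m else 0)"
    using Schur_j_exists[of n ?Z] by blast
  have Pg: "?P g"
    using g val component_outside[OF f] by (auto simp: fun_eq_iff)
  have uniq: "g' = g" if "?P g'" for g'
    by (rule End_H_eqI[where X = "Lam n d"]) (use that Pg in \<open>auto simp: Schur_j_def\<close>)
  have e: "sbar n f = g" unfolding sbar_def using Pg uniq by (rule the_equality)
  show "sbar n f \<in> Schur_j n" using e g by simp
  show "component (sbar n f) l m = ?Z l m" if "l \<in> Lam n d" "m \<in> Lam n d"
    unfolding e component_def using g(2)[OF that(2)] that by (simp add: component_def)
qed

lemma sbar_add:
  assumes "f \<in> Schur_j n" "g \<in> Schur_j n"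
  shows "sbar n (f + g) = sbar n f + sbar n g"
  by (rule Schur_j_eqI[of _ n])
    (use assms in \<open>auto simp: sbar Schur_j_add component_add hbar_add scale_right_distrib\<close>)

lemma sbar_scale:
  assumes "f \<in> Schur_j n"
  shows "sbar n (end_scale a f) = end_scale (lau_bar a) (sbar n f)"
  by (rule Schur_j_eqI[of _ n])
    (use assms in \<open>auto simp: sbar Schur_j_scale component_scale hbar_scale mult.commute\<close>)

lemma bar_lead_bar: "bar_lead d w * lau_bar (bar_lead d w) = 1" "lau_bar (bar_lead d w) * bar_lead d w = 1"
  by (simp_all add: bar_lead_def)

lemma sbar_sbar:
  assumes "f \<in> Schur_j n"
  shows "sbar n (sbar n f) = f"
  by (rule Schur_j_eqI[of _ n])
    (use assms in \<open>auto simp: sbar hbar_scale bar_lead_bar\<close>)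

lemma sbar_zero: "sbar n 0 = 0"
  using sbar_add[OF Schur_j_zero Schur_j_zero, of n] by simp

lemma sbar_sum:
  assumes "finite I" "\<And>i. i \<in> I \<Longrightarrow> f i \<in> Schur_j n"
  shows "sbar n (sum f I) = (\<Sum>i\<in>I. sbar n (f i))"
  using assms by (induction I) (auto simp: sbar_zero sbar_add Schur_j_sum)

definition bar_matrix :: "nat \<Rightarrow> mat \<Rightarrow> mat \<Rightarrow> lau2" where
  "bar_matrix n A B = coord n (sbar n (std n A)) B"

lemma coord_sbar:
  assumes f: "f \<in> Schur_j n"
  shows "coord n (sbar n f) B = (\<Sum>A\<in>Xi n d. lau_bar (coord n f A) * bar_matrix n A B)"
proof -
  have "sbar n f = sbar n (\<Sum>A\<in>Xi n d. end_scale (coord n f A) (std n A))"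
    by (rule arg_cong[OF std_expansion[OF f]])
  also have "\<dots> = (\<Sum>A\<in>Xi n d. sbar n (end_scale (coord n f A) (std n A)))"
    by (rule sbar_sum[OF finite_Xi Schur_j_scale[OF std_Schur_j]])
  also have "\<dots> = (\<Sum>A\<in>Xi n d. end_scale (lau_bar (coord n f A)) (sbar n (std n A)))"
    by (intro sum.cong refl sbar_scale std_Schur_j)
  finally show ?thesis by (simp add: coord_sum coord_scale bar_matrix_def)
qed

text \<open>The exponents in \<open>std n A\<close> are chosen such that the diagonal entries of the bar involution
  become \<open>1\<close>: the factor \<open>bar_lead d h\<close> from the bar conjugate of the double coset sum and the inverse
  of the factor from \<open>hbar (xx m)\<close> are compensated by twice these exponents.\<close>

lemma bar_matrix_triangular:
  assumes A: "A \<in> Xi n d" and B: "B \<in> Xi n d"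
  shows "bar_matrix n A A = 1" "bar_matrix n A B \<noteq> 0 \<Longrightarrow> B = A \<or> less_alg n B A"
proof -
  obtain l g m where lgm: "(l, g, m) \<in> triples n d" "A = kappa (l, g, m)"
    "l \<in> Lam n d" "m \<in> Lam n d" "g \<in> min_reps d l m" "g \<in> weyl d" by (rule Xi_triple[OF A])
  obtain h where h: "h \<in> max_reps d l g m" using ex_max_rep[OF lgm(6)] by blast
  have comp: "component (sbar n (std n A)) l' k = (if k = m \<and> l' = l then
      scale (lau_bar (bar_lead d (max_rep m)) * mon (lhat_c n A) (lhat_a n A)) (hbar (coset_sum l g m)) else 0)"
    if "k \<in> Lam n d" "l' \<in> Lam n d" for l' k
    using component_std[OF lgm(1) that(1), of l'] sbar(2)[OF std_Schur_j[OF A] that(2,1)]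
    by (simp add: lgm(2)[symmetric] hbar_scale)
  note lhat = lhat_max_rep[OF lgm(3,4,6) h max_rep, folded lgm(2)]
  have "bar_matrix n A A = mon (lhat_c n A) (lhat_a n A) *
      (lau_bar (bar_lead d (max_rep m)) * mon (lhat_c n A) (lhat_a n A) * bar_lead d h)"
    unfolding bar_matrix_def
    using coord_kappa[OF lgm(1), of "sbar n (std n A)"] comp[OF lgm(4,3)] hbar_coset_sum(1)[OF lgm(3,4,6) h]
    by (simp add: lgm(2)[symmetric] coef_scale)
  also have "\<dots> = 1" by (simp add: bar_lead_def lhat lhat_a_def)
  finally show "bar_matrix n A A = 1" .
  assume nz: "bar_matrix n A B \<noteq> 0"
  obtain l' g' m' where lgm': "(l', g', m') \<in> triples n d" "B = kappa (l', g', m')"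
    "l' \<in> Lam n d" "m' \<in> Lam n d" "g' \<in> min_reps d l' m'" "g' \<in> weyl d" by (rule Xi_triple[OF B])
  have "coef (component (sbar n (std n A)) l' m') g' \<noteq> 0"
    using nz coord_kappa[OF lgm'(1), of "sbar n (std n A)"]
    unfolding bar_matrix_def lgm'(2) by auto
  then have "l' = l" "m' = m" "coef (hbar (coset_sum l g m)) g' \<noteq> 0"
    unfolding comp[OF lgm'(4,3)] by (auto split: if_splits simp: coef_scale)
  then have "le_alg n B A"
    using hbar_coset_sum(2)[OF lgm(3,4,6) h lgm'(6)] lgm(2) lgm'(2) by simp
  then show "B = A \<or> less_alg n B A" by (auto simp: less_alg_def)
qed

lemma bar_matrix_involution:
  assumes A: "A \<in> Xi n d" and C: "C \<in> Xi n d"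
  shows "(\<Sum>B\<in>Xi n d. lau_bar (bar_matrix n A B) * bar_matrix n B C) = (if A = C then 1 else 0)"
  using coord_sbar[OF sbar(1)[OF std_Schur_j[OF A]], of C] coord_std[OF A C]
    sbar_sbar[OF std_Schur_j[OF A]]
  by (auto simp: bar_matrix_def)

subsection \<open>The smaller Schur algebra\<close>

text \<open>The indices in \<open>Xi_i n d\<close> are those with source and target in \<open>Lam_i n d\<close>. A map without
  other components only depends on the summands in \<open>Lam_i n d\<close> and has values there.\<close>

lemma Schur_i_iff:
  "f \<in> Schur_i n \<longleftrightarrow> f \<in> Schur_j n \<and> (\<forall>A\<in>Xi n d. A \<notin> Xi_i n d \<longrightarrow> coord n f A = 0)"
proof
  let ?L = "Lam n d" and ?K = "Lam_i n d"
  have KL: "?K \<subseteq> ?L" by (auto simp: Lam_i_def)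
  let ?r = "\<lambda>p l. if l \<in> ?K then p l else 0"
  have r: "?r p \<in> dsum ?K" if "p \<in> dsum ?L" for p
    using that KL by (auto simp: dsum_iff)
  {
    assume "f \<in> Schur_i n"
    then obtain f' where f': "f' \<in> End_H ?K" "f = extend_end n f'" by (auto simp: Schur_i_def)
    have f: "f p = (if p \<in> dsum ?L then f' (?r p) else 0)" for p
      by (simp add: f' extend_end_def)
    have fj: "f \<in> Schur_j n"
      unfolding Schur_j_def End_H_def mem_Collect_eq
    proof (intro conjI ballI allI impI)
      fix p assume p: "p \<in> dsum ?L"
      show "f p \<in> dsum ?L"
        using p End_HD(1)[OF f'(1) r[OF p]] dsum_mono[OF KL] by (auto simp: f)
      have "?r (\<lambda>l. p l * x) = (\<lambda>l. ?r p l * x)" for x by auto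
      then show "f (\<lambda>l. p l * x) = (\<lambda>l. f p l * x)" for x
        using p dsum_mult[OF p] End_HD(3)[OF f'(1) r[OF p], of x] by (simp add: f)
      fix p' assume p': "p' \<in> dsum ?L"
      have "?r (p + p') = ?r p + ?r p'" by auto
      then show "f (p + p') = f p + f p'"
        using p p' dsum_add[OF p p'] End_HD(2)[OF f'(1) r[OF p] r[OF p']] by (simp add: f)
    qed (simp add: f)
    have "coord n f A = 0" if A: "A \<in> Xi n d" "A \<notin> Xi_i n d" for A
    proof -
      obtain l g m where lgm: "(l, g, m) \<in> triples n d" "A = kappa (l, g, m)"
        "l \<in> Lam n d" "m \<in> Lam n d" "g \<in> min_reps d l m" "g \<in> weyl d" by (rule Xi_triple[OF A(1)])
      have "component f l m = 0"
      proof (cases "m \<in> ?K")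
        case True
        then have "l \<notin> ?K" using A(2) kappa_Xi_i[OF lgm(3,4,6)] lgm(2) by blast
        moreover have "f (inj_at m (xx m)) \<in> dsum ?K"
          using End_HD(1)[OF f'(1) r[OF generator_dsum[OF lgm(4)]]] generator_dsum[OF lgm(4)]
          by (simp add: f)
        ultimately show ?thesis by (simp add: component_def dsum_iff)
      next
        case False
        then have "?r (inj_at m (xx m)) = 0" by (auto simp: inj_at_def)
        then show ?thesis using End_H_zero[OF f'(1)] by (simp add: component_def f)
      qed
      then show ?thesis unfolding lgm(2) coord_kappa[OF lgm(1)] by simp
    qed
    with fj show "f \<in> Schur_j n \<and> (\<forall>A\<in>Xi n d. A \<notin> Xi_i n d \<longrightarrow> coord n f A = 0)" by blast
  }
  assume "f \<in> Schur_j n \<and> (\<forall>A\<in>Xi n d. A \<notin> Xi_i n d \<longrightarrow> coord n f A = 0)"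
  then have fj: "f \<in> Schur_j n" and z: "\<And>A. A \<in> Xi n d \<Longrightarrow> A \<notin> Xi_i n d \<Longrightarrow> coord n f A = 0" by auto
  note fE = fj[unfolded Schur_j_def]
  have comp0: "component f l m = 0" if lm: "l \<in> ?L" "m \<in> ?L" "l \<notin> ?K \<or> m \<notin> ?K" for l m
  proof (rule hecke_eqI)
    fix w assume w: "w \<in> weyl d"
    obtain g where g: "g \<in> min_reps d l m" "double_coset d l g m = double_coset d l w m"
      using ex_min_rep[OF w] by blast
    have gw: "g \<in> weyl d" using g min_reps_weyl by blast
    have t: "(l, g, m) \<in> triples n d" using lm g by (simp add: triples_def)
    have "w \<in> double_coset d l g m" using g double_coset_self by metis
    then have "coef (component f l m) w = coef (component f l m) g"
      by (rule invariant_coef[OF lm(1,2) component_invariant[OF fj lm(1,2)] gw])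
    moreover have "coord n f (kappa (l, g, m)) = 0"
      using z[OF kappa_Xi[OF lm(1,2) gw]] kappa_Xi_i[OF lm(1,2) gw] lm(3) by blast
    then have "coef (component f l m) g = 0"
      using mon_cancel[of _ _ "coef (component f l m) g" 0] by (simp add: coord_kappa[OF t])
    ultimately show "coef (component f l m) w = coef 0 w" by simp
  qed
  have eval: "f p = f (?r p)" "f p \<in> dsum ?K" if p: "p \<in> dsum ?L" for p
  proof -
    have "\<forall>l\<in>?L. \<exists>h. p l = xx l * h" using p by (auto simp: dsum_iff)
    then obtain h where h: "\<And>l. l \<in> ?L \<Longrightarrow> p l = xx l * h l" by metis
    have po: "\<And>l. l \<notin> ?L \<Longrightarrow> p l = 0" using p by (simp add: dsum_iff)
    have 1: "f p k = (\<Sum>l\<in>?L. component f k l * h l)" for k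
      unfolding component_def by (rule End_H_eval[OF fE finite_Lam h po])
    have 2: "f (?r p) k = (\<Sum>l\<in>?L. component f k l * (if l \<in> ?K then h l else 0))" for k
      unfolding component_def
      by (rule End_H_eval[OF fE finite_Lam]) (use h po KL in auto)
    have out: "component f k l = 0" if "l \<in> ?L" "k \<notin> ?K \<or> l \<notin> ?K" for k l
      using that comp0[of k l] component_outside[OF fj that(1), of k] by (cases "k \<in> ?L") auto
    show "f p = f (?r p)"
      unfolding fun_eq_iff 1 2 by (intro allI sum.cong) (auto simp: out)
    have "f p \<in> dsum ?L" using End_HD(1)[OF fE p] .
    moreover have "f p k = 0" if "k \<notin> ?K" for k
      unfolding 1 using out that by (intro sum.neutral) auto
    ultimately show "f p \<in> dsum ?K" using KL by (auto simp: dsum_iff)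
  qed
  define f' where "f' p = (if p \<in> dsum ?K then f p else 0)" for p
  have sub: "p \<in> dsum ?L" if "p \<in> dsum ?K" for p using dsum_mono[OF KL] that by blast
  have "f' \<in> End_H ?K"
    unfolding End_H_def mem_Collect_eq
  proof (intro conjI ballI allI impI)
    fix p assume p: "p \<in> dsum ?K"
    show "f' p \<in> dsum ?K" using p eval(2)[OF sub[OF p]] by (simp add: f'_def)
    show "f' (\<lambda>l. p l * x) = (\<lambda>l. f' p l * x)" for x
      using p dsum_mult[OF p] End_HD(3)[OF fE sub[OF p]] by (simp add: f'_def)
    fix p' assume p': "p' \<in> dsum ?K"
    show "f' (p + p') = f' p + f' p'"
      using p p' dsum_add[OF p p'] End_HD(2)[OF fE sub[OF p] sub[OF p']] by (simp add: f'_def)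
  qed (simp add: f'_def)
  moreover have "f = extend_end n f'"
  proof
    fix p show "f p = extend_end n f' p"
      using eval(1)[of p] r[of p] End_HD(4)[OF fE, of p] by (auto simp: extend_end_def f'_def)
  qed
  ultimately show "f \<in> Schur_i n" by (auto simp: Schur_i_def)
qed

end

section \<open>Specialization\<close>

context hecke_algebra
begin

context
  fixes n :: nat and L :: "(int \<Rightarrow> int) \<Rightarrow> nat"
begin

definition phi :: "lau2 \<Rightarrow> lau1" where
  "phi = lau_spec (L (sgen 0)) (L (sgen 1))"

abbreviation "scalars \<equiv> lau_sub (wt_gcd L)"
abbreviation "rel \<equiv> bc_rel (Schur_j n) end_scale phi scalars"
abbreviation "formal \<equiv> bc_free (Schur_j n) scalars"

lemma phi_hom:
  "phi (a + b) = phi a + phi b" "phi (a * b) = phi a * phi b" "phi (sum f I) = (\<Sum>i\<in>I. phi (f i))"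
  "phi (lau_bar a) = lau_bar (phi a)" "phi 0 = 0" "phi 1 = 1"
  unfolding phi_def
  by (rule lau_spec_add lau_spec_mult lau_spec_sum lau_spec_lau_bar lau_spec_zero lau_spec_one)+

lemma phi_scalars: "phi p \<in> scalars"
  unfolding wt_gcd_def phi_def by (rule lau_spec_in_lau_sub)

text \<open>The specialized coordinates of a formal combination. They vanish on the relations of the base
  change, and every formal combination is congruent to the combination of the elements
  \<open>std n A\<close> with these coordinates. This identifies the specialized algebra with the free
  module on \<open>Xi n d\<close>.\<close>

definition scoord :: "('h endo \<Rightarrow>\<^sub>0 lau1) \<Rightarrow> mat \<Rightarrow> lau1" where
  "scoord h A = (\<Sum>x\<in>Poly_Mapping.keys h. Poly_Mapping.lookup h x * phi (coord n x A))"

lemma scoord_superset: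
  assumes "finite K" "Poly_Mapping.keys h \<subseteq> K"
  shows "scoord h A = (\<Sum>x\<in>K. Poly_Mapping.lookup h x * phi (coord n x A))"
  unfolding scoord_def using assms by (intro sum.mono_neutral_left) (auto simp: in_keys_iff)

lemma scoord_add: "scoord (h + h') A = scoord h A + scoord h' A"
proof -
  let ?K = "Poly_Mapping.keys h \<union> Poly_Mapping.keys h'"
  have "Poly_Mapping.keys (h + h') \<subseteq> ?K" by (rule Poly_Mapping.keys_add)
  then show ?thesis
    by (simp add: scoord_superset[of ?K] lookup_add distrib_right sum.distrib)
qed

lemma scoord_zero: "scoord 0 A = 0"
  by (simp add: scoord_def)

lemma scoord_sum: "scoord (sum f I) A = (\<Sum>i\<in>I. scoord (f i) A)"
  by (induction I rule: infinite_finite_induct) (auto simp: scoord_zero scoord_add)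

lemma scoord_diff: "scoord (h - h') A = scoord h A - scoord h' A"
  using scoord_add[of "h - h'" h' A] by simp

lemma scoord_single: "scoord (Poly_Mapping.single x c) A = c * phi (coord n x A)"
  by (simp add: scoord_superset[of "{x}"])

lemma scoord_rel: "h \<in> rel \<Longrightarrow> scoord h A = 0"
proof (induction rule: bc_rel.induct)
  case (add x y c)
  show ?case by (simp add: scoord_diff scoord_single coord_add phi_hom distrib_left)
next
  case (smul x c a)
  show ?case by (simp add: scoord_diff scoord_single coord_scale phi_hom mult.assoc)
next
  case (diff h h')
  then show ?case by (simp add: scoord_diff)
qed

lemma scoord_scalars: "h \<in> formal \<Longrightarrow> scoord h A \<in> scalars"
  unfolding scoord_def bc_free_def by (intro lau_sub_sum lau_sub_mult phi_scalars) auto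

lemma formal_single: "x \<in> Schur_j n \<Longrightarrow> c \<in> scalars \<Longrightarrow> Poly_Mapping.single x c \<in> formal"
  by (auto simp: bc_free_def lookup_single when_def)

lemma bc_free_add: "h \<in> bc_free S (lau_sub c) \<Longrightarrow> h' \<in> bc_free S (lau_sub c) \<Longrightarrow>
    h + h' \<in> bc_free S (lau_sub c)"
  using Poly_Mapping.keys_add[of h h'] by (auto simp: bc_free_def lookup_add lau_sub_add)

lemma bc_free_sum: "(\<And>i. i \<in> I \<Longrightarrow> f i \<in> bc_free S (lau_sub c)) \<Longrightarrow> sum f I \<in> bc_free S (lau_sub c)"
proof (induction I rule: infinite_finite_induct)
  case (insert i I)
  then show ?case by (simp add: bc_free_add)
qed (simp_all add: bc_free_def)

lemma rel_diff: "h \<in> rel \<Longrightarrow> h' \<in> rel \<Longrightarrow> h - h' \<in> rel"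
  by (rule bc_rel.diff)

lemma rel_zero: "0 \<in> rel"
proof -
  let ?h = "Poly_Mapping.single (0 + 0 :: 'h endo) (0::lau1) - Poly_Mapping.single 0 0 - Poly_Mapping.single 0 0"
  have "?h \<in> rel" by (rule bc_rel.add) (auto simp: Schur_j_zero)
  from rel_diff[OF this this] show ?thesis by simp
qed

lemma rel_add: "h \<in> rel \<Longrightarrow> h' \<in> rel \<Longrightarrow> h + h' \<in> rel"
  using rel_diff[of h "0 - h'"] rel_diff[OF rel_zero, of h'] by simp

lemma rel_sum: "(\<And>i. i \<in> I \<Longrightarrow> f i \<in> rel) \<Longrightarrow> sum f I \<in> rel"
  by (induction I rule: infinite_finite_induct) (auto simp: rel_zero rel_add)

lemma rel_single_sum:
  assumes "finite I" "\<And>i. i \<in> I \<Longrightarrow> f i \<in> Schur_j n" and c: "c \<in> scalars"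
  shows "Poly_Mapping.single (sum f I) c - (\<Sum>i\<in>I. Poly_Mapping.single (f i) c) \<in> rel"
  using assms(1,2)
proof (induction I)
  case empty
  have "Poly_Mapping.single (0 + 0 :: 'h endo) c - Poly_Mapping.single 0 c - Poly_Mapping.single 0 c \<in> rel"
    using c by (intro bc_rel.add Schur_j_zero)
  moreover have "0 - (x - x - x) = x" for x :: "'h endo \<Rightarrow>\<^sub>0 lau1" by simp
  ultimately show ?case using rel_diff[OF rel_zero] unfolding sum.empty add_0_left diff_zero by metis
next
  case (insert i I)
  have 1: "Poly_Mapping.single (f i + sum f I) c - Poly_Mapping.single (f i) c
      - Poly_Mapping.single (sum f I) c \<in> rel"
    using insert(4) c by (intro bc_rel.add Schur_j_sum) auto
  have 2: "Poly_Mapping.single (sum f I) c - (\<Sum>i\<in>I. Poly_Mapping.single (f i) c) \<in> rel"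
    using insert by blast
  have eq: "(x - a - y) + (y - z) = x - (a + z)" for x a y z :: "'h endo \<Rightarrow>\<^sub>0 lau1"
    by (simp add: algebra_simps)
  show ?case
    using rel_add[OF 1 2] unfolding eq sum.insert[OF insert(1,2)] .
qed

definition normal_form :: "(mat \<Rightarrow> lau1) \<Rightarrow> ('h endo \<Rightarrow>\<^sub>0 lau1)" where
  "normal_form p = (\<Sum>A\<in>Xi n d. Poly_Mapping.single (std n A) (p A))"

lemma normal_form_formal: "(\<And>A. A \<in> Xi n d \<Longrightarrow> p A \<in> scalars) \<Longrightarrow> normal_form p \<in> formal"
  unfolding normal_form_def by (intro bc_free_sum formal_single std_Schur_j)

lemma scoord_normal_form: "A \<in> Xi n d \<Longrightarrow> scoord (normal_form p) A = p A"
proof -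
  assume A: "A \<in> Xi n d"
  have "scoord (normal_form p) A = (\<Sum>B\<in>Xi n d. if B = A then p A else 0)"
    unfolding normal_form_def scoord_sum scoord_single
    by (rule sum.cong) (auto simp: coord_std A phi_hom)
  then show ?thesis using A finite_Xi by simp
qed

lemma normal_form_single:
  assumes x: "x \<in> Schur_j n" and c: "c \<in> scalars"
  shows "Poly_Mapping.single x c - normal_form (\<lambda>A. c * phi (coord n x A)) \<in> rel"
proof -
  let ?f = "\<lambda>A. end_scale (coord n x A) (std n A)"
  have 1: "Poly_Mapping.single (\<Sum>A\<in>Xi n d. ?f A) c - (\<Sum>A\<in>Xi n d. Poly_Mapping.single (?f A) c) \<in> rel"
    by (rule rel_single_sum[OF finite_Xi _ c]) (rule Schur_j_scale[OF std_Schur_j])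
  have 2: "(\<Sum>A\<in>Xi n d. Poly_Mapping.single (?f A) c - Poly_Mapping.single (std n A) (c * phi (coord n x A))) \<in> rel"
    by (intro rel_sum bc_rel.smul std_Schur_j c)
  show ?thesis
    using rel_add[OF 1 2]
    unfolding std_expansion[OF x, symmetric] sum_subtractf normal_form_def by simp
qed

lemma normal_form_congruent:
  assumes h: "h \<in> formal"
  shows "h - normal_form (scoord h) \<in> rel"
proof -
  let ?K = "Poly_Mapping.keys h" and ?l = "Poly_Mapping.lookup h"
  have "(\<Sum>x\<in>?K. Poly_Mapping.single x (?l x) - normal_form (\<lambda>A. ?l x * phi (coord n x A))) \<in> rel"
    using h by (intro rel_sum normal_form_single) (auto simp: bc_free_def)
  moreover have "(\<Sum>x\<in>?K. normal_form (\<lambda>A. ?l x * phi (coord n x A))) = normal_form (scoord h)"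
  proof -
    have s: "(\<Sum>x\<in>K. Poly_Mapping.single k (g x)) = Poly_Mapping.single k (sum g K)"
      for K and k :: "'h endo" and g :: "'h endo \<Rightarrow> lau1"
      by (induction K rule: infinite_finite_induct) (auto simp: single_add)
    show ?thesis
      unfolding normal_form_def scoord_def by (subst sum.swap) (simp only: s)
  qed
  ultimately show ?thesis
    by (simp only: sum_subtractf poly_mapping_sum_single)
qed

lemma rel_iff:
  assumes h: "h \<in> formal" "h' \<in> formal"
  shows "h - h' \<in> rel \<longleftrightarrow> (\<forall>A\<in>Xi n d. scoord h A = scoord h' A)"
proof
  assume "h - h' \<in> rel"
  then show "\<forall>A\<in>Xi n d. scoord h A = scoord h' A"
    using scoord_rel[of "h - h'"] by (simp add: scoord_diff)
next
  assume "\<forall>A\<in>Xi n d. scoord h A = scoord h' A"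
  then have eq: "normal_form (scoord h) = normal_form (scoord h')"
    unfolding normal_form_def by (intro sum.cong) auto
  show "h - h' \<in> rel"
    using rel_diff[OF normal_form_congruent[OF h(1)] normal_form_congruent[OF h(2)]] by (simp add: eq)
qed

lemma spec_class_eq:
  "h \<in> formal \<Longrightarrow> spec_class n L h = {h' \<in> formal. \<forall>A\<in>Xi n d. scoord h' A = scoord h A}"
  unfolding spec_class_def bc_class_def phi_def[symmetric] using rel_iff by blast

lemma spec_class_eq_iff:
  assumes "h \<in> formal" "h' \<in> formal"
  shows "spec_class n L h = spec_class n L h' \<longleftrightarrow> (\<forall>A\<in>Xi n d. scoord h A = scoord h' A)"
proof
  assume "spec_class n L h = spec_class n L h'"
  then have "h \<in> spec_class n L h'" using assms spec_class_eq by blast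
  then show "\<forall>A\<in>Xi n d. scoord h A = scoord h' A" using assms spec_class_eq by blast
qed (use assms spec_class_eq in auto)

subsection \<open>The specialized algebra in coordinates\<close>

definition elt :: "(mat \<Rightarrow> lau1) \<Rightarrow> 'h spec_elt" where
  "elt p = spec_class n L (normal_form p)"

abbreviation "scalar_vector p \<equiv> (\<forall>A\<in>Xi n d. p A \<in> scalars)"

lemma spec_class_elt:
  assumes "h \<in> formal"
  shows "spec_class n L h = elt (scoord h)"
  unfolding elt_def using assms scoord_scalars[OF assms]
  by (subst spec_class_eq_iff) (auto simp: scoord_normal_form normal_form_formal)

lemma elt_eq_iff:
  assumes "scalar_vector p" "scalar_vector p'"
  shows "elt p = elt p' \<longleftrightarrow> (\<forall>A\<in>Xi n d. p A = p' A)"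
  unfolding elt_def using assms
  by (subst spec_class_eq_iff) (auto simp: scoord_normal_form normal_form_formal)

lemma rep_elt:
  assumes "scalar_vector p"
  shows "rep (elt p) \<in> formal" "A \<in> Xi n d \<Longrightarrow> scoord (rep (elt p)) A = p A"
proof -
  have nf: "normal_form p \<in> formal" using assms normal_form_formal by blast
  then have "normal_form p \<in> elt p" unfolding elt_def by (simp add: spec_class_eq)
  then have "rep (elt p) \<in> elt p" unfolding rep_def by (rule someI)
  then have "rep (elt p) \<in> formal \<and> (\<forall>A\<in>Xi n d. scoord (rep (elt p)) A = scoord (normal_form p) A)"
    unfolding elt_def spec_class_eq[OF nf] by blast
  then show "rep (elt p) \<in> formal" "A \<in> Xi n d \<Longrightarrow> scoord (rep (elt p)) A = p A"
    by (auto simp: scoord_normal_form)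
qed

lemma std_spec_elt:
  assumes "A \<in> Xi n d"
  shows "std_spec n L A = elt (\<lambda>B. if B = A then 1 else 0)"
proof -
  have f: "Poly_Mapping.single (std n A) 1 \<in> formal"
    by (rule formal_single[OF std_Schur_j[OF assms]]) simp
  have "scalar_vector (scoord (Poly_Mapping.single (std n A) 1))"
    using scoord_scalars[OF f] by blast
  then show ?thesis
    unfolding std_spec_def spec_class_elt[OF f]
    by (subst elt_eq_iff) (auto simp: scoord_single coord_std assms phi_hom)
qed

lemma Schur_j_spec_elt: "Schur_j_spec n L = {elt p | p. scalar_vector p}"
proof (intro set_eqI iffI)
  fix X assume "X \<in> Schur_j_spec n L"
  then show "X \<in> {elt p | p. scalar_vector p}"
    using spec_class_elt scoord_scalars unfolding Schur_j_spec_def by blast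
next
  fix X assume "X \<in> {elt p | p. scalar_vector p}"
  then show "X \<in> Schur_j_spec n L"
    using normal_form_formal unfolding Schur_j_spec_def elt_def by blast
qed

lemma Schur_i_spec_elt:
  "Schur_i_spec n L = {elt p | p. scalar_vector p \<and> (\<forall>A\<in>Xi n d. A \<notin> Xi_i n d \<longrightarrow> p A = 0)}"
proof (intro set_eqI iffI)
  fix X assume "X \<in> Schur_i_spec n L"
  then obtain h where h: "h \<in> bc_free (Schur_i n) scalars" "X = spec_class n L h"
    unfolding Schur_i_spec_def by blast
  have hf: "h \<in> formal" using h(1) Schur_i_iff by (auto simp: bc_free_def)
  have "scoord h A = 0" if "A \<in> Xi n d" "A \<notin> Xi_i n d" for A
    unfolding scoord_def using h(1) that Schur_i_iff
    by (intro sum.neutral ballI) (auto simp: bc_free_def phi_hom)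
  then show "X \<in> {elt p | p. scalar_vector p \<and> (\<forall>A\<in>Xi n d. A \<notin> Xi_i n d \<longrightarrow> p A = 0)}"
    using h(2) spec_class_elt[OF hf] scoord_scalars[OF hf] by blast
next
  fix X assume "X \<in> {elt p | p. scalar_vector p \<and> (\<forall>A\<in>Xi n d. A \<notin> Xi_i n d \<longrightarrow> p A = 0)}"
  then obtain p where p: "X = elt p" "scalar_vector p"
    "\<And>A. A \<in> Xi n d \<Longrightarrow> A \<notin> Xi_i n d \<Longrightarrow> p A = 0" by blast
  have "Poly_Mapping.single (std n A) (p A) \<in> bc_free (Schur_i n) scalars" if A: "A \<in> Xi n d" for A
  proof (cases "A \<in> Xi_i n d")
    case True
    then have "std n A \<in> Schur_i n"
      unfolding Schur_i_iff using std_Schur_j[OF A] coord_std[OF A] by auto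
    then show ?thesis using p(2) A by (auto simp: bc_free_def lookup_single when_def)
  next
    case False
    then show ?thesis using p(3)[OF A] by (simp add: bc_free_def)
  qed
  then have "normal_form p \<in> bc_free (Schur_i n) scalars"
    unfolding normal_form_def by (rule bc_free_sum)
  then show "X \<in> Schur_i_spec n L"
    unfolding Schur_i_spec_def p(1) elt_def by blast
qed

text \<open>In the next two lemmas the choice of representatives does not matter, because only their
  coordinates enter.\<close>

lemma bar_spec_elt:
  assumes p: "scalar_vector p"
  shows "bar_spec n L (elt p) = elt (\<lambda>C. \<Sum>B\<in>Xi n d. lau_bar (p B) * phi (bar_matrix n B C))"
proof -
  let ?h = "rep (elt p)"
  let ?K = "Poly_Mapping.keys ?h" and ?l = "Poly_Mapping.lookup ?h"
  let ?b = "\<Sum>f\<in>?K. Poly_Mapping.single (sbar n f) (lau_bar (?l f))"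
  have h: "?h \<in> formal" by (rule rep_elt(1)[OF p])
  then have S: "f \<in> Schur_j n" if "f \<in> ?K" for f using that by (auto simp: bc_free_def)
  have b: "?b \<in> formal"
    using h S sbar(1) by (intro bc_free_sum formal_single lau_sub_bar) (auto simp: bc_free_def)
  have "scoord ?b C = (\<Sum>B\<in>Xi n d. lau_bar (p B) * phi (bar_matrix n B C))" for C
  proof -
    have "scoord ?b C = (\<Sum>f\<in>?K. \<Sum>B\<in>Xi n d.
        lau_bar (?l f * phi (coord n f B)) * phi (bar_matrix n B C))"
      unfolding scoord_sum scoord_single
    proof (rule sum.cong[OF refl])
      fix f assume f: "f \<in> ?K"
      show "lau_bar (?l f) * phi (coord n (sbar n f) C) =
          (\<Sum>B\<in>Xi n d. lau_bar (?l f * phi (coord n f B)) * phi (bar_matrix n B C))"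
        unfolding coord_sbar[OF S[OF f]]
        by (simp add: phi_hom lau_bar_mult sum_distrib_left mult.assoc)
    qed
    also have "\<dots> = (\<Sum>B\<in>Xi n d. lau_bar (scoord ?h B) * phi (bar_matrix n B C))"
      unfolding scoord_def lau_bar_sum sum_distrib_right by (rule sum.swap)
    also have "\<dots> = (\<Sum>B\<in>Xi n d. lau_bar (p B) * phi (bar_matrix n B C))"
      by (intro sum.cong refl) (simp add: rep_elt(2)[OF p])
    finally show ?thesis .
  qed
  then show ?thesis
    unfolding bar_spec_def spec_class_elt[OF b] by (metis ext)
qed

lemma lin_comb_elt:
  assumes X: "\<And>A. A \<in> I \<Longrightarrow> X A = elt (x A)" "\<And>A. A \<in> I \<Longrightarrow> scalar_vector (x A)"
    and p: "\<And>A. A \<in> I \<Longrightarrow> p A \<in> scalars"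
  shows "lin_comb n L I p X = elt (\<lambda>B. \<Sum>A\<in>I. p A * x A B)"
proof -
  let ?m = "\<lambda>A. Poly_Mapping.map (\<lambda>r. p A * r) (rep (X A))"
  have lm: "Poly_Mapping.lookup (Poly_Mapping.map (\<lambda>r. a * r) h) y = a * Poly_Mapping.lookup h y"
    for a :: lau1 and h :: "'h endo \<Rightarrow>\<^sub>0 lau1" and y
    by (simp add: Poly_Mapping.map.rep_eq when_def)
  have rep: "rep (X A) \<in> formal" if "A \<in> I" for A
    using that X rep_elt(1) by simp
  have km: "Poly_Mapping.keys (Poly_Mapping.map (\<lambda>r. a * r) h) \<subseteq> Poly_Mapping.keys h"
    for a :: lau1 and h :: "'h endo \<Rightarrow>\<^sub>0 lau1"
    by (auto simp: in_keys_iff lm)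
  have f: "?m A \<in> formal" if "A \<in> I" for A
    using rep[OF that] km[of "p A" "rep (X A)"] p[OF that]
    by (auto simp: bc_free_def lm intro!: lau_sub_mult)
  have sc: "scoord (?m A) B = p A * scoord (rep (X A)) B" for A B
    using scoord_superset[OF finite_keys km, of "p A" "rep (X A)" B]
    by (simp add: lm scoord_def sum_distrib_left mult.assoc)
  have fs: "(\<Sum>A\<in>I. ?m A) \<in> formal" by (rule bc_free_sum[OF f])
  have "scoord (\<Sum>A\<in>I. ?m A) B = (\<Sum>A\<in>I. p A * x A B)" if B: "B \<in> Xi n d" for B
    unfolding scoord_sum sc using X B by (intro sum.cong refl) (simp add: rep_elt(2))
  moreover have "scalar_vector (\<lambda>B. \<Sum>A\<in>I. p A * x A B)"
    using X(2) p by (auto intro!: lau_sub_sum lau_sub_mult)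
  ultimately show ?thesis
    unfolding lin_comb_def spec_class_elt[OF fs]
    using scoord_scalars[OF fs] by (subst elt_eq_iff) auto
qed

subsection \<open>Canonical bases\<close>

interpretation triangular_bar "Xi n d" "less_alg n" "corner_total n"
  "\<lambda>A B. phi (bar_matrix n A B)" "wt_gcd L"
proof
  show "finite (Xi n d)" by (rule finite_Xi)
  fix A B C assume A: "A \<in> Xi n d" and B: "B \<in> Xi n d" and C: "C \<in> Xi n d"
  show "less_alg n A B \<Longrightarrow> less_alg n B C \<Longrightarrow> less_alg n A C"
    by (rule less_alg_trans[OF A B C])
  show "less_alg n A B \<Longrightarrow> corner_total n A < corner_total n B"
    by (rule less_alg_corner_total[OF A B])
  show "phi (bar_matrix n A B) \<in> scalars" by (rule phi_scalars)
  show "phi (bar_matrix n A A) = 1" using bar_matrix_triangular(1)[OF A A] phi_hom(6) by simp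
  show "B = A \<or> less_alg n B A" if "phi (bar_matrix n A B) \<noteq> 0"
  proof (rule bar_matrix_triangular(2)[OF A B])
    show "bar_matrix n A B \<noteq> 0" using that phi_hom(5) by auto
  qed
  have "phi (\<Sum>B\<in>Xi n d. lau_bar (bar_matrix n A B) * bar_matrix n B C) = phi (if A = C then 1 else 0)"
    by (rule arg_cong[OF bar_matrix_involution[OF A C]])
  then show "(\<Sum>B\<in>Xi n d. lau_bar (phi (bar_matrix n A B)) * phi (bar_matrix n B C)) = (if A = C then 1 else 0)"
    by (simp add: phi_hom)
qed

text \<open>The coordinates that the definition of a canonical basis prescribes.\<close>

definition canonical_vector :: "mat \<Rightarrow> (mat \<Rightarrow> lau1) \<Rightarrow> bool" where
  "canonical_vector A x \<longleftrightarrow> x A = 1 \<and> (\<forall>B\<in>Xi n d. less_alg n B A \<longrightarrow> x B \<in> lau_neg (wt_gcd L)) \<and>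
     (\<forall>B. B \<notin> insert A {B \<in> Xi n d. less_alg n B A} \<longrightarrow> x B = 0) \<and> (\<forall>B\<in>Xi n d. vbar x B = x B)"

lemma canonical_vector_scalar: "canonical_vector A x \<Longrightarrow> scalar_vector x"
  unfolding canonical_vector_def using lau_neg_subset[of "wt_gcd L"]
  by (metis (mono_tags, lifting) insertE lau_sub_one lau_sub_zero mem_Collect_eq subsetD)

lemma bar_spec_vbar: "scalar_vector x \<Longrightarrow> bar_spec n L (elt x) = elt (vbar x)"
  unfolding bar_spec_elt vbar_def ..

lemma vbar_scalar: "scalar_vector x \<Longrightarrow> scalar_vector (vbar x)"
  unfolding vbar_def by (auto intro!: lau_sub_sum lau_sub_mult lau_sub_bar phi_scalars)

lemma lin_comb_std:
  assumes "S \<subseteq> Xi n d" "\<And>B. B \<in> S \<Longrightarrow> p B \<in> scalars"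
  shows "lin_comb n L S p (std_spec n L) = elt (\<lambda>B. if B \<in> S then p B else 0)"
proof -
  have fin: "finite S" using assms(1) finite_Xi finite_subset by blast
  have "lin_comb n L S p (std_spec n L) = elt (\<lambda>B. \<Sum>A\<in>S. p A * (if B = A then 1 else 0))"
    by (rule lin_comb_elt) (use assms std_spec_elt in auto)
  also have "(\<lambda>B. \<Sum>A\<in>S. p A * (if B = A then 1 else 0)) = (\<lambda>B. if B \<in> S then p B else 0)"
  proof
    fix B
    have "(\<Sum>A\<in>S. p A * (if B = A then 1 else 0)) = (\<Sum>A\<in>S. if B = A then p A else 0)"
      by (rule sum.cong) simp_all
    then show "(\<Sum>A\<in>S. p A * (if B = A then 1 else 0)) = (if B \<in> S then p B else 0)"
      by (simp only: sum.delta'[OF fin])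
  qed
  finally show ?thesis .
qed

text \<open>Both algebras are covered by letting \<open>J\<close> be a set of matrices that is closed downwards, and
  \<open>E\<close> the elements with coordinates supported on it.\<close>

context
  fixes J :: "mat set" and E :: "'h spec_elt set"
  assumes J: "J \<subseteq> Xi n d" "\<And>A B. A \<in> J \<Longrightarrow> B \<in> Xi n d \<Longrightarrow> less_alg n B A \<Longrightarrow> B \<in> J"
    and E: "E = {elt p | p. scalar_vector p \<and> (\<forall>A\<in>Xi n d. A \<notin> J \<longrightarrow> p A = 0)}"
begin

lemma lower_set: "A \<in> J \<Longrightarrow> {B \<in> J. less_alg n B A} = {B \<in> Xi n d. less_alg n B A}"
  using J by blast

lemma canonical_basisI:
  assumes b: "\<And>A. A \<in> J \<Longrightarrow> b A = elt (P A)" and P: "\<And>A. A \<in> J \<Longrightarrow> canonical_vector A (P A)"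
  shows "is_canonical_basis n L J E b"
proof -
  note sv = canonical_vector_scalar[OF P]
  have P1: "P A A = 1" if "A \<in> J" for A using P[OF that] by (simp add: canonical_vector_def)
  have P2: "B = A \<or> less_alg n B A" if "A \<in> J" "P A B \<noteq> 0" for A B
    using P[OF that(1)] that(2) unfolding canonical_vector_def by blast
  have off: "P A B = 0" if "A \<in> J" "B \<in> Xi n d" "B \<notin> J" for A B
    using P2[OF that(1), of B] J(2)[OF that(1,2)] that by blast
  have "is_basis n L J E b"
    unfolding is_basis_def
  proof (intro conjI ballI)
    fix A assume A: "A \<in> J"
    show "b A \<in> E" unfolding E b[OF A] using sv[OF A] off[OF A] by blast
  next
    fix X assume "X \<in> E"
    then obtain v where v: "X = elt v" "scalar_vector v" "\<And>A. A \<in> Xi n d \<Longrightarrow> A \<notin> J \<Longrightarrow> v A = 0"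
      unfolding E by blast
    have ex1: "\<exists>!p. (\<forall>A\<in>J. p A \<in> scalars) \<and> (\<forall>A. A \<notin> J \<longrightarrow> p A = 0) \<and>
        (\<forall>B\<in>J. v B = (\<Sum>A\<in>J. p A * (if A \<in> J then P A B else if A = B then 1 else 0)))"
    proof (rule unitriangular_ex1)
      fix A B assume "A \<in> Xi n d" "B \<in> Xi n d"
      then show "(if A \<in> J then P A B else if A = B then 1 else 0) \<in> scalars" using sv by auto
    qed (use P1 P2 J v(2) in \<open>auto split: if_splits\<close>)
    have eq: "(\<forall>B\<in>J. v B = (\<Sum>A\<in>J. p A * (if A \<in> J then P A B else if A = B then 1 else 0)))
        \<longleftrightarrow> X = lin_comb n L J p b" if p: "\<forall>A\<in>J. p A \<in> scalars" for p
    proof -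
      have "lin_comb n L J p b = elt (\<lambda>B. \<Sum>A\<in>J. p A * P A B)"
        by (rule lin_comb_elt) (use b sv p in auto)
      moreover have "scalar_vector (\<lambda>B. \<Sum>A\<in>J. p A * P A B)"
        using sv p by (auto intro!: lau_sub_sum lau_sub_mult)
      ultimately have "X = lin_comb n L J p b \<longleftrightarrow> (\<forall>B\<in>Xi n d. v B = (\<Sum>A\<in>J. p A * P A B))"
        using v(1) elt_eq_iff[OF v(2)] by simp
      also have "\<dots> \<longleftrightarrow> (\<forall>B\<in>J. v B = (\<Sum>A\<in>J. p A * P A B))"
      proof
        assume h: "\<forall>B\<in>J. v B = (\<Sum>A\<in>J. p A * P A B)"
        show "\<forall>B\<in>Xi n d. v B = (\<Sum>A\<in>J. p A * P A B)"
        proof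
          fix B assume B: "B \<in> Xi n d"
          show "v B = (\<Sum>A\<in>J. p A * P A B)"
          proof (cases "B \<in> J")
            case False
            then have "(\<Sum>A\<in>J. p A * P A B) = 0" using off B by (intro sum.neutral) auto
            then show ?thesis using v(3)[OF B False] by simp
          qed (use h in blast)
        qed
      qed (use J in blast)
      finally show ?thesis by simp
    qed
    have iff: "(\<forall>A\<in>J. p A \<in> scalars) \<and> (\<forall>A. A \<notin> J \<longrightarrow> p A = 0) \<and>
        (\<forall>B\<in>J. v B = (\<Sum>A\<in>J. p A * (if A \<in> J then P A B else if A = B then 1 else 0)))
      \<longleftrightarrow> (\<forall>A\<in>J. p A \<in> scalars) \<and> (\<forall>A. A \<notin> J \<longrightarrow> p A = 0) \<and> X = lin_comb n L J p b" for p
      using eq[of p] by argo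
    show "\<exists>!p. (\<forall>A\<in>J. p A \<in> scalars) \<and> (\<forall>A. A \<notin> J \<longrightarrow> p A = 0) \<and> X = lin_comb n L J p b"
      using ex1 unfolding iff .
  qed
  moreover have "bar_spec n L (b A) = b A" if A: "A \<in> J" for A
    unfolding b[OF A] bar_spec_vbar[OF sv[OF A]]
    using P[OF A] elt_eq_iff[OF vbar_scalar[OF sv[OF A]] sv[OF A]]
    by (simp add: canonical_vector_def)
  moreover have "\<exists>p. p A = 1 \<and> (\<forall>B\<in>J. less_alg n B A \<longrightarrow> p B \<in> lau_neg (wt_gcd L)) \<and>
      b A = lin_comb n L (insert A {B \<in> J. less_alg n B A}) p (std_spec n L)" if A: "A \<in> J" for A
  proof (intro exI[of _ "P A"] conjI)
    let ?S = "insert A {B \<in> J. less_alg n B A}"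
    have S: "?S \<subseteq> Xi n d" using A J by blast
    have "(\<lambda>B. if B \<in> ?S then P A B else 0) = P A"
      using P[OF A] unfolding lower_set[OF A] canonical_vector_def by (auto simp: fun_eq_iff)
    then show "b A = lin_comb n L ?S (P A) (std_spec n L)"
      using lin_comb_std[OF S, of "P A"] sv[OF A] S b[OF A] by auto
  qed (use P[OF A] J in \<open>auto simp: canonical_vector_def\<close>)
  ultimately show ?thesis unfolding is_canonical_basis_def by blast
qed

lemma canonical_basisD:
  assumes b: "is_canonical_basis n L J E b" and A: "A \<in> J"
  shows "\<exists>x. canonical_vector A x \<and> b A = elt x"
proof -
  let ?S = "insert A {B \<in> J. less_alg n B A}"
  obtain p where p: "p A = 1" "\<And>B. B \<in> J \<Longrightarrow> less_alg n B A \<Longrightarrow> p B \<in> lau_neg (wt_gcd L)"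
    "b A = lin_comb n L ?S p (std_spec n L)" and bar: "bar_spec n L (b A) = b A"
    using b A unfolding is_canonical_basis_def by blast
  let ?x = "\<lambda>B. if B \<in> ?S then p B else 0"
  have S: "?S \<subseteq> Xi n d" using A J by blast
  have ps: "p B \<in> scalars" if "B \<in> ?S" for B
    using that p lau_neg_subset[of "wt_gcd L"] by auto
  have bx: "b A = elt ?x" unfolding p(3) by (rule lin_comb_std[OF S ps])
  have sv: "scalar_vector ?x" using ps by auto
  have "elt (vbar ?x) = elt ?x" using bar unfolding bx bar_spec_vbar[OF sv] .
  then have "\<forall>B\<in>Xi n d. vbar ?x B = ?x B" using elt_eq_iff[OF vbar_scalar[OF sv] sv] by blast
  then have "canonical_vector A ?x"
    unfolding canonical_vector_def using p(1,2) J(2)[OF A] unfolding lower_set[OF A] by auto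
  with bx show ?thesis by blast
qed

text \<open>With \<open>wt_gcd L = 0\<close> the prescribed coefficients are arbitrary integers, and uniqueness
  can fail.\<close>

lemma canonical_basis_unique:
  assumes "wt_gcd L > 0" "is_canonical_basis n L J E b" "is_canonical_basis n L J E b'" "A \<in> J"
  shows "b A = b' A"
proof -
  obtain x y where x: "canonical_vector A x" "b A = elt x" and y: "canonical_vector A y" "b' A = elt y"
    using canonical_basisD[OF assms(2,4)] canonical_basisD[OF assms(3,4)] by blast
  have A: "A \<in> Xi n d" using assms(4) J by blast
  have "x B = y B" if "B \<in> Xi n d" for B
    by (rule bar_invariant_unique[OF assms(1) A _ _ _ _ _ _ _ _ that])
      (use x(1) y(1) in \<open>unfold canonical_vector_def, blast+\<close>)
  then show ?thesis
    using elt_eq_iff[OF canonical_vector_scalar[OF x(1)] canonical_vector_scalar[OF y(1)]] x y by simp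
qed

end

lemma Schur_j_spec_elt': "Schur_j_spec n L =
    {elt p | p. scalar_vector p \<and> (\<forall>A\<in>Xi n d. A \<notin> Xi n d \<longrightarrow> p A = 0)}"
  unfolding Schur_j_spec_elt by blast

lemma Xi_i_subset: "Xi_i n d \<subseteq> Xi n d"
  by (auto simp: Xi_i_def)

lemma canonical_j_exists: "\<exists>b. canonical_j n L b"
proof -
  have "\<forall>A\<in>Xi n d. \<exists>x. canonical_vector A x"
    unfolding canonical_vector_def using bar_invariant_exists by blast
  then obtain P where P: "\<And>A. A \<in> Xi n d \<Longrightarrow> canonical_vector A (P A)" by metis
  have "canonical_j n L (\<lambda>A. elt (P A))"
    unfolding canonical_j_def
    by (rule canonical_basisI[OF order_refl _ Schur_j_spec_elt' _ P]) auto
  then show ?thesis by blast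
qed

text \<open>Matrices below an element of \<open>Xi_i n d\<close> have the same row and column sums, so they also belong
  to \<open>Xi_i n d\<close>. A canonical basis of the large algebra therefore restricts to the small one,
  and an element with leading term outside of \<open>Xi_i n d\<close> does not belong to the small
  algebra.\<close>

lemma canonical_i_of_canonical_j:
  assumes b: "canonical_j n L b"
  shows "canonical_i n L b" "b ` Xi_i n d = b ` Xi n d \<inter> Schur_i_spec n L"
proof -
  have "\<forall>A\<in>Xi n d. \<exists>x. canonical_vector A x \<and> b A = elt x"
    using canonical_basisD[OF order_refl _ Schur_j_spec_elt' b[unfolded canonical_j_def]] by blast
  then obtain P where P: "\<And>A. A \<in> Xi n d \<Longrightarrow> canonical_vector A (P A)"
    "\<And>A. A \<in> Xi n d \<Longrightarrow> b A = elt (P A)" by metis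
  have down: "B \<in> Xi_i n d" if "A \<in> Xi_i n d" "B \<in> Xi n d" "less_alg n B A" for A B
    using Xi_i_down that by blast
  show "canonical_i n L b"
    unfolding canonical_i_def
    by (rule canonical_basisI[OF Xi_i_subset down Schur_i_spec_elt]) (use P Xi_i_subset in blast)+
  show "b ` Xi_i n d = b ` Xi n d \<inter> Schur_i_spec n L"
  proof (intro set_eqI iffI)
    fix X assume "X \<in> b ` Xi_i n d"
    then obtain A where A: "A \<in> Xi_i n d" "X = b A" by blast
    then have AX: "A \<in> Xi n d" using Xi_i_subset by blast
    have "P A B = 0" if "B \<in> Xi n d" "B \<notin> Xi_i n d" for B
    proof -
      have "B \<notin> insert A {B \<in> Xi n d. less_alg n B A}" using that down[OF A(1)] A(1) by blast
      then show ?thesis using P(1)[OF AX] unfolding canonical_vector_def by blast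
    qed
    then have "b A \<in> Schur_i_spec n L"
      unfolding Schur_i_spec_elt P(2)[OF AX] using canonical_vector_scalar[OF P(1)[OF AX]] by blast
    then show "X \<in> b ` Xi n d \<inter> Schur_i_spec n L" using A AX by blast
  next
    fix X assume "X \<in> b ` Xi n d \<inter> Schur_i_spec n L"
    then obtain A p where A: "A \<in> Xi n d" "X = b A" "X = elt p" "scalar_vector p"
      "\<And>A. A \<in> Xi n d \<Longrightarrow> A \<notin> Xi_i n d \<Longrightarrow> p A = 0"
      unfolding Schur_i_spec_elt by blast
    then have "p A = P A A"
      using elt_eq_iff[OF A(4) canonical_vector_scalar[OF P(1)[OF A(1)]]] P(2)[OF A(1)] by auto
    then have "p A \<noteq> 0" using P(1)[OF A(1)] by (simp add: canonical_vector_def)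
    then show "X \<in> b ` Xi_i n d" using A by blast
  qed
qed

lemma canonical_j_unique:
  "wt_gcd L > 0 \<Longrightarrow> canonical_j n L b \<Longrightarrow> canonical_j n L b' \<Longrightarrow> A \<in> Xi n d \<Longrightarrow> b A = b' A"
  unfolding canonical_j_def
  by (rule canonical_basis_unique[OF order_refl _ Schur_j_spec_elt'])

lemma canonical_i_unique:
  "wt_gcd L > 0 \<Longrightarrow> canonical_i n L b \<Longrightarrow> canonical_i n L b' \<Longrightarrow> A \<in> Xi_i n d \<Longrightarrow> b A = b' A"
  unfolding canonical_i_def
  by (rule canonical_basis_unique[OF Xi_i_subset Xi_i_down Schur_i_spec_elt])

end

end

theorem theorem6p2p2:
  fixes n d :: nat
    and scale :: "lau2 \<Rightarrow> 'h::ring_1 \<Rightarrow> 'h"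
    and T :: "(int \<Rightarrow> int) \<Rightarrow> 'h"
    and L :: "(int \<Rightarrow> int) \<Rightarrow> nat"
  assumes "hecke_algebra scale d T"
    and "weight_function d L"
  shows
    "(\<exists>bj. hecke_algebra.canonical_j scale d T n L bj) \<and>
     (\<forall>bj. hecke_algebra.canonical_j scale d T n L bj \<longrightarrow>
        (\<exists>bi. hecke_algebra.canonical_i scale d T n L bi \<and>
           bi ` Xi_i n d = bj ` Xi n d \<inter> hecke_algebra.Schur_i_spec scale d T n L)) \<and>
     (gcd (L (sgen 0)) (L (sgen 1)) > 0 \<longrightarrow>
        (\<forall>b b'. hecke_algebra.canonical_j scale d T n L b \<and>
           hecke_algebra.canonical_j scale d T n L b' \<longrightarrow> (\<forall>A\<in>Xi n d. b A = b' A)) \<and>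
        (\<forall>b b'. hecke_algebra.canonical_i scale d T n L b \<and>
           hecke_algebra.canonical_i scale d T n L b' \<longrightarrow> (\<forall>A\<in>Xi_i n d. b A = b' A)))"
proof -
  interpret hecke_algebra scale d T by fact
  show ?thesis
  proof (intro conjI allI impI)
    show "\<exists>bj. canonical_j n L bj" by (rule canonical_j_exists)
    fix bj assume "canonical_j n L bj"
    from canonical_i_of_canonical_j[OF this]
    show "\<exists>bi. canonical_i n L bi \<and> bi ` Xi_i n d = bj ` Xi n d \<inter> Schur_i_spec n L" by blast
  next
    fix b b' assume c: "gcd (L (sgen 0)) (L (sgen 1)) > 0"
    show "\<forall>A\<in>Xi n d. b A = b' A" if "canonical_j n L b \<and> canonical_j n L b'"
      using canonical_j_unique[of L n b b'] that c unfolding wt_gcd_def by blast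
    show "\<forall>A\<in>Xi_i n d. b A = b' A" if "canonical_i n L b \<and> canonical_i n L b'"
      using canonical_i_unique[of L n b b'] that c unfolding wt_gcd_def by blast
  qed
qed

end
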